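(* Let $\Sigma\in\mathbb{R}^{p\times p}$ be a covariance matrix invariant under a subgroup $\mathfrak{G}$ of the symmetric group on $\{1,\dots,p\}$, with spectral norm $\psi=\|\Sigma\|$, where $\psi$ is a constant (independent of $p,n$). Let $\hat\Sigma=\mathcal{P}_{\mathfrak{G}}(\Sigma^n)$, where $\Sigma^n$ is the empirical covariance matrix of $n$ i.i.d. samples from $\mathcal{N}(0,\Sigma)$, and let $s_i,m_i$ ($i\in\mathcal{I}$) be the block sizes and block multiplicities associated to $\mathfrak{G}$. (a) For $0<\delta\le8\psi$, one has $\|\Sigma-\hat\Sigma\|\le\delta$ with probability exceeding $1-\frac1{p^c}$, for some constant $c$, provided $$n\ge C_1\max\left\{\max_{i\in\mathcal{I}}\frac{s_i}{m_i\delta^2},\ \max_{i\in\mathcal{I}}\frac{\log p}{m_i\delta^2}\right\}$$ for some constant $C_1$. (b) For $0<\delta\le8\psi$, one has $\|\Sigma-\hat\Sigma\|_F\le\delta$ with probability exceeding $1-\frac1{p^c}$, for some constant $c$, provided $$n\ge C_2\max\left\{\max_{i\in\mathcal{I}}\frac{s_i\,p}{m_i\delta^2},\ \max_{i\in\mathcal{I}}\frac{p\log p}{m_i\delta^2}\right\}$$ for some constant $C_2$. (That is, there exist positive constants $c,C_1,C_2$, independent of $p,n$, for which these assertions hold.)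
   Context: For $g\in\mathfrak{G}$, $\Pi_g\in\mathbb{R}^{p\times p}$ is the permutation matrix of $g$. A matrix $M$ is $\mathfrak{G}$-invariant if $\Pi_g M\Pi_g^T=M$ for all $g\in\mathfrak{G}$; $\mathcal{W}_{\mathfrak{G}}\subseteq\mathbb{R}^{p\times p}$ is the subspace of all invariant matrices, and $\mathcal{P}_{\mathfrak{G}}$ is the Euclidean (Frobenius-orthogonal) projection onto $\mathcal{W}_{\mathfrak{G}}$. $\Sigma^n=\frac1n\sum_{k=1}^n X^{(k)}(X^{(k)})^T$. $\|\cdot\|$ is the spectral norm, $\|\cdot\|_F$ the Frobenius norm. Group parameters: let $\mathcal{I}$ index the (pairwise inequivalent) complex irreducible representations of $\mathfrak{G}$ that occur in the permutation representation $g\mapsto\Pi_g$ on $\mathbb{C}^p$. By Schur's lemma there is a unitary matrix $T\in\mathbb{C}^{p\times p}$ depending only on $\mathfrak{G}$ such that for every $M\in\mathcal{W}_{\mathfrak{G}}$, $T^*MT=\mathrm{diag}(M_i)_{i\in\mathcal{I}}$, where each $M_i=\mathrm{diag}(B_i,\dots,B_i)$ consists of $m_i$ identical copies of a block $B_i$ of size $s_i\times s_i$. The parameters $s_i$ (block sizes) and $m_i$ (number of repetitions of the block) are those of this decomposition; i.e. $m_i$ is the dimension of the $i$-th irreducible representation and $s_i$ the number of times it occurs in the permutation representation. (For example, for the full symmetric group: $|\mathcal{I}|=2$, $s_1=m_1=1$, $s_2=1$, $m_2=p-1$.) *)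

theory Defs
  imports
    "HOL-Algebra.Sym_Groups"
    "HOL-Probability.Probability"
    "Jordan_Normal_Form.Schur_Decomposition"
    "Jordan_Normal_Form.VS_Connect"
begin

text \<open>
  The dimension \<open>p\<close> has to be quantified under the constants of the theorem, so vectors and
  matrices are those of \<open>Jordan_Normal_Form\<close>. Their entries are indexed from \<open>0\<close>, whereas
  \<open>sym_group p\<close> acts on \<open>{1..p}\<close>; hence the shift in \<open>perm_mat\<close>.
\<close>

definition perm_mat :: "nat \<Rightarrow> (nat \<Rightarrow> nat) \<Rightarrow> 'a::semiring_1 mat" where
  "perm_mat p g = mat p p (\<lambda>(i, j). if g (Suc j) = Suc i then 1 else 0)"

definition invariant_mats :: "nat \<Rightarrow> (nat \<Rightarrow> nat) set \<Rightarrow> real mat set" where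
  "invariant_mats p G =
     {M \<in> carrier_mat p p. \<forall>g\<in>G. perm_mat p g * M * transpose_mat (perm_mat p g) = M}"

definition frob_inner :: "real mat \<Rightarrow> real mat \<Rightarrow> real" where
  "frob_inner A B = (\<Sum>i<dim_row A. \<Sum>j<dim_col A. A $$ (i, j) * B $$ (i, j))"

definition frob_norm :: "real mat \<Rightarrow> real" where
  "frob_norm A = sqrt (frob_inner A A)"

definition euclid_norm :: "real vec \<Rightarrow> real" where
  "euclid_norm v = sqrt (scalar_prod v v)"

definition spectral_norm :: "real mat \<Rightarrow> real" where
  "spectral_norm A =
     (SUP v\<in>{v \<in> carrier_vec (dim_col A). euclid_norm v \<le> 1}. euclid_norm (A *\<^sub>v v))"

definition invariant_proj :: "nat \<Rightarrow> (nat \<Rightarrow> nat) set \<Rightarrow> real mat \<Rightarrow> real mat" where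
  "invariant_proj p G M =
     (THE Q. Q \<in> invariant_mats p G \<and> (\<forall>W\<in>invariant_mats p G. frob_inner (M - Q) W = 0))"

definition matrix_rep :: "(nat \<Rightarrow> nat) set \<Rightarrow> nat \<Rightarrow> ((nat \<Rightarrow> nat) \<Rightarrow> complex mat) \<Rightarrow> bool" where
  "matrix_rep G d \<rho> \<longleftrightarrow>
     (\<forall>g\<in>G. \<rho> g \<in> carrier_mat d d) \<and> \<rho> id = 1\<^sub>m d \<and>
     (\<forall>g\<in>G. \<forall>h\<in>G. \<rho> (g \<circ> h) = \<rho> g * \<rho> h)"

definition irreducible_rep :: "(nat \<Rightarrow> nat) set \<Rightarrow> nat \<Rightarrow> ((nat \<Rightarrow> nat) \<Rightarrow> complex mat) \<Rightarrow> bool" where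
  "irreducible_rep G d \<rho> \<longleftrightarrow>
     matrix_rep G d \<rho> \<and> d > 0 \<and>
     (\<forall>W. VectorSpace.subspace class_ring W (module_vec TYPE(complex) d) \<and>
          (\<forall>g\<in>G. \<forall>w\<in>W. \<rho> g *\<^sub>v w \<in> W) \<longrightarrow>
          W = {0\<^sub>v d} \<or> W = carrier_vec d)"

definition equivalent_reps ::
  "(nat \<Rightarrow> nat) set \<Rightarrow> nat \<Rightarrow> ((nat \<Rightarrow> nat) \<Rightarrow> complex mat) \<Rightarrow> nat \<Rightarrow> ((nat \<Rightarrow> nat) \<Rightarrow> complex mat) \<Rightarrow> bool"
  where
  "equivalent_reps G d \<rho> d' \<rho>' \<longleftrightarrow>
     d = d' \<and> (\<exists>S\<in>carrier_mat d d. invertible_mat S \<and> (\<forall>g\<in>G. \<rho> g * S = S * \<rho>' g))"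

definition unitary_mat :: "nat \<Rightarrow> complex mat \<Rightarrow> bool" where
  "unitary_mat p T \<longleftrightarrow>
     T \<in> carrier_mat p p \<and> mat_adjoint T * T = 1\<^sub>m p \<and> T * mat_adjoint T = 1\<^sub>m p"

definition kron_one :: "complex mat \<Rightarrow> nat \<Rightarrow> complex mat" where
  "kron_one A s = mat (dim_row A * s) (dim_col A * s)
     (\<lambda>(i, j). if i mod s = j mod s then A $$ (i div s, j div s) else 0)"

text \<open>
  The index set of the irreducible constituents is \<open>{..<r}\<close>. The matrices \<open>kron_one (\<rho> i g) (s i)\<close>
  say that \<open>T\<close> splits the permutation representation into \<open>s i\<close> copies of each \<open>\<rho> i\<close>; the copies
  are interleaved, because this is the ordering of the columns of \<open>T\<close> in which an invariant matrix
  becomes block diagonal with \<open>m i\<close> equal consecutive blocks \<open>B i\<close>. The last conjunct follows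
  from the others by Schur's lemma; it is the form in which \<open>s\<close> and \<open>m\<close> are introduced as block
  size and multiplicity. The pairs \<open>(m i, s i)\<close> are determined by \<open>G\<close> up to reordering.
\<close>

definition block_decomposition ::
  "nat \<Rightarrow> (nat \<Rightarrow> nat) set \<Rightarrow> nat \<Rightarrow> (nat \<Rightarrow> nat) \<Rightarrow> (nat \<Rightarrow> nat) \<Rightarrow>
   (nat \<Rightarrow> (nat \<Rightarrow> nat) \<Rightarrow> complex mat) \<Rightarrow> complex mat \<Rightarrow> bool" where
  "block_decomposition p G r s m \<rho> T \<longleftrightarrow>
     (\<forall>i<r. s i > 0 \<and> irreducible_rep G (m i) (\<rho> i)) \<and>
     (\<forall>i<r. \<forall>j<r. i \<noteq> j \<longrightarrow> \<not> equivalent_reps G (m i) (\<rho> i) (m j) (\<rho> j)) \<and>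
     unitary_mat p T \<and>
     (\<forall>g\<in>G. mat_adjoint T * perm_mat p g * T =
        diag_block_mat (map (\<lambda>i. kron_one (\<rho> i g) (s i)) [0..<r])) \<and>
     (\<forall>M\<in>invariant_mats p G. \<exists>B. (\<forall>i<r. B i \<in> carrier_mat (s i) (s i)) \<and>
        mat_adjoint T * map_mat complex_of_real M * T =
        diag_block_mat (map (\<lambda>i. diag_block_mat (replicate (m i) (B i))) [0..<r]))"

definition block_params ::
  "nat \<Rightarrow> (nat \<Rightarrow> nat) set \<Rightarrow> nat \<Rightarrow> (nat \<Rightarrow> nat) \<Rightarrow> (nat \<Rightarrow> nat) \<Rightarrow> bool" where
  "block_params p G r s m \<longleftrightarrow> (\<exists>\<rho> T. block_decomposition p G r s m \<rho> T)"

definition covariance_mat :: "nat \<Rightarrow> real mat \<Rightarrow> bool" where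
  "covariance_mat p \<Sigma> \<longleftrightarrow>
     \<Sigma> \<in> carrier_mat p p \<and> transpose_mat \<Sigma> = \<Sigma> \<and>
     (\<forall>v\<in>carrier_vec p. scalar_prod v (\<Sigma> *\<^sub>v v) \<ge> 0)"

definition normal_law :: "real \<Rightarrow> real \<Rightarrow> real measure" where
  "normal_law \<mu> v =
     (if v = 0 then return borel \<mu> else density lborel (\<lambda>x. ennreal (normal_density \<mu> (sqrt v) x)))"

text \<open>
  The centred normal law with covariance \<open>\<Sigma>\<close>, possibly degenerate, as a measure on \<open>\<real>\<^sup>p\<close>
  (realised as \<open>PiM {..<p} (\<lambda>_. borel)\<close>): every linear functional \<open>x \<mapsto> a \<bullet> x\<close> has law
  \<open>N(0, a \<bullet> \<Sigma> a)\<close>.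
\<close>

definition centered_normal :: "nat \<Rightarrow> real mat \<Rightarrow> (nat \<Rightarrow> real) measure \<Rightarrow> bool" where
  "centered_normal p \<Sigma> \<mu> \<longleftrightarrow>
     prob_space \<mu> \<and> sets \<mu> = sets (PiM {..<p} (\<lambda>_. borel)) \<and>
     (\<forall>a\<in>carrier_vec p.
        distr \<mu> borel (\<lambda>x. scalar_prod a (vec p x)) = normal_law 0 (scalar_prod a (\<Sigma> *\<^sub>v a)))"

text \<open>
  \<open>X\<close> ranges over \<open>PiM {..<n} (\<lambda>_. \<mu>)\<close>, the joint law of \<open>n\<close> independent samples \<open>X k\<close> from \<open>\<mu>\<close>.
\<close>

definition empirical_cov :: "nat \<Rightarrow> nat \<Rightarrow> (nat \<Rightarrow> nat \<Rightarrow> real) \<Rightarrow> real mat" where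
  "empirical_cov p n X = mat p p (\<lambda>(i, j). (1 / real n) * (\<Sum>k<n. X k i * X k j))"

end

theory Submission
  imports Defs
begin

text \<open>
  The error \<open>D = \<Sigma> - P(\<Sigma>\<^sup>n)\<close> is an invariant matrix, so the unitary \<open>T\<close> turns it into \<open>m i\<close> copies of
  one Hermitian block \<open>B i\<close> of size \<open>s i\<close> for every \<open>i\<close>, and its spectral norm is the largest norm of
  these blocks. The norm of \<open>B i\<close> is controlled by the values \<open>u\<^sup>* (B i) u\<close> at the points \<open>u\<close> of a net
  whose size is exponential in \<open>s i\<close> (\<open>form_bound_from_grid_net\<close>, \<open>card_grid_net\<close>).

  The factor \<open>m i\<close> in the sample size comes from averaging over the copies. Let \<open>x k\<close> be the vector
  with coordinates \<open>u\<close> in the \<open>k\<close>-th copy of the \<open>i\<close>-th block. Then \<open>m i\<close> times \<open>u\<^sup>* (B i) u\<close> is the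
  inner product of \<open>D\<close> with \<open>W = \<Sum>k. x k (x k)\<^sup>*\<close>. As the representation matrices are unitary,
  \<open>W\<close> is invariant (\<open>test_gram_invariant\<close>); an orthogonal projection onto the invariant matrices
  leaves inner products with \<open>W\<close> unchanged, so \<open>D\<close> may be replaced by \<open>\<Sigma> - \<Sigma>\<^sup>n\<close>. What remains is
  the centred mean over the samples of the Gaussian quadratic form \<open>Q(X) = \<Sum>k. |(x k)\<^sup>* X|\<^sup>2\<close>, whose
  rank is at most \<open>2 m i\<close> and which, in independent standard normal variables, has norm at most \<open>\<psi>\<close>. Hence \<open>Q\<close> fluctuates by
  \<open>\<psi> sqrt (m i)\<close> only, and its mean over \<open>n\<close> samples deviates by \<open>m i \<delta> / 4\<close> with probability at most
  \<open>2 exp (- n m i \<delta>\<^sup>2 / (896 \<psi>\<^sup>2))\<close> (\<open>empirical_statistic_tail\<close>). A union bound over the nets and over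
  \<open>i < r \<le> p\<close> yields (a). Part (b) is (a) for \<open>\<delta> / sqrt p\<close>, because the Frobenius norm is at most
  \<open>sqrt p\<close> times the spectral norm.

  The law of a sample is given by its one-dimensional marginals. The exponential moments of \<open>Q\<close> are
  obtained from these by linearising every square with an auxiliary standard normal variable
  (\<open>gaussian_family_exp_square_sum\<close>). This leads to a quadratic form in independent standard normal
  variables, which is estimated by integrating out one variable after the other
  (\<open>gaussian_chaos_exp_bound\<close>).

  All estimates are carried out over the reals: a complex vector \<open>u\<close> of length \<open>d\<close> is a real vector
  indexed by \<open>{..<d} \<times> UNIV\<close>, the boolean selecting the real or the imaginary part.
\<close>

section \<open>Quadratic forms and a net of the unit ball\<close>

definition bilin :: "'i set \<Rightarrow> ('i \<Rightarrow> 'i \<Rightarrow> real) \<Rightarrow> ('i \<Rightarrow> real) \<Rightarrow> ('i \<Rightarrow> real) \<Rightarrow> real" where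
  "bilin I S x y = (\<Sum>i\<in>I. \<Sum>j\<in>I. S i j * x i * y j)"

definition sq_norm :: "'i set \<Rightarrow> ('i \<Rightarrow> real) \<Rightarrow> real" where
  "sq_norm I x = (\<Sum>i\<in>I. (x i)\<^sup>2)"

lemma sq_norm_nonneg [simp]: "sq_norm I x \<ge> 0"
  by (simp add: sq_norm_def sum_nonneg)

lemma sq_norm_scale: "sq_norm I (\<lambda>i. c * x i) = c\<^sup>2 * sq_norm I x"
  by (simp add: sq_norm_def power_mult_distrib sum_distrib_left)

lemma bilin_add_left: "bilin I S (\<lambda>i. x i + x' i) y = bilin I S x y + bilin I S x' y"
  by (simp add: bilin_def algebra_simps sum.distrib)

lemma bilin_add_right: "bilin I S x (\<lambda>i. y i + y' i) = bilin I S x y + bilin I S x y'"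
  by (simp add: bilin_def algebra_simps sum.distrib)

lemma bilin_diff_left: "bilin I S (\<lambda>i. x i - x' i) y = bilin I S x y - bilin I S x' y"
  by (simp add: bilin_def algebra_simps sum_subtractf)

lemma bilin_diff_right: "bilin I S x (\<lambda>i. y i - y' i) = bilin I S x y - bilin I S x y'"
  by (simp add: bilin_def algebra_simps sum_subtractf)

lemma bilin_scale_left: "bilin I S (\<lambda>i. c * x i) y = c * bilin I S x y"
  by (simp add: bilin_def algebra_simps sum_distrib_left)

lemma bilin_scale_right: "bilin I S x (\<lambda>i. c * y i) = c * bilin I S x y"
  by (simp add: bilin_def algebra_simps sum_distrib_left)

lemma bilin_commute:
  fixes S :: "'i \<Rightarrow> 'i \<Rightarrow> real"
  assumes "\<And>i j. i \<in> I \<Longrightarrow> j \<in> I \<Longrightarrow> S i j = S j i"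
  shows "bilin I S x y = bilin I S y x"
  unfolding bilin_def
  by (subst sum.swap, intro sum.cong refl) (simp add: assms mult.commute mult.left_commute)

text \<open>
  Polarisation and the parallelogram law. With the sum on the right instead of the
  product of the two norms, the scaling of \<open>y\<close> is left to the applications.
\<close>

lemma bilin_polarisation_bound:
  fixes S :: "'i \<Rightarrow> 'i \<Rightarrow> real"
  assumes sym: "\<And>i j. i \<in> I \<Longrightarrow> j \<in> I \<Longrightarrow> S i j = S j i"
    and bd: "\<And>x. \<bar>bilin I S x x\<bar> \<le> \<kappa> * sq_norm I x"
  shows "\<bar>bilin I S x y\<bar> \<le> \<kappa> / 2 * (sq_norm I x + sq_norm I y)"
proof -
  have par: "sq_norm I (\<lambda>i. x i + y i) + sq_norm I (\<lambda>i. x i - y i) = 2 * (sq_norm I x + sq_norm I y)"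
    by (simp add: sq_norm_def power2_eq_square algebra_simps sum.distrib sum_subtractf sum_distrib_left)
  have pol: "bilin I S (\<lambda>i. x i + y i) (\<lambda>i. x i + y i) - bilin I S (\<lambda>i. x i - y i) (\<lambda>i. x i - y i)
      = 4 * bilin I S x y"
    using bilin_commute[of I S y x, OF sym]
    by (simp add: bilin_add_left bilin_add_right bilin_diff_left bilin_diff_right)
  have "4 * \<bar>bilin I S x y\<bar> \<le> \<bar>bilin I S (\<lambda>i. x i + y i) (\<lambda>i. x i + y i)\<bar> + \<bar>bilin I S (\<lambda>i. x i - y i) (\<lambda>i. x i - y i)\<bar>"
    using pol by linarith
  also have "\<dots> \<le> \<kappa> * (sq_norm I (\<lambda>i. x i + y i) + sq_norm I (\<lambda>i. x i - y i))"
    using bd[of "\<lambda>i. x i + y i"] bd[of "\<lambda>i. x i - y i"] by (simp add: distrib_left)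
  finally show ?thesis unfolding par by (simp add: algebra_simps)
qed

text \<open>
  For a symmetric matrix the numerical radius bounds the operator norm: pair the image \<open>w = S x\<close>
  with \<open>\<kappa> x\<close> in the polarised bound.
\<close>

lemma form_bound_imp_image_bound:
  fixes S :: "'i \<Rightarrow> 'i \<Rightarrow> real"
  assumes sym: "\<And>i j. i \<in> I \<Longrightarrow> j \<in> I \<Longrightarrow> S i j = S j i"
    and bd: "\<And>x. \<bar>bilin I S x x\<bar> \<le> \<kappa> * sq_norm I x" and "\<kappa> \<ge> 0"
  shows "sq_norm I (\<lambda>i. \<Sum>j\<in>I. S i j * x j) \<le> \<kappa>\<^sup>2 * sq_norm I x"
proof -
  define w where "w = (\<lambda>i. \<Sum>j\<in>I. S i j * x j)"
  have w: "bilin I S w x = sq_norm I w"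
    by (simp add: bilin_def sq_norm_def w_def power2_eq_square sum_distrib_left mult_ac)
  have *: "t * sq_norm I w \<le> \<kappa> / 2 * (sq_norm I w + t\<^sup>2 * sq_norm I x)" for t
    using bilin_polarisation_bound[OF sym bd, of w "\<lambda>i. t * x i"]
    by (simp add: bilin_scale_right w sq_norm_scale)
  show ?thesis
  proof (cases "\<kappa> = 0")
    case True
    then show ?thesis using *[of 1] by (simp add: w_def)
  next
    case False
    with \<open>\<kappa> \<ge> 0\<close> have k: "\<kappa> > 0" by simp
    have "\<kappa> / 2 * sq_norm I w \<le> \<kappa> / 2 * (\<kappa>\<^sup>2 * sq_norm I x)"
      using *[of \<kappa>] by (simp add: algebra_simps)
    then have "sq_norm I w \<le> \<kappa>\<^sup>2 * sq_norm I x" using k by simp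
    then show ?thesis by (simp add: w_def)
  qed
qed

text \<open>
  Integer points in the ball of radius \<open>4 sqrt d\<close> in dimension \<open>d\<close>. The mesh \<open>1 / (4 sqrt d)\<close> used in
  \<open>grid_net\<close> makes the coordinatewise rounding error at most \<open>1/4\<close> in the Euclidean norm.
\<close>

definition int_ball :: "'i set \<Rightarrow> ('i \<Rightarrow> int) set" where
  "int_ball I = {z \<in> I \<rightarrow>\<^sub>E UNIV. (\<Sum>i\<in>I. (z i)\<^sup>2) \<le> 16 * int (card I)}"

definition grid_net :: "'i set \<Rightarrow> ('i \<Rightarrow> real) set" where
  "grid_net I = (\<lambda>z i. real_of_int (z i) / (4 * sqrt (card I))) ` int_ball I"

text \<open>
  By \<open>8 |t| \<le> t\<^sup>2 + 16\<close>. The bound on the \<open>\<ell>\<^sub>1\<close>-norm is linear in the dimension; this is what makes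
  the number of such points exponential in the dimension.
\<close>

lemma int_ball_abs_sum:
  assumes "z \<in> int_ball I"
  shows "(\<Sum>i\<in>I. \<bar>z i\<bar>) \<le> 4 * int (card I)"
proof -
  have "8 * \<bar>t\<bar> \<le> t\<^sup>2 + 16" for t :: int
    using zero_le_power2[of "\<bar>t\<bar> - 4"] by (simp add: power2_eq_square algebra_simps)
  then have "(\<Sum>i\<in>I. 8 * \<bar>z i\<bar>) \<le> (\<Sum>i\<in>I. (z i)\<^sup>2 + 16)" by (intro sum_mono) auto
  then have "8 * (\<Sum>i\<in>I. \<bar>z i\<bar>) \<le> (\<Sum>i\<in>I. (z i)\<^sup>2) + 16 * int (card I)"
    by (simp add: sum_distrib_left[symmetric] sum.distrib)
  then show ?thesis using assms by (simp add: int_ball_def)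
qed

lemma sum_half_powers_le: "(\<Sum>t\<in>{-int N..int N}. (1/2) ^ nat \<bar>t\<bar>) \<le> (3::real)"
proof -
  have "(\<Sum>t\<in>{-int N..int N}. (1/2) ^ nat \<bar>t\<bar>) = 3 - 2 * (1/2::real) ^ N"
  proof (induction N)
    case (Suc N)
    have "{-int (Suc N)..int (Suc N)} = insert (int (Suc N)) (insert (- int (Suc N)) {-int N..int N})"
      by auto
    then show ?case using Suc by (simp add: nat_add_distrib)
  qed simp
  then show ?thesis by simp
qed

text \<open>
  Give a point \<open>z\<close> the weight \<open>(1/2)^\<bar>z\<bar>\<^sub>1\<close>. Every point of the ball has weight at least \<open>(1/2)^(4 d)\<close>,
  whereas the total weight factorises over the coordinates and is at most \<open>3^d\<close>.
\<close>

lemma card_int_ball: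
  assumes "finite I"
  shows "finite (int_ball I)" "real (card (int_ball I)) \<le> 48 ^ card I"
proof -
  let ?N = "4 * card I"
  let ?B = "I \<rightarrow>\<^sub>E {-int ?N..int ?N}"
  have sub: "int_ball I \<subseteq> ?B"
  proof
    fix z assume z: "z \<in> int_ball I"
    have "\<bar>z i\<bar> \<le> int ?N" if "i \<in> I" for i
      using int_ball_abs_sum[OF z] member_le_sum[of i I "\<lambda>i. \<bar>z i\<bar>"] that assms by simp
    then have "- int ?N \<le> z i \<and> z i \<le> int ?N" if "i \<in> I" for i using that by (force simp: abs_le_iff)
    with z show "z \<in> ?B" by (auto simp: int_ball_def PiE_iff)
  qed
  have finB: "finite ?B" using assms by (intro finite_PiE) auto
  show "finite (int_ball I)" using sub finB by (rule finite_subset)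
  have "real (card (int_ball I)) * (1/2) ^ ?N = (\<Sum>z\<in>int_ball I. (1/2) ^ ?N)" by simp
  also have "\<dots> \<le> (\<Sum>z\<in>int_ball I. \<Prod>i\<in>I. (1/2) ^ nat \<bar>z i\<bar>)"
  proof (rule sum_mono)
    fix z assume z: "z \<in> int_ball I"
    have "int (\<Sum>i\<in>I. nat \<bar>z i\<bar>) \<le> int ?N" using int_ball_abs_sum[OF z] by simp
    then have "(\<Sum>i\<in>I. nat \<bar>z i\<bar>) \<le> ?N" by linarith
    then show "(1/2) ^ ?N \<le> (\<Prod>i\<in>I. (1/2::real) ^ nat \<bar>z i\<bar>)"
      unfolding power_sum[symmetric] by (intro power_decreasing) auto
  qed
  also have "\<dots> \<le> (\<Sum>z\<in>?B. \<Prod>i\<in>I. (1/2) ^ nat \<bar>z i\<bar>)"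
    using sub finB by (intro sum_mono2 prod_nonneg) auto
  also have "\<dots> = (\<Prod>i\<in>I. \<Sum>t\<in>{-int ?N..int ?N}. (1/2) ^ nat \<bar>t\<bar>)"
    using assms by (subst prod_sum_PiE) auto
  also have "\<dots> \<le> (\<Prod>i\<in>I. 3)"
    by (intro prod_mono conjI sum_half_powers_le sum_nonneg) auto
  finally have "real (card (int_ball I)) \<le> 3 ^ card I * 2 ^ ?N"
    by (simp add: field_simps power_one_over)
  also have "\<dots> = (48::real) ^ card I"
    by (simp add: power_mult power_mult_distrib[symmetric])
  finally show "real (card (int_ball I)) \<le> 48 ^ card I" .
qed

lemma card_grid_net:
  assumes "finite I"
  shows "finite (grid_net I)" "real (card (grid_net I)) \<le> 48 ^ card I"
proof -
  show "finite (grid_net I)" using card_int_ball[OF assms] by (simp add: grid_net_def)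
  have "card (grid_net I) \<le> card (int_ball I)"
    unfolding grid_net_def using card_int_ball[OF assms] by (intro card_image_le) auto
  then show "real (card (grid_net I)) \<le> 48 ^ card I" using card_int_ball(2)[OF assms] by linarith
qed

text \<open>
  The net is used on the real form of \<open>k\<close>-dimensional complex space, which has dimension \<open>2 k\<close>.
\<close>

lemma grid_net_size_le_exp: "(48::real) ^ (2 * k) \<le> exp (12 * real k)"
proof -
  have "(2::real) \<le> exp 1" using exp_ge_add_one_self[of 1] by simp
  then have "(2::real) ^ 12 \<le> exp 1 ^ 12" by (rule power_mono) simp
  then have "(48::real)\<^sup>2 \<le> exp 12" by (simp add: exp_of_nat_mult[symmetric])
  then have "((48::real)\<^sup>2) ^ k \<le> exp 12 ^ k" by (rule power_mono) simp
  then show ?thesis unfolding power_mult by (simp add: exp_of_nat_mult[symmetric] mult.commute)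
qed

lemma grid_net_sq_norm:
  assumes "finite I" "I \<noteq> {}" "v \<in> grid_net I"
  shows "sq_norm I v \<le> 1"
proof -
  obtain z where z: "z \<in> int_ball I" "v = (\<lambda>i. real_of_int (z i) / (4 * sqrt (card I)))"
    using assms by (auto simp: grid_net_def)
  have c: "card I > 0" using assms by (simp add: card_gt_0_iff)
  have "sq_norm I v = real_of_int (\<Sum>i\<in>I. (z i)\<^sup>2) / (16 * card I)"
    by (simp add: sq_norm_def z(2) power_divide power_mult_distrib sum_divide_distrib)
  also have "\<dots> \<le> 1"
  proof -
    have "(\<Sum>i\<in>I. (z i)\<^sup>2) \<le> 16 * int (card I)" using z by (simp add: int_ball_def)
    then have "real_of_int (\<Sum>i\<in>I. (z i)\<^sup>2) \<le> 16 * real (card I)"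
      by (metis of_int_le_iff of_int_mult of_int_numeral of_int_of_nat_eq)
    then show ?thesis using c by (simp add: field_simps)
  qed
  finally show ?thesis .
qed

lemma grid_net_approx:
  assumes "finite I" "I \<noteq> {}" "sq_norm I u \<le> 1"
  obtains v where "v \<in> grid_net I" "sq_norm I (\<lambda>i. u i - v i) \<le> 1 / 16"
proof -
  have c: "card I > 0" using assms by (simp add: card_gt_0_iff)
  define R where "R = 4 * sqrt (real (card I))"
  have R: "R > 0" "R\<^sup>2 = 16 * real (card I)" using c by (auto simp: R_def power_mult_distrib)
  \<comment> \<open>rounding towards zero, so that the rounded point does not leave the ball\<close>
  define rnd :: "real \<Rightarrow> int" where "rnd t = (if t \<ge> 0 then \<lfloor>t\<rfloor> else \<lceil>t\<rceil>)" for t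
  have rnd1: "\<bar>real_of_int (rnd t)\<bar> \<le> \<bar>t\<bar>" for t unfolding rnd_def by (auto; linarith)
  have rnd2: "\<bar>t - real_of_int (rnd t)\<bar> \<le> 1" for t unfolding rnd_def by (auto; linarith)
  define z where "z = (\<lambda>i\<in>I. rnd (R * u i))"
  have "real_of_int (\<Sum>i\<in>I. (z i)\<^sup>2) = (\<Sum>i\<in>I. (real_of_int (z i))\<^sup>2)" by simp
  also have "\<dots> \<le> (\<Sum>i\<in>I. (R * u i)\<^sup>2)"
    by (intro sum_mono) (simp add: z_def abs_le_square_iff[symmetric] rnd1)
  also have "\<dots> = R\<^sup>2 * sq_norm I u" by (simp add: sq_norm_def power_mult_distrib sum_distrib_left)
  also have "\<dots> \<le> R\<^sup>2 * 1" using assms(3) by (intro mult_left_mono) auto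
  finally have "real_of_int (\<Sum>i\<in>I. (z i)\<^sup>2) \<le> real_of_int (16 * int (card I))" using R by simp
  then have "z \<in> int_ball I" unfolding of_int_le_iff by (auto simp: int_ball_def z_def)
  moreover have "sq_norm I (\<lambda>i. u i - real_of_int (z i) / R) \<le> 1 / 16"
  proof -
    have "sq_norm I (\<lambda>i. u i - real_of_int (z i) / R) = (\<Sum>i\<in>I. ((R * u i - real_of_int (z i)) / R)\<^sup>2)"
      unfolding sq_norm_def using R by (intro sum.cong refl) (simp add: field_simps)
    also have "\<dots> \<le> (\<Sum>i\<in>I. 1 / R\<^sup>2)"
      unfolding power_divide
      by (intro sum_mono divide_right_mono) (auto simp: z_def abs_le_square_iff[of _ 1, simplified, symmetric] rnd2)
    also have "\<dots> = 1 / 16" using R c by simp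
    finally show ?thesis .
  qed
  ultimately show ?thesis using that[of "\<lambda>i. real_of_int (z i) / R"]
    by (auto simp: grid_net_def R_def)
qed

lemma bilin_abs_le_entries:
  assumes "finite I" "sq_norm I u \<le> 1"
  shows "\<bar>bilin I S u u\<bar> \<le> (\<Sum>i\<in>I. \<Sum>j\<in>I. \<bar>S i j\<bar>)"
proof -
  have u: "\<bar>u i\<bar> \<le> 1" if "i \<in> I" for i
  proof -
    have "(u i)\<^sup>2 \<le> 1" using member_le_sum[of i I "\<lambda>i. (u i)\<^sup>2"] assms that by (auto simp: sq_norm_def)
    then show ?thesis by (simp add: abs_square_le_1)
  qed
  have "\<bar>bilin I S u u\<bar> \<le> (\<Sum>i\<in>I. \<Sum>j\<in>I. \<bar>S i j * u i * u j\<bar>)"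
    unfolding bilin_def by (intro order_trans[OF sum_abs] sum_mono sum_abs)
  also have "\<dots> \<le> (\<Sum>i\<in>I. \<Sum>j\<in>I. \<bar>S i j\<bar> * (1 * 1))"
    unfolding abs_mult mult.assoc using u by (intro sum_mono mult_left_mono mult_mono) auto
  finally show ?thesis by simp
qed

text \<open>
  Let \<open>b\<close> be the supremum of the form on the unit ball and \<open>u = v + e\<close> with \<open>v\<close> in the net and
  \<open>\<bar>e\<bar> \<le> 1/4\<close>. Expanding the form at \<open>u\<close> gives \<open>b \<le> \<epsilon> + b/2 + b/16\<close>, that is \<open>b \<le> 16/7 \<epsilon>\<close>.
\<close>

lemma form_bound_from_grid_net:
  fixes S :: "'i \<Rightarrow> 'i \<Rightarrow> real"
  assumes fin: "finite I" and ne: "I \<noteq> {}"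
    and sym: "\<And>i j. i \<in> I \<Longrightarrow> j \<in> I \<Longrightarrow> S i j = S j i"
    and net: "\<And>v. v \<in> grid_net I \<Longrightarrow> \<bar>bilin I S v v\<bar> \<le> \<epsilon>"
  shows "\<bar>bilin I S u u\<bar> \<le> 16 / 7 * \<epsilon> * sq_norm I u"
proof -
  define b where "b = (SUP u\<in>{u. sq_norm I u \<le> 1}. \<bar>bilin I S u u\<bar>)"
  have bdd: "bdd_above ((\<lambda>u. \<bar>bilin I S u u\<bar>) ` {u. sq_norm I u \<le> 1})"
    using bilin_abs_le_entries[OF fin] by (intro bdd_aboveI2) auto
  have unit: "\<bar>bilin I S u u\<bar> \<le> b" if "sq_norm I u \<le> 1" for u
    unfolding b_def by (rule cSUP_upper[OF _ bdd]) (use that in auto)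
  have scaled: "\<bar>bilin I S u u\<bar> \<le> b * sq_norm I u" for u
  proof (cases "sq_norm I u = 0")
    case True
    then have "u i = 0" if "i \<in> I" for i using that fin by (auto simp: sq_norm_def sum_nonneg_eq_0_iff)
    then show ?thesis using True by (simp add: bilin_def)
  next
    case False
    define n where "n = sqrt (sq_norm I u)"
    have n: "n > 0" "n\<^sup>2 = sq_norm I u" using False by (auto simp: n_def less_le)
    have "sq_norm I (\<lambda>i. (1 / n) * u i) \<le> 1" using n False by (simp only: sq_norm_scale) (simp add: power_divide)
    from unit[OF this] have "\<bar>bilin I S u u\<bar> / n\<^sup>2 \<le> b"
      unfolding bilin_scale_left bilin_scale_right by (simp add: power2_eq_square abs_mult)
    then show ?thesis using n False by (simp add: pos_divide_le_eq less_le)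
  qed
  have "b \<le> \<epsilon> + 9 / 16 * b"
    unfolding b_def
  proof (rule cSUP_least, fold b_def)
    show "{u. sq_norm I u \<le> 1} \<noteq> {}" by (auto intro!: exI[of _ "\<lambda>_. 0"] simp: sq_norm_def)
    fix u assume "u \<in> {u. sq_norm I u \<le> 1}"
    then obtain v where v: "v \<in> grid_net I" "sq_norm I (\<lambda>i. u i - v i) \<le> 1 / 16"
      using grid_net_approx[OF fin ne] by auto
    define e where "e = (\<lambda>i. u i - v i)"
    have b0: "b \<ge> 0" using unit[of "\<lambda>_. 0"] by (simp add: sq_norm_def bilin_def)
    have "bilin I S u u = bilin I S v v + 2 * bilin I S v e + bilin I S e e"
    proof -
      have "u = (\<lambda>i. v i + e i)" by (auto simp: e_def)
      then show ?thesis using bilin_commute[of I S e v, OF sym]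
        by (simp add: bilin_add_left bilin_add_right)
    qed
    moreover have "\<bar>bilin I S v v\<bar> \<le> \<epsilon>" by (rule net[OF v(1)])
    moreover have "\<bar>bilin I S v e\<bar> \<le> b / 4"
    proof -
      \<comment> \<open>the factor 4 brings \<open>e\<close> to the size of \<open>v\<close> and balances the two terms of the polarised bound\<close>
      have "\<bar>bilin I S v (\<lambda>i. 4 * e i)\<bar> \<le> b / 2 * (sq_norm I v + 16 * sq_norm I e)"
        using bilin_polarisation_bound[OF sym scaled, of v "\<lambda>i. 4 * e i"] by (simp add: sq_norm_scale)
      also have "\<dots> \<le> b / 2 * 2"
        using b0 v(2) grid_net_sq_norm[OF fin ne v(1)] by (intro mult_left_mono) (auto simp: e_def)
      finally show ?thesis unfolding bilin_scale_right by simp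
    qed
    moreover have "\<bar>bilin I S e e\<bar> \<le> b * (1 / 16)"
      by (rule order_trans[OF scaled mult_left_mono]) (use v b0 in \<open>auto simp: e_def\<close>)
    ultimately show "\<bar>bilin I S u u\<bar> \<le> \<epsilon> + 9 / 16 * b" by linarith
  qed
  then have "b \<le> 16 / 7 * \<epsilon>" by simp
  then show ?thesis using scaled[of u] mult_right_mono[of b "16 / 7 * \<epsilon>" "sq_norm I u"] by simp
qed

section \<open>Exponential moments of Gaussian quadratic forms\<close>

text \<open>
  Completing the square turns the integrand into a multiple of the normal density with mean
  \<open>b / (1 - 2 a)\<close> and variance \<open>1 / (1 - 2 a)\<close>.
\<close>

lemma nn_integral_std_normal_exp_quadratic:
  assumes "a < 1 / 2"
  shows "(\<integral>\<^sup>+x. ennreal (exp (a * x\<^sup>2 + b * x)) \<partial>std_normal_distribution)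
    = ennreal (exp (b\<^sup>2 / (2 * (1 - 2 * a))) / sqrt (1 - 2 * a))"
proof -
  define s where "s = 1 - 2 * a"
  have s: "s > 0" using assms by (simp add: s_def)
  define K where "K = exp (b\<^sup>2 / (2 * s)) / sqrt s"
  have K: "K \<ge> 0" using s by (simp add: K_def)
  have eq: "std_normal_density x * exp (a * x\<^sup>2 + b * x) = K * normal_density (b / s) (1 / sqrt s) x" for x
  proof -
    have "- x\<^sup>2 / 2 + (a * x\<^sup>2 + b * x) = b\<^sup>2 / (2 * s) + - (x - b / s)\<^sup>2 / (2 * (1 / sqrt s)\<^sup>2)"
    proof -
      have a: "a = (1 - s) / 2" by (simp add: s_def)
      show ?thesis using s unfolding a by (simp add: power_divide field_simps power2_eq_square)
    qed
    then have e: "exp (- x\<^sup>2 / 2) * exp (a * x\<^sup>2 + b * x)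
        = exp (b\<^sup>2 / (2 * s)) * exp (- (x - b / s)\<^sup>2 / (2 * (1 / sqrt s)\<^sup>2))"
      unfolding exp_add[symmetric] by simp
    have r: "1 / sqrt (2 * pi * (1 / sqrt s)\<^sup>2) = sqrt s / sqrt (2 * pi)"
      using s by (simp add: power_divide real_sqrt_divide real_sqrt_mult)
    have "std_normal_density x * exp (a * x\<^sup>2 + b * x) = 1 / sqrt (2 * pi) * (exp (- x\<^sup>2 / 2) * exp (a * x\<^sup>2 + b * x))"
      by (simp add: std_normal_density_def)
    also have "\<dots> = K * normal_density (b / s) (1 / sqrt s) x"
      unfolding e normal_density_def r K_def using s by simp
    finally show ?thesis .
  qed
  have "(\<integral>\<^sup>+x. ennreal (exp (a * x\<^sup>2 + b * x)) \<partial>std_normal_distribution)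
      = (\<integral>\<^sup>+x. ennreal (std_normal_density x * exp (a * x\<^sup>2 + b * x)) \<partial>lborel)"
    by (subst nn_integral_density) (auto simp: ennreal_mult)
  also have "\<dots> = (\<integral>\<^sup>+x. ennreal K * ennreal (normal_density (b / s) (1 / sqrt s) x) \<partial>lborel)"
    unfolding eq using K by (simp add: ennreal_mult)
  also have "\<dots> = ennreal K * (\<integral>\<^sup>+x. ennreal (normal_density (b / s) (1 / sqrt s) x) \<partial>lborel)"
    by (rule nn_integral_cmult) simp
  also have "(\<integral>\<^sup>+x. ennreal (normal_density (b / s) (1 / sqrt s) x) \<partial>lborel) = 1"
    using s by (subst nn_integral_eq_integral) auto
  finally show ?thesis by (simp add: K_def s_def)
qed

lemma prob_space_std_normal: "prob_space std_normal_distribution"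
  by (rule prob_space_normal_density) simp

text \<open>
  Covers the degenerate case \<open>v = 0\<close>, so that moments and characteristic function need no case
  distinction.
\<close>

lemma normal_law_0_eq_distr:
  assumes "v \<ge> 0"
  shows "normal_law 0 v = distr std_normal_distribution borel (\<lambda>x. sqrt v * x)"
proof -
  interpret prob_space std_normal_distribution by (rule prob_space_std_normal)
  show ?thesis
  proof (cases "v = 0")
    case True
    then show ?thesis by (simp add: normal_law_def distr_const)
  next
    case False
    with assms have v: "v > 0" by simp
    have "distributed std_normal_distribution lborel (\<lambda>x. x) (\<lambda>x. ennreal (std_normal_density x))"
      by (auto simp: distributed_def distr_id2 density_cong)
    from normal_density_affine[OF this, of "sqrt v" 0]
    have "distributed std_normal_distribution lborel (\<lambda>x. sqrt v * x) (\<lambda>x. ennreal (normal_density 0 (sqrt v) x))"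
      using v by simp
    from distributed_distr_eq_density[OF this] show ?thesis
      using False by (simp add: normal_law_def cong: distr_cong)
  qed
qed

lemma nn_integral_normal_law_exp:
  assumes "v \<ge> 0"
  shows "(\<integral>\<^sup>+x. ennreal (exp (c * x)) \<partial>normal_law 0 v) = ennreal (exp (c\<^sup>2 * v / 2))"
  using nn_integral_std_normal_exp_quadratic[of 0 "c * sqrt v"] assms
  unfolding normal_law_0_eq_distr[OF assms]
  by (subst nn_integral_distr) (auto simp: mult.assoc power_mult_distrib)

lemma integral_normal_law_iexp:
  assumes "v \<ge> 0"
  shows "(CLINT x|normal_law 0 v. iexp (c * x)) = complex_of_real (exp (- (c\<^sup>2 * v / 2)))"
proof -
  have "(CLINT x|normal_law 0 v. iexp (c * x)) = (CLINT x|std_normal_distribution. iexp ((c * sqrt v) * x))"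
    unfolding normal_law_0_eq_distr[OF assms] by (subst integral_distr) (auto simp: mult_ac)
  also have "\<dots> = char std_normal_distribution (c * sqrt v)" by (simp add: char_def)
  also have "\<dots> = complex_of_real (exp (- (c\<^sup>2 * v / 2)))"
    using assms by (simp add: char_std_normal_distribution power_mult_distrib)
  finally show ?thesis .
qed

abbreviation std_gauss :: "'i set \<Rightarrow> ('i \<Rightarrow> real) measure" where
  "std_gauss I \<equiv> PiM I (\<lambda>_. std_normal_distribution)"

lemma product_sigma_finite_std_normal: "product_sigma_finite (\<lambda>_. std_normal_distribution)"
proof -
  interpret prob_space std_normal_distribution by (rule prob_space_std_normal)
  show ?thesis by unfold_locales
qed

lemma prob_space_std_gauss: "prob_space (std_gauss I)"
  by (rule prob_space_PiM) (rule prob_space_std_normal)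

text \<open>
  Linearisation of squares. For \<open>\<tau> \<ge> 0\<close> and a standard normal variable \<open>Z\<close>, \<open>exp (\<tau> q\<^sup>2)\<close> is the mean of
  \<open>exp (sqrt (2 \<tau>) Z q)\<close>; for \<open>\<tau> < 0\<close> it is the mean of \<open>exp (\<i> sqrt (- 2 \<tau>) Z q)\<close>. With one independent
  \<open>Z\<close> for every \<open>q i\<close> and the order of integration exchanged, the inner integral involves only the
  law of one linear combination of the \<open>q i\<close>, which is normal with variance \<open>bilin I S z z\<close>. So the
  one-dimensional marginals suffice.
\<close>

lemma gaussian_family_exp_square_sum:
  fixes q :: "'i \<Rightarrow> 'a \<Rightarrow> real"
  assumes fin: "finite I" and M: "prob_space M"
    and meas [measurable]: "\<And>i. i \<in> I \<Longrightarrow> q i \<in> borel_measurable M"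
    and psd: "\<And>z. bilin I S z z \<ge> 0"
    and law: "\<And>z. distr M borel (\<lambda>x. \<Sum>i\<in>I. z i * q i x) = normal_law 0 (bilin I S z z)"
  shows "(\<integral>\<^sup>+x. ennreal (exp (\<tau> * (\<Sum>i\<in>I. (q i x)\<^sup>2))) \<partial>M)
    = (\<integral>\<^sup>+z. ennreal (exp (\<tau> * bilin I S z z)) \<partial>std_gauss I)"
proof -
  interpret M: prob_space M by (rule M)
  interpret N: prob_space std_normal_distribution by (rule prob_space_std_normal)
  interpret G: product_sigma_finite "\<lambda>_::'i. std_normal_distribution" by (rule product_sigma_finite_std_normal)
  interpret GI: prob_space "std_gauss I" by (rule prob_space_std_gauss)
  interpret MG: pair_sigma_finite M "std_gauss I" ..
  interpret P: prob_space "M \<Otimes>\<^sub>M std_gauss I"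
    by (rule prob_space_pair) unfold_locales
  show ?thesis
  proof (cases "\<tau> \<ge> 0")
    case True
    define c where "c = sqrt (2 * \<tau>)"
    have c: "c\<^sup>2 / 2 = \<tau>" using True by (simp add: c_def)
    have lin: "ennreal (exp (\<tau> * (\<Sum>i\<in>I. (q i x)\<^sup>2)))
        = (\<integral>\<^sup>+z. ennreal (exp (c * (\<Sum>i\<in>I. z i * q i x))) \<partial>std_gauss I)" for x
    proof -
      have "ennreal (exp (\<tau> * (\<Sum>i\<in>I. (q i x)\<^sup>2))) = (\<Prod>i\<in>I. ennreal (exp (\<tau> * (q i x)\<^sup>2)))"
        using fin by (simp add: sum_distrib_left exp_sum prod_ennreal)
      also have "\<dots> = (\<Prod>i\<in>I. \<integral>\<^sup>+t. ennreal (exp (c * q i x * t)) \<partial>std_normal_distribution)"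
        using nn_integral_std_normal_exp_quadratic[of 0] c by (simp add: power_mult_distrib)
      also have "\<dots> = (\<integral>\<^sup>+z. (\<Prod>i\<in>I. ennreal (exp (c * q i x * z i))) \<partial>std_gauss I)"
        using fin by (intro G.product_nn_integral_prod[symmetric]) auto
      also have "\<dots> = (\<integral>\<^sup>+z. ennreal (exp (c * (\<Sum>i\<in>I. z i * q i x))) \<partial>std_gauss I)"
        using fin by (simp add: prod_ennreal exp_sum[symmetric] sum_distrib_left mult_ac)
      finally show ?thesis .
    qed
    have "(\<integral>\<^sup>+x. ennreal (exp (\<tau> * (\<Sum>i\<in>I. (q i x)\<^sup>2))) \<partial>M)
        = (\<integral>\<^sup>+x. \<integral>\<^sup>+z. ennreal (exp (c * (\<Sum>i\<in>I. z i * q i x))) \<partial>std_gauss I \<partial>M)"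
      by (simp add: lin)
    also have "\<dots> = (\<integral>\<^sup>+z. \<integral>\<^sup>+x. ennreal (exp (c * (\<Sum>i\<in>I. z i * q i x))) \<partial>M \<partial>std_gauss I)"
      by (rule MG.Fubini'[symmetric]) measurable
    also have "\<dots> = (\<integral>\<^sup>+z. ennreal (exp (\<tau> * bilin I S z z)) \<partial>std_gauss I)"
    proof (rule nn_integral_cong)
      fix z
      have "(\<integral>\<^sup>+x. ennreal (exp (c * (\<Sum>i\<in>I. z i * q i x))) \<partial>M)
          = (\<integral>\<^sup>+y. ennreal (exp (c * y)) \<partial>distr M borel (\<lambda>x. \<Sum>i\<in>I. z i * q i x))"
        by (subst nn_integral_distr) auto
      also have "\<dots> = ennreal (exp (\<tau> * bilin I S z z))"
        unfolding law using c by (subst nn_integral_normal_law_exp[OF psd]) (simp add: mult.commute[of _ "bilin I S z z"])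
      finally show "(\<integral>\<^sup>+x. ennreal (exp (c * (\<Sum>i\<in>I. z i * q i x))) \<partial>M) = ennreal (exp (\<tau> * bilin I S z z))" .
    qed
    finally show ?thesis .
  next
    case False
    define c where "c = sqrt (- (2 * \<tau>))"
    have c: "c\<^sup>2 = - (2 * \<tau>)" using False by (simp add: c_def)
    have lin: "complex_of_real (exp (\<tau> * (\<Sum>i\<in>I. (q i x)\<^sup>2)))
        = (CLINT z|std_gauss I. iexp (c * (\<Sum>i\<in>I. z i * q i x)))" for x
    proof -
      have one: "complex_of_real (exp (\<tau> * (q i x)\<^sup>2)) = (CLINT t|std_normal_distribution. iexp (c * q i x * t))" for i
      proof -
        have "(CLINT t|std_normal_distribution. iexp (c * q i x * t)) = char std_normal_distribution (c * q i x)"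
          by (simp add: char_def)
        then show ?thesis by (simp add: char_std_normal_distribution power_mult_distrib c)
      qed
      have "complex_of_real (exp (\<tau> * (\<Sum>i\<in>I. (q i x)\<^sup>2))) = (\<Prod>i\<in>I. complex_of_real (exp (\<tau> * (q i x)\<^sup>2)))"
        using fin by (simp add: sum_distrib_left exp_sum)
      also have "\<dots> = (\<Prod>i\<in>I. CLINT t|std_normal_distribution. iexp (c * q i x * t))"
        by (simp only: one)
      also have "\<dots> = (CLINT z|std_gauss I. (\<Prod>i\<in>I. iexp (c * q i x * z i)))"
        using fin by (intro G.product_integral_prod[symmetric] N.integrable_const_bound[where B = 1]) auto
      also have "\<dots> = (CLINT z|std_gauss I. iexp (c * (\<Sum>i\<in>I. z i * q i x)))"
        using fin by (simp add: exp_sum[symmetric] sum_distrib_left mult_ac)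
      finally show ?thesis .
    qed
    have "(CLINT x|M. complex_of_real (exp (\<tau> * (\<Sum>i\<in>I. (q i x)\<^sup>2))))
        = (CLINT x|M. CLINT z|std_gauss I. iexp (c * (\<Sum>i\<in>I. z i * q i x)))"
      by (simp only: lin)
    also have "\<dots> = (CLINT z|std_gauss I. CLINT x|M. iexp (c * (\<Sum>i\<in>I. z i * q i x)))"
    proof (rule MG.Fubini_integral[symmetric])
      show "integrable (M \<Otimes>\<^sub>M std_gauss I) (\<lambda>(x, z). iexp (c * (\<Sum>i\<in>I. z i * q i x)))"
        by (intro P.integrable_const_bound[where B = 1]) auto
    qed
    also have "\<dots> = (CLINT z|std_gauss I. complex_of_real (exp (\<tau> * bilin I S z z)))"
    proof (rule Bochner_Integration.integral_cong[OF refl])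
      fix z
      have "(CLINT x|M. iexp (c * (\<Sum>i\<in>I. z i * q i x)))
          = (CLINT y|distr M borel (\<lambda>x. \<Sum>i\<in>I. z i * q i x). iexp (c * y))"
        by (subst integral_distr) auto
      also have "\<dots> = complex_of_real (exp (\<tau> * bilin I S z z))"
        unfolding law by (subst integral_normal_law_iexp[OF psd]) (simp add: c)
      finally show "(CLINT x|M. iexp (c * (\<Sum>i\<in>I. z i * q i x))) = complex_of_real (exp (\<tau> * bilin I S z z))" .
    qed
    finally have eq: "(\<integral>x. exp (\<tau> * (\<Sum>i\<in>I. (q i x)\<^sup>2)) \<partial>M) = (\<integral>z. exp (\<tau> * bilin I S z z) \<partial>std_gauss I)"
      unfolding integral_complex_of_real of_real_eq_iff .
    have [measurable]: "(\<lambda>z. bilin I S z z) \<in> borel_measurable (std_gauss I)"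
      unfolding bilin_def by measurable
    have i1: "integrable M (\<lambda>x. exp (\<tau> * (\<Sum>i\<in>I. (q i x)\<^sup>2)))"
      using False by (intro M.integrable_const_bound[where B = 1]) (auto simp: mult_nonpos_nonneg sum_nonneg)
    have i2: "integrable (std_gauss I) (\<lambda>z. exp (\<tau> * bilin I S z z))"
      using False psd by (intro GI.integrable_const_bound[where B = 1]) (auto simp: mult_nonpos_nonneg)
    show ?thesis
      using i1 i2 eq by (simp add: nn_integral_eq_integral)
  qed
qed

lemma inverse_sqrt_le_exp:
  assumes "\<bar>s\<bar> \<le> 1 / 8"
  shows "1 / sqrt (1 - 2 * s) \<le> exp (s + 4 * s\<^sup>2)"
proof -
  have p: "1 - 2 * s > 0" using assms by linarith
  have "\<bar>ln (1 + (- 2 * s)) - (- 2 * s)\<bar> \<le> 2 * (- 2 * s)\<^sup>2"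
    by (rule abs_ln_one_plus_x_minus_x_bound) (use assms in auto)
  then have "- (ln (1 - 2 * s) / 2) \<le> s + 4 * s\<^sup>2" by (simp add: power_mult_distrib)
  moreover have "1 / sqrt (1 - 2 * s) = exp (- (ln (1 - 2 * s) / 2))"
    using p by (simp add: exp_minus ln_sqrt[symmetric] inverse_eq_divide)
  ultimately show ?thesis by simp
qed

lemma bilin_insert_diagonal:
  fixes S :: "'i \<Rightarrow> 'i \<Rightarrow> real" and z :: "'i \<Rightarrow> real"
  assumes "finite I" "k \<notin> I" and sym: "\<And>i. i \<in> I \<Longrightarrow> S k i = S i k"
  shows "bilin (insert k I) S z z = bilin I S z z + 2 * z k * (\<Sum>i\<in>I. S i k * z i) + S k k * (z k)\<^sup>2"
proof -
  have "(\<Sum>i\<in>I. S k i * z k * z i) = z k * (\<Sum>i\<in>I. S i k * z i)"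
    unfolding sum_distrib_left by (intro sum.cong refl) (simp add: sym)
  moreover have "(\<Sum>i\<in>I. S i k * z i * z k) = z k * (\<Sum>i\<in>I. S i k * z i)"
    unfolding sum_distrib_left by (intro sum.cong refl) simp
  ultimately show ?thesis
    using assms(1,2) by (simp add: bilin_def sum.distrib power2_eq_square algebra_simps)
qed

text \<open>
  Induction on the number of variables. Integrating out \<open>z k\<close> leaves a Gaussian integral of the same
  type whose matrix \<open>S'\<close> comes from the Schur complement of \<open>1 - 2 S\<close>. The bound \<open>\<kappa>\<close> on the form
  survives this step. From below this holds because \<open>S' - S\<close> is positive semidefinite; from above, the value of \<open>S'\<close> at \<open>x\<close> is the maximum over \<open>y\<close> of the old form at \<open>x(k := y)\<close>
  minus \<open>y\<^sup>2/2\<close>, and \<open>\<kappa> \<le> 1/2\<close>. Each step costs at most \<open>8/3 \<kappa>\<^sup>2\<close> through the change of the trace and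
  \<open>4 \<kappa>\<^sup>2\<close> through the normalising factor, together less than \<open>7 \<kappa>\<^sup>2\<close>.
\<close>

lemma gaussian_chaos_exp_bound:
  fixes S :: "'i \<Rightarrow> 'i \<Rightarrow> real" and \<kappa> :: real
  assumes "finite I" and "0 \<le> \<kappa>" "\<kappa> \<le> 1 / 8"
    and "\<And>i j. i \<in> I \<Longrightarrow> j \<in> I \<Longrightarrow> S i j = S j i"
    and "\<And>x. \<bar>bilin I S x x\<bar> \<le> \<kappa> * sq_norm I x"
  shows "(\<integral>\<^sup>+z. ennreal (exp (bilin I S z z)) \<partial>std_gauss I)
    \<le> ennreal (exp ((\<Sum>i\<in>I. S i i) + 7 * card I * \<kappa>\<^sup>2))"
  using assms(1,4,5)
proof (induction I arbitrary: S rule: finite_induct)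
  case empty
  interpret prob_space "std_gauss ({} :: 'i set)" by (rule prob_space_std_gauss)
  show ?case by (simp add: bilin_def emeasure_space_1)
next
  case (insert k I S)
  interpret G: product_sigma_finite "\<lambda>_::'i. std_normal_distribution" by (rule product_sigma_finite_std_normal)
  note sym = insert.prems(1) and bd = insert.prems(2)
  define s where "s = S k k"
  define b where "b x = (\<Sum>i\<in>I. S i k * x i)" for x :: "'i \<Rightarrow> real"
  define S' where "S' i j = S i j + 2 / (1 - 2 * s) * (S i k * S j k)" for i j
  have expand: "bilin (insert k I) S z z = bilin I S z z + 2 * z k * b z + s * (z k)\<^sup>2" for z :: "'i \<Rightarrow> real"
    unfolding b_def s_def using insert.hyps sym by (intro bilin_insert_diagonal) auto
  have upd: "bilin I S (x(k := y)) (x(k := y)) = bilin I S x x" "b (x(k := y)) = b x"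
    "sq_norm (insert k I) (x(k := y)) = sq_norm I x + y\<^sup>2" for x :: "'i \<Rightarrow> real" and y
    using insert.hyps unfolding bilin_def b_def sq_norm_def
    by (auto intro!: sum.cong arg_cong2[where f = "(+)"])
  have bd': "\<bar>bilin I S x x + 2 * y * b x + s * y\<^sup>2\<bar> \<le> \<kappa> * (sq_norm I x + y\<^sup>2)" for x y
    using bd[of "x(k := y)"] unfolding expand upd by simp
  have s: "\<bar>s\<bar> \<le> \<kappa>"
    using bd'[of "\<lambda>_. 0" 1] by (simp add: bilin_def b_def sq_norm_def)
  have s1: "1 - 2 * s \<ge> 3 / 4" using s assms(3) by linarith
  \<comment> \<open>the \<open>k\<close>-th column is the image of the \<open>k\<close>-th unit vector\<close>
  have col: "(\<Sum>i\<in>I. (S i k)\<^sup>2) \<le> \<kappa>\<^sup>2"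
  proof -
    have "(\<Sum>j\<in>insert k I. S i j * (if j = k then 1 else 0)) = S i k" for i
      using insert.hyps by (simp add: if_distrib cong: if_cong)
    moreover have "sq_norm (insert k I) (\<lambda>j. if j = k then 1 else 0) = 1"
    proof -
      have "(\<Sum>x\<in>I. (if x = k then 1 else 0 :: real)\<^sup>2) = (\<Sum>x\<in>I. 0)"
        using insert.hyps by (intro sum.cong) auto
      then show ?thesis using insert.hyps by (simp add: sq_norm_def)
    qed
    ultimately have "sq_norm (insert k I) (\<lambda>i. S i k) \<le> \<kappa>\<^sup>2"
      using form_bound_imp_image_bound[OF sym bd assms(2), of "\<lambda>j. if j = k then 1 else 0"] by simp
    then show ?thesis using insert.hyps by (simp add: sq_norm_def) (smt (verit) zero_le_power2)
  qed
  have S'form: "bilin I S' x x = bilin I S x x + 2 * (b x)\<^sup>2 / (1 - 2 * s)" for x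
  proof -
    have "(b x)\<^sup>2 = (\<Sum>i\<in>I. \<Sum>j\<in>I. (S i k * S j k) * x i * x j)"
      unfolding b_def power2_eq_square sum_product by (simp add: mult_ac)
    moreover have "bilin I S' x x = bilin I S x x + 2 / (1 - 2 * s) * (\<Sum>i\<in>I. \<Sum>j\<in>I. (S i k * S j k) * x i * x j)"
    proof -
      define c where "c = 2 / (1 - 2 * s)"
      show ?thesis unfolding bilin_def S'_def c_def[symmetric]
        by (simp add: distrib_right distrib_left sum.distrib sum_distrib_left mult_ac)
    qed
    ultimately show ?thesis by simp
  qed
  have IH: "(\<integral>\<^sup>+z. ennreal (exp (bilin I S' z z)) \<partial>std_gauss I)
      \<le> ennreal (exp ((\<Sum>i\<in>I. S' i i) + 7 * card I * \<kappa>\<^sup>2))"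
  proof (rule insert.IH)
    show "S' i j = S' j i" if "i \<in> I" "j \<in> I" for i j
      using sym[of i j] that by (simp add: S'_def)
    fix x :: "'i \<Rightarrow> real"
    have "bilin I S' x x \<le> \<kappa> * sq_norm I x"
    proof -
      \<comment> \<open>the maximiser of \<open>2 y (b x) + s y\<^sup>2 - y\<^sup>2/2\<close>\<close>
      define y where "y = 2 * b x / (1 - 2 * s)"
      have "2 * y * b x + s * y\<^sup>2 - y\<^sup>2 / 2 = 2 * (b x)\<^sup>2 / (1 - 2 * s)"
      proof -
        define r where "r = 1 - 2 * s"
        have r: "r > 0" "s = (1 - r) / 2" using s1 by (auto simp: r_def)
        show ?thesis unfolding y_def r_def[symmetric] using r(1) unfolding r(2)
          by (simp add: power_divide field_simps power2_eq_square)
      qed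
      moreover have "\<kappa> * y\<^sup>2 \<le> 1 / 2 * y\<^sup>2" using assms(3) by (intro mult_right_mono) auto
      moreover have "bilin I S x x + 2 * y * b x + s * y\<^sup>2 \<le> \<kappa> * sq_norm I x + \<kappa> * y\<^sup>2"
        using bd'[of x y] by (simp add: distrib_left abs_le_iff)
      ultimately show ?thesis unfolding S'form by linarith
    qed
    moreover have "- (\<kappa> * sq_norm I x) \<le> bilin I S' x x"
    proof -
      have "- (\<kappa> * sq_norm I x) \<le> bilin I S x x" using bd'[of x 0] by (simp add: abs_le_iff)
      moreover have "2 * (b x)\<^sup>2 / (1 - 2 * s) \<ge> 0" using s1 by (intro divide_nonneg_nonneg) auto
      ultimately show ?thesis unfolding S'form by linarith
    qed
    ultimately show "\<bar>bilin I S' x x\<bar> \<le> \<kappa> * sq_norm I x" by linarith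
  qed
  have tr: "(\<Sum>i\<in>I. S' i i) \<le> (\<Sum>i\<in>I. S i i) + 8 / 3 * \<kappa>\<^sup>2"
  proof -
    have "2 / (1 - 2 * s) * (\<Sum>i\<in>I. (S i k)\<^sup>2) \<le> 8 / 3 * \<kappa>\<^sup>2"
      using s1 col by (intro mult_mono) (auto simp: field_simps sum_nonneg)
    then show ?thesis unfolding S'_def by (simp add: sum.distrib sum_distrib_left power2_eq_square)
  qed
  have inner: "(\<integral>\<^sup>+y. ennreal (exp (bilin (insert k I) S (x(k := y)) (x(k := y)))) \<partial>std_normal_distribution)
      = ennreal (exp (bilin I S' x x)) * ennreal (1 / sqrt (1 - 2 * s))" for x
  proof -
    have "(\<integral>\<^sup>+y. ennreal (exp (bilin (insert k I) S (x(k := y)) (x(k := y)))) \<partial>std_normal_distribution)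
        = (\<integral>\<^sup>+y. ennreal (exp (bilin I S x x)) * ennreal (exp (s * y\<^sup>2 + (2 * b x) * y)) \<partial>std_normal_distribution)"
      unfolding expand upd by (simp add: ennreal_mult[symmetric] exp_add[symmetric] algebra_simps)
    also have "\<dots> = ennreal (exp (bilin I S x x)) * ennreal (exp ((2 * b x)\<^sup>2 / (2 * (1 - 2 * s))) / sqrt (1 - 2 * s))"
      using s1 by (subst nn_integral_cmult) (auto simp: nn_integral_std_normal_exp_quadratic)
    also have "\<dots> = ennreal (exp (bilin I S' x x)) * ennreal (1 / sqrt (1 - 2 * s))"
    proof -
      have h: "(2 * b x)\<^sup>2 / (2 * t) = 2 * (b x)\<^sup>2 / t" for t by (simp add: power_mult_distrib)
      show ?thesis unfolding S'form h using s1 by (simp add: ennreal_mult[symmetric] exp_add)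
    qed
    finally show ?thesis .
  qed
  have [measurable]: "(\<lambda>z. bilin J T z z) \<in> borel_measurable (std_gauss J)" for J :: "'i set" and T
    unfolding bilin_def by measurable
  have "(\<integral>\<^sup>+z. ennreal (exp (bilin (insert k I) S z z)) \<partial>std_gauss (insert k I))
      = (\<integral>\<^sup>+x. \<integral>\<^sup>+y. ennreal (exp (bilin (insert k I) S (x(k := y)) (x(k := y)))) \<partial>std_normal_distribution \<partial>std_gauss I)"
    using insert.hyps by (intro G.product_nn_integral_insert) auto
  also have "\<dots> = (\<integral>\<^sup>+x. ennreal (exp (bilin I S' x x)) \<partial>std_gauss I) * ennreal (1 / sqrt (1 - 2 * s))"
    unfolding inner by (rule nn_integral_multc) measurable
  also have "\<dots> \<le> ennreal (exp ((\<Sum>i\<in>I. S' i i) + 7 * card I * \<kappa>\<^sup>2)) * ennreal (exp (s + 4 * s\<^sup>2))"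
    using IH inverse_sqrt_le_exp[of s] s assms(3) by (intro mult_mono ennreal_leI) auto
  also have "\<dots> \<le> ennreal (exp ((\<Sum>i\<in>insert k I. S i i) + 7 * card (insert k I) * \<kappa>\<^sup>2))"
  proof -
    have "s\<^sup>2 \<le> \<kappa>\<^sup>2" using s power_mono[of "\<bar>s\<bar>" \<kappa> 2] by simp
    moreover have "(\<Sum>i\<in>insert k I. S i i) = s + (\<Sum>i\<in>I. S i i)"
      "7 * real (card (insert k I)) * \<kappa>\<^sup>2 = 7 * card I * \<kappa>\<^sup>2 + 7 * \<kappa>\<^sup>2"
      using insert.hyps by (simp_all add: s_def algebra_simps)
    moreover have "\<kappa>\<^sup>2 \<ge> 0" by (rule zero_le_power2)
    ultimately have "(\<Sum>i\<in>I. S' i i) + 7 * card I * \<kappa>\<^sup>2 + (s + 4 * s\<^sup>2)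
        \<le> (\<Sum>i\<in>insert k I. S i i) + 7 * card (insert k I) * \<kappa>\<^sup>2"
      using tr by linarith
    then show ?thesis by (simp add: ennreal_mult[symmetric] exp_add[symmetric])
  qed
  finally show ?case .
qed

section \<open>Deviation of sums of independent copies\<close>

text \<open>
  The exponent \<open>\<tau>\<close> is \<open>\<sigma>\<close> times the minimiser \<open>t / (2 V)\<close> of \<open>V \<theta>\<^sup>2 - \<theta> t\<close>; the sign \<open>\<sigma>\<close> selects the upper
  or the lower tail.
\<close>

lemma chernoff_one_sided:
  fixes q :: "'a \<Rightarrow> real" and n :: nat and e t V \<tau> \<sigma> :: real
  assumes M: "prob_space M" and [measurable]: "q \<in> borel_measurable M"
    and mgf: "(\<integral>\<^sup>+x. ennreal (exp (\<tau> * q x)) \<partial>M) \<le> ennreal (exp (\<tau> * e + V * \<tau>\<^sup>2))"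
    and \<tau>: "\<tau> = \<sigma> * t / (2 * V)" and \<sigma>: "\<sigma>\<^sup>2 = 1" and V: "V > 0" and t: "t \<ge> 0"
  shows "measure (PiM {..<n} (\<lambda>_. M)) {X \<in> space (PiM {..<n} (\<lambda>_. M)). n * t \<le> \<sigma> * ((\<Sum>j<n. q (X j)) - n * e)}
    \<le> exp (- (n * t\<^sup>2 / (4 * V)))"
proof -
  interpret M: prob_space M by (rule M)
  interpret G: product_sigma_finite "\<lambda>_::nat. M" by unfold_locales
  let ?P = "PiM {..<n} (\<lambda>_. M)"
  interpret P: prob_space ?P by (rule prob_space_PiM) (rule M)
  let ?A = "{X \<in> space ?P. n * t \<le> \<sigma> * ((\<Sum>j<n. q (X j)) - n * e)}"
  define \<theta> where "\<theta> = t / (2 * V)"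
  have th: "\<tau> = \<sigma> * \<theta>" "\<theta> \<ge> 0" "\<tau>\<^sup>2 = \<theta>\<^sup>2" using \<tau> \<sigma> V t by (auto simp: \<theta>_def power_mult_distrib power_divide)
  define K where "K = exp (- (\<theta> * (n * t)) - \<tau> * (n * e))"
  have "emeasure ?P ?A = (\<integral>\<^sup>+X. indicator ?A X \<partial>?P)" by (subst nn_integral_indicator) auto
  also have "\<dots> \<le> (\<integral>\<^sup>+X. ennreal K * (\<Prod>j<n. ennreal (exp (\<tau> * q (X j)))) \<partial>?P)"
  proof (rule nn_integral_mono)
    fix X :: "nat \<Rightarrow> 'a"
    have "1 \<le> K * (\<Prod>j<n. exp (\<tau> * q (X j)))" if "n * t \<le> \<sigma> * ((\<Sum>j<n. q (X j)) - n * e)"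
    proof -
      have "\<theta> * (n * t) \<le> \<theta> * (\<sigma> * ((\<Sum>j<n. q (X j)) - n * e))"
        using that th(2) by (rule mult_left_mono)
      then have "0 \<le> - (\<theta> * (n * t)) - \<tau> * (n * e) + (\<Sum>j<n. \<tau> * q (X j))"
        by (simp add: th(1) algebra_simps sum_distrib_left)
      then have "1 \<le> exp (- (\<theta> * (n * t)) - \<tau> * (n * e) + (\<Sum>j<n. \<tau> * q (X j)))" by simp
      moreover have "exp (\<Sum>j<n. \<tau> * q (X j)) = (\<Prod>j<n. exp (\<tau> * q (X j)))" by (rule exp_sum) simp
      ultimately show ?thesis by (simp only: K_def exp_add)
    qed
    then show "indicator ?A X \<le> ennreal K * (\<Prod>j<n. ennreal (exp (\<tau> * q (X j))))"
      by (auto simp: indicator_def prod_ennreal K_def ennreal_mult[symmetric] prod_nonneg ennreal_1[symmetric] simp del: ennreal_1)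
  qed
  also have "\<dots> = ennreal K * (\<integral>\<^sup>+X. (\<Prod>j<n. ennreal (exp (\<tau> * q (X j)))) \<partial>?P)"
    by (rule nn_integral_cmult) measurable
  also have "(\<integral>\<^sup>+X. (\<Prod>j<n. ennreal (exp (\<tau> * q (X j)))) \<partial>?P) = (\<Prod>j<n. \<integral>\<^sup>+x. ennreal (exp (\<tau> * q x)) \<partial>M)"
    by (rule G.product_nn_integral_prod) auto
  also have "\<dots> \<le> (\<Prod>j<n. ennreal (exp (\<tau> * e + V * \<tau>\<^sup>2)))"
    using mgf by (intro prod_mono_ennreal)
  also have "ennreal K * (\<Prod>j<n. ennreal (exp (\<tau> * e + V * \<tau>\<^sup>2))) = ennreal (K * exp (n * (\<tau> * e + V * \<tau>\<^sup>2)))"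
    by (simp add: ennreal_power K_def ennreal_mult[symmetric] exp_of_nat_mult)
  also have "K * exp (n * (\<tau> * e + V * \<tau>\<^sup>2)) = exp (- (n * t\<^sup>2 / (4 * V)))"
  proof -
    have "- (\<theta> * (n * t)) - \<tau> * (n * e) + n * (\<tau> * e + V * \<tau>\<^sup>2) = - (n * t\<^sup>2 / (4 * V))"
      unfolding th(3) using V by (simp add: \<theta>_def power2_eq_square field_simps)
    then show ?thesis unfolding K_def exp_add[symmetric] by simp
  qed
  finally show ?thesis by (simp add: P.emeasure_eq_measure mult_left_mono)
qed

lemma chernoff_two_sided:
  fixes q :: "'a \<Rightarrow> real" and n :: nat and e t V \<tau>0 :: real
  assumes M: "prob_space M" and q [measurable]: "q \<in> borel_measurable M"
    and mgf: "\<And>\<tau>. \<bar>\<tau>\<bar> \<le> \<tau>0 \<Longrightarrow> (\<integral>\<^sup>+x. ennreal (exp (\<tau> * q x)) \<partial>M) \<le> ennreal (exp (\<tau> * e + V * \<tau>\<^sup>2))"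
    and V: "V > 0" and t: "t \<ge> 0" "t / (2 * V) \<le> \<tau>0"
  shows "measure (PiM {..<n} (\<lambda>_. M)) {X \<in> space (PiM {..<n} (\<lambda>_. M)). n * t \<le> \<bar>(\<Sum>j<n. q (X j)) - n * e\<bar>}
    \<le> 2 * exp (- (n * t\<^sup>2 / (4 * V)))"
proof -
  let ?P = "PiM {..<n} (\<lambda>_. M)"
  interpret P: prob_space ?P by (rule prob_space_PiM) (rule M)
  let ?A = "\<lambda>\<sigma>. {X \<in> space ?P. n * t \<le> \<sigma> * ((\<Sum>j<n. q (X j)) - n * e)}"
  have one: "measure ?P (?A \<sigma>) \<le> exp (- (n * t\<^sup>2 / (4 * V)))" if "\<sigma> = 1 \<or> \<sigma> = -1" for \<sigma> :: real
    by (rule chernoff_one_sided[OF M q mgf[of "\<sigma> * t / (2 * V)"] refl _ V t(1)]) (use that t V in auto)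
  have "measure ?P {X \<in> space ?P. n * t \<le> \<bar>(\<Sum>j<n. q (X j)) - n * e\<bar>} \<le> measure ?P (?A 1 \<union> ?A (-1))"
    by (rule P.finite_measure_mono) auto
  also have "\<dots> \<le> measure ?P (?A 1) + measure ?P (?A (-1))"
    by (rule measure_Un_le) auto
  finally show ?thesis using one[of 1] one[of "-1"] by simp
qed

section \<open>Permutation matrices and block diagonal matrices\<close>

lemma perm_group_permutes:
  assumes "subgroup G (sym_group p)" "g \<in> G"
  shows "g permutes {1..p}"
  using subgroup.subset[OF assms(1)] assms(2) by (auto simp: sym_group_def)

lemma perm_group_finite:
  assumes "subgroup G (sym_group p)"
  shows "finite G"
  by (rule finite_subset[OF _ finite_permutations[of "{1..p}"]]) (use perm_group_permutes[OF assms] in auto)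

text \<open>
  The permutation that \<open>g\<close> induces on the matrix indices, which start from \<open>0\<close>.
\<close>

definition shift_perm :: "(nat \<Rightarrow> nat) \<Rightarrow> nat \<Rightarrow> nat" where
  "shift_perm g j = g (Suc j) - 1"

lemma Suc_shift:
  assumes "g permutes {1..p}" "j < p"
  shows "Suc (shift_perm g j) = g (Suc j)"
  using permutes_in_image[OF assms(1), of "Suc j"] assms(2) by (simp add: shift_perm_def)

lemma shift_less:
  assumes "g permutes {1..p}" "j < p"
  shows "shift_perm g j < p"
  using permutes_in_image[OF assms(1), of "Suc j"] assms(2) by (auto simp: shift_perm_def)

lemma inj_on_shift:
  assumes "g permutes {1..p}"
  shows "inj_on (shift_perm g) {..<p}"
proof (rule inj_onI)
  fix x y assume xy: "x \<in> {..<p}" "y \<in> {..<p}" "shift_perm g x = shift_perm g y"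
  then have "g (Suc x) = g (Suc y)" using Suc_shift[OF assms, of x] Suc_shift[OF assms, of y] by simp
  then show "x = y" using permutes_inj[OF assms] by (auto dest: injD)
qed

lemma bij_betw_shift:
  assumes "g permutes {1..p}"
  shows "bij_betw (shift_perm g) {..<p} {..<p}"
proof -
  have "shift_perm g ` {..<p} = {..<p}"
    by (rule endo_inj_surj) (use shift_less[OF assms] inj_on_shift[OF assms] in auto)
  then show ?thesis using inj_on_shift[OF assms] by (simp add: bij_betw_def)
qed

lemma sum_shift:
  assumes "g permutes {1..p}"
  shows "(\<Sum>j<p. f (shift_perm g j)) = (\<Sum>j<p. f j)"
  by (rule sum.reindex_bij_betw[OF bij_betw_shift[OF assms]])

lemma perm_mat_carrier [simp]: "perm_mat p g \<in> carrier_mat p p"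
  by (simp add: perm_mat_def)

lemma perm_mat_index:
  assumes "g permutes {1..p}" "i < p" "j < p"
  shows "perm_mat p g $$ (i, j) = (if i = shift_perm g j then 1 else 0)"
  using assms Suc_shift[OF assms(1,3)] by (auto simp: perm_mat_def)

lemma mult_mat_index:
  assumes "A \<in> carrier_mat n k" "B \<in> carrier_mat k l" "i < n" "j < l"
  shows "(A * B) $$ (i, j) = (\<Sum>q<k. A $$ (i, q) * B $$ (q, j))"
  using assms by (simp add: scalar_prod_def atLeast0LessThan)

lemma perm_mat_mult_index:
  fixes N :: "'a::semiring_1 mat"
  assumes g: "g permutes {1..p}" and N: "N \<in> carrier_mat p k" and "j < p" "c < k"
  shows "(perm_mat p g * N) $$ (shift_perm g j, c) = N $$ (j, c)"
proof -
  have "(perm_mat p g * N) $$ (shift_perm g j, c) = (\<Sum>q<p. perm_mat p g $$ (shift_perm g j, q) * N $$ (q, c))"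
    using assms shift_less[OF g] by (intro mult_mat_index[of _ p p _ k]) auto
  also have "\<dots> = (\<Sum>q<p. if q = j then N $$ (q, c) else 0)"
    using assms shift_less[OF g] inj_onD[OF inj_on_shift[OF g]]
    by (intro sum.cong refl) (auto simp: perm_mat_index)
  finally show ?thesis using assms by simp
qed

lemma mult_perm_mat_transpose_index:
  fixes N :: "'a::semiring_1 mat"
  assumes g: "g permutes {1..p}" and N: "N \<in> carrier_mat k p" and "j < p" "c < k"
  shows "(N * transpose_mat (perm_mat p g)) $$ (c, shift_perm g j) = N $$ (c, j)"
proof -
  have "(N * transpose_mat (perm_mat p g)) $$ (c, shift_perm g j)
      = (\<Sum>q<p. N $$ (c, q) * transpose_mat (perm_mat p g) $$ (q, shift_perm g j))"
    using assms shift_less[OF g] by (intro mult_mat_index[of _ k p _ p]) auto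
  also have "\<dots> = (\<Sum>q<p. if q = j then N $$ (c, q) else 0)"
  proof (rule sum.cong[OF refl])
    fix q assume "q \<in> {..<p}"
    then have "transpose_mat (perm_mat p g :: 'a mat) $$ (q, shift_perm g j) = perm_mat p g $$ (shift_perm g j, q)"
      using shift_less[OF g \<open>j < p\<close>] by (intro index_transpose_mat) (simp_all add: perm_mat_def)
    then show "N $$ (c, q) * transpose_mat (perm_mat p g) $$ (q, shift_perm g j) = (if q = j then N $$ (c, q) else 0)"
      using assms shift_less[OF g] inj_onD[OF inj_on_shift[OF g]] \<open>q \<in> {..<p}\<close>
      by (auto simp: perm_mat_index)
  qed
  finally show ?thesis using assms by simp
qed

text \<open>
  Conjugation by a permutation matrix moves the entry at \<open>(i, j)\<close> to the permuted position; hence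
  invariance says that the entries are constant along the orbits of index pairs.
\<close>

lemma invariant_mats_iff:
  assumes G: "\<And>g. g \<in> G \<Longrightarrow> g permutes {1..p}"
  shows "M \<in> invariant_mats p G \<longleftrightarrow> M \<in> carrier_mat p p \<and>
    (\<forall>g\<in>G. \<forall>i<p. \<forall>j<p. M $$ (shift_perm g i, shift_perm g j) = M $$ (i, j))"
proof -
  have conj: "(perm_mat p g * M * transpose_mat (perm_mat p g)) $$ (shift_perm g i, shift_perm g j) = M $$ (i, j)"
    if "g \<in> G" "M \<in> carrier_mat p p" "i < p" "j < p" for g i j
    using that mult_carrier_mat[OF perm_mat_carrier that(2), of g]
    by (subst mult_perm_mat_transpose_index[OF G, of g "perm_mat p g * M" p])
      (auto simp: perm_mat_mult_index[OF G] shift_less[OF G])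
  show ?thesis
  proof (intro iffI conjI ballI allI impI)
    assume M: "M \<in> invariant_mats p G"
    then show "M \<in> carrier_mat p p" by (simp add: invariant_mats_def)
    fix g i j assume "g \<in> G" "i < p" "j < p"
    then show "M $$ (shift_perm g i, shift_perm g j) = M $$ (i, j)"
      using M conj[of g i j] by (simp add: invariant_mats_def)
  next
    assume M: "M \<in> carrier_mat p p \<and> (\<forall>g\<in>G. \<forall>i<p. \<forall>j<p. M $$ (shift_perm g i, shift_perm g j) = M $$ (i, j))"
    have "perm_mat p g * M * transpose_mat (perm_mat p g) = M" if g: "g \<in> G" for g
    proof (rule eq_matI)
      fix a b assume "a < dim_row M" "b < dim_col M"
      then have "a \<in> shift_perm g ` {..<p}" "b \<in> shift_perm g ` {..<p}"
        using M bij_betw_imp_surj_on[OF bij_betw_shift[OF G[OF g]]] by auto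
      then obtain i j where "a = shift_perm g i" "i < p" "b = shift_perm g j" "j < p" by blast
      then show "(perm_mat p g * M * transpose_mat (perm_mat p g)) $$ (a, b) = M $$ (a, b)"
        using M conj[OF g, of i j] g by simp
    qed (use M in \<open>auto simp: carrier_matD[OF perm_mat_carrier]\<close>)
    with M show "M \<in> invariant_mats p G" by (simp add: invariant_mats_def)
  qed
qed

lemma mat_adjoint_index:
  fixes A :: "complex mat"
  assumes "A \<in> carrier_mat n k" "i < k" "j < n"
  shows "mat_adjoint A $$ (i, j) = cnj (A $$ (j, i))"
  using assms by (simp add: mat_adjoint_def mat_of_rows_def)

lemma mat_adjoint_carrier [simp]:
  fixes A :: "complex mat"
  assumes "A \<in> carrier_mat n k"
  shows "mat_adjoint A \<in> carrier_mat k n"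
  using assms by (simp add: mat_adjoint_def mat_of_rows_def)

lemma sum_lessThan_add: "(\<Sum>q<a + b. f q) = (\<Sum>q<a. f q) + (\<Sum>x<b. f (a + x))"
  for f :: "nat \<Rightarrow> 'a::comm_monoid_add"
  by (induction b) (auto simp: add.assoc)

lemma sum_over_blocks:
  fixes f :: "nat \<Rightarrow> 'a::comm_monoid_add" and d :: "nat \<Rightarrow> nat"
  shows "(\<Sum>q<(\<Sum>i<r. d i). f q) = (\<Sum>i<r. \<Sum>x<d i. f ((\<Sum>l<i. d l) + x))"
  by (induction r) (auto simp: sum_lessThan_add)

lemma sum_over_equal_blocks:
  fixes f :: "nat \<Rightarrow> 'a::comm_monoid_add"
  shows "(\<Sum>q<m * s. f q) = (\<Sum>k<m. \<Sum>a<s. f (k * s + a))"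
  using sum_over_blocks[where d = "\<lambda>_. s" and r = m and f = f] by simp

lemma block_offset_mono:
  fixes d :: "nat \<Rightarrow> nat"
  assumes "i < j"
  shows "(\<Sum>l<i. d l) + d i \<le> (\<Sum>l<j. d l)"
  using sum_mono2[of "{..<j}" "{..<Suc i}" d] assms by auto

lemma block_index_inject:
  fixes d :: "nat \<Rightarrow> nat"
  assumes "x < d i" "y < d j"
  shows "(\<Sum>l<i. d l) + x = (\<Sum>l<j. d l) + y \<longleftrightarrow> i = j \<and> x = y"
  using block_offset_mono[of i j d] block_offset_mono[of j i d] assms by (cases i j rule: linorder_cases) auto

lemma diag_block_mat_map_carrier:
  assumes "\<And>i. i < r \<Longrightarrow> f i \<in> carrier_mat (d i) (d i)"
  shows "diag_block_mat (map f [0..<r]) \<in> carrier_mat (\<Sum>i<r. d i) (\<Sum>i<r. d i)"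
proof -
  have "sum_list (map dim_row (map f [0..<r])) = (\<Sum>i<r. d i)" "sum_list (map dim_col (map f [0..<r])) = (\<Sum>i<r. d i)"
    unfolding map_map interv_sum_list_conv_sum_set_nat
    using carrier_matD[OF assms] by (auto intro!: sum.cong simp: atLeast0LessThan)
  then show ?thesis by (intro carrier_matI) (simp_all only: dim_diag_block_mat)
qed

lemma diag_block_mat_map_index:
  assumes "\<And>i. i < r \<Longrightarrow> f i \<in> carrier_mat (d i) (d i)"
    and "i < r" "j < r" "x < d i" "y < d j"
  shows "diag_block_mat (map f [0..<r]) $$ ((\<Sum>l<i. d l) + x, (\<Sum>l<j. d l) + y)
    = (if i = j then f i $$ (x, y) else 0)"
  using assms
proof (induction r)
  case (Suc r)
  define A where "A = diag_block_mat (map f [0..<r])"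
  let ?o = "\<lambda>i. \<Sum>l<i. d l"
  have A: "A \<in> carrier_mat (?o r) (?o r)" unfolding A_def using Suc.prems(1) by (intro diag_block_mat_map_carrier) auto
  have B: "f r \<in> carrier_mat (d r) (d r)" using Suc.prems(1) by auto
  have D: "diag_block_mat (map f [0..<Suc r])
      = four_block_mat A (0\<^sub>m (?o r) (d r)) (0\<^sub>m (d r) (?o r)) (f r)"
    using carrier_matD[OF A] carrier_matD[OF B]
    by (simp add: diag_block_mat_last Let_def A_def[symmetric])
  have lt: "?o l + z < ?o r" if "l < r" "z < d l" for l z
    using block_offset_mono[OF that(1), of d] that(2) by linarith
  have row: "?o i + x < ?o r + d r" using lt[of i x] Suc.prems by (cases "i = r") auto
  have col: "?o j + y < ?o r + d r" using lt[of j y] Suc.prems by (cases "j = r") auto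
  have IH: "i < r \<Longrightarrow> j < r \<Longrightarrow> A $$ (?o i + x, ?o j + y) = (if i = j then f i $$ (x, y) else 0)"
    unfolding A_def using Suc by auto
  show ?case
    unfolding D using row col carrier_matD[OF A] carrier_matD[OF B] Suc.prems(2-5) lt[of i x] lt[of j y] IH
    by (cases "i = r"; cases "j = r") (auto simp: not_less)
qed simp

lemma kron_one_carrier:
  assumes "A \<in> carrier_mat m m"
  shows "kron_one A s \<in> carrier_mat (m * s) (m * s)"
  using assms by (simp add: kron_one_def)

lemma mult_add_less: "k * s + a < m * s" if "k < m" "a < s" for k s a m :: nat
proof -
  have "Suc k * s \<le> m * s" using that by (intro mult_le_mono1) auto
  with that show ?thesis by simp
qed

lemma kron_one_index:
  assumes "A \<in> carrier_mat m m" "k < m" "l < m" "a < s" "b < s"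
  shows "kron_one A s $$ (k * s + a, l * s + b) = (if a = b then A $$ (k, l) else 0)"
  using assms by (simp add: kron_one_def mult_add_less)

lemma replicate_block_index:
  assumes "B \<in> carrier_mat s s" "k < m" "l < m" "a < s" "b < s"
  shows "diag_block_mat (replicate m B) $$ (k * s + a, l * s + b) = (if k = l then B $$ (a, b) else 0)"
  using diag_block_mat_map_index[of m "\<lambda>_. B" "\<lambda>_. s" k l a b] assms
  by (simp add: map_replicate_const)

lemma replicate_block_carrier:
  assumes "B \<in> carrier_mat s s"
  shows "diag_block_mat (replicate m B) \<in> carrier_mat (m * s) (m * s)"
  using diag_block_mat_map_carrier[of m "\<lambda>_. B" "\<lambda>_. s"] assms
  by (simp add: map_replicate_const)

section \<open>Test vectors from the decomposition into irreducible representations\<close>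

abbreviation bool_unit :: "bool \<Rightarrow> complex" where
  "bool_unit b \<equiv> (if b then \<i> else 1)"

definition complexify :: "('a \<times> bool \<Rightarrow> real) \<Rightarrow> 'a \<Rightarrow> complex" where
  "complexify z a = (\<Sum>b\<in>UNIV. z (a, b) * bool_unit b)"

lemma complexify_eq: "complexify z a = Complex (z (a, False)) (z (a, True))"
  by (simp add: complexify_def UNIV_bool complex_eq_iff)

lemma sum_times_bool: "(\<Sum>x\<in>A \<times> (UNIV :: bool set). f x) = (\<Sum>a\<in>A. f (a, False) + f (a, True))"
  by (simp add: sum.cartesian_product' UNIV_bool add.commute)

lemma sq_norm_complexify: "sq_norm (A \<times> UNIV) z = (\<Sum>a\<in>A. (cmod (complexify z a))\<^sup>2)"
  by (simp add: sq_norm_def sum_times_bool complexify_eq cmod_def)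

lemma sum_product_sums:
  fixes x y :: "'a \<Rightarrow> 'b \<Rightarrow> 'c::comm_semiring_0"
  shows "(\<Sum>j\<in>A. (\<Sum>b\<in>B. x j b) * (\<Sum>b'\<in>C. y j b')) = (\<Sum>b\<in>B. \<Sum>b'\<in>C. \<Sum>j\<in>A. x j b * y j b')"
proof -
  have "(\<Sum>j\<in>A. (\<Sum>b\<in>B. x j b) * (\<Sum>b'\<in>C. y j b')) = (\<Sum>j\<in>A. \<Sum>b\<in>B. \<Sum>b'\<in>C. x j b * y j b')"
    by (simp only: sum_product)
  also have "\<dots> = (\<Sum>b\<in>B. \<Sum>j\<in>A. \<Sum>b'\<in>C. x j b * y j b')" by (rule sum.swap)
  also have "\<dots> = (\<Sum>b\<in>B. \<Sum>b'\<in>C. \<Sum>j\<in>A. x j b * y j b')" by (intro sum.cong refl sum.swap)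
  finally show ?thesis .
qed

text \<open>
  The columns of \<open>T\<close> form an orthonormal basis of complex \<open>p\<close>-space indexed by triples: the
  irreducible representation \<open>i\<close>, a basis vector \<open>k < m i\<close> of it, and the number \<open>a < s i\<close> of its
  occurrence. The map \<open>idx\<close> below translates such a triple to a column number.
\<close>

locale block_frame =
  fixes p :: nat and G :: "(nat \<Rightarrow> nat) set" and r :: nat and s m :: "nat \<Rightarrow> nat"
    and \<rho> :: "nat \<Rightarrow> (nat \<Rightarrow> nat) \<Rightarrow> complex mat" and T :: "complex mat"
  assumes G: "subgroup G (sym_group p)"
    and dec: "block_decomposition p G r s m \<rho> T"
begin

lemma G_permutes: "g \<in> G \<Longrightarrow> g permutes {1..p}"
  by (rule perm_group_permutes[OF G])

lemma s_pos: "i < r \<Longrightarrow> s i > 0" and m_pos: "i < r \<Longrightarrow> m i > 0"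
  using dec by (auto simp: block_decomposition_def irreducible_rep_def)

lemma \<rho>_carrier: "i < r \<Longrightarrow> g \<in> G \<Longrightarrow> \<rho> i g \<in> carrier_mat (m i) (m i)"
  using dec by (auto simp: block_decomposition_def irreducible_rep_def matrix_rep_def)

lemma T_carrier [simp]: "T \<in> carrier_mat p p"
  using dec by (simp add: block_decomposition_def unitary_mat_def)

definition idx :: "nat \<Rightarrow> nat \<Rightarrow> nat \<Rightarrow> nat" where
  "idx i k a = (\<Sum>l<i. m l * s l) + (k * s i + a)"

lemma idx_inject:
  assumes "k < m i" "a < s i" "l < m j" "b < s j"
  shows "idx i k a = idx j l b \<longleftrightarrow> i = j \<and> k = l \<and> a = b"
proof -
  have "idx i k a = idx j l b \<longleftrightarrow> i = j \<and> k * s i + a = l * s j + b"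
    unfolding idx_def using assms
    by (intro block_index_inject[where d = "\<lambda>l. m l * s l"]) (auto intro: mult_add_less)
  moreover have "k = l \<and> a = b" if "i = j" "k * s i + a = l * s j + b"
  proof -
    have "(k * s i + a) div s i = k" "(k * s i + a) mod s i = a"
      "(l * s i + b) div s i = l" "(l * s i + b) mod s i = b" using assms that(1) by auto
    with that show ?thesis by auto
  qed
  ultimately show ?thesis by auto
qed

lemma kron_block_carrier:
  assumes "g \<in> G" "i < r"
  shows "kron_one (\<rho> i g) (s i) \<in> carrier_mat (m i * s i) (m i * s i)"
  using \<rho>_carrier[OF assms(2,1)] by (rule kron_one_carrier)

lemma id_in_G: "id \<in> G"
  using subgroup.one_closed[OF G] by (simp add: sym_group_one)

lemma dim_eq: "(\<Sum>i<r. m i * s i) = p"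
proof -
  have "mat_adjoint T * perm_mat p id * T = diag_block_mat (map (\<lambda>i. kron_one (\<rho> i id) (s i)) [0..<r])"
    using dec id_in_G by (simp add: block_decomposition_def)
  also have "\<dots> \<in> carrier_mat (\<Sum>i<r. m i * s i) (\<Sum>i<r. m i * s i)"
    by (rule diag_block_mat_map_carrier) (rule kron_block_carrier[OF id_in_G])
  finally have "dim_row (mat_adjoint T * perm_mat p id * T) = (\<Sum>i<r. m i * s i)" by (rule carrier_matD)
  then show ?thesis using carrier_matD[OF mat_adjoint_carrier[OF T_carrier]] by simp
qed

lemma idx_less:
  assumes "i < r" "k < m i" "a < s i"
  shows "idx i k a < p"
proof -
  have "k * s i + a < m i * s i" using assms by (intro mult_add_less)
  then show ?thesis
    using block_offset_mono[OF assms(1), of "\<lambda>l. m l * s l"] dim_eq unfolding idx_def by linarith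
qed

lemma sum_idx:
  fixes f :: "nat \<Rightarrow> 'a::comm_monoid_add"
  shows "(\<Sum>q<p. f q) = (\<Sum>i<r. \<Sum>k<m i. \<Sum>a<s i. f (idx i k a))"
  unfolding dim_eq[symmetric] sum_over_blocks sum_over_equal_blocks idx_def ..

lemma columns_orthonormal:
  assumes "q < p" "q' < p"
  shows "(\<Sum>j<p. cnj (T $$ (j, q)) * T $$ (j, q')) = (if q = q' then 1 else 0)"
proof -
  have "mat_adjoint T * T = 1\<^sub>m p" using dec by (simp add: block_decomposition_def unitary_mat_def)
  then have "(mat_adjoint T * T) $$ (q, q') = (if q = q' then 1 else 0)" using assms by simp
  then show ?thesis
    using assms by (subst (asm) mult_mat_index[of _ p p _ p]) (auto simp: mat_adjoint_index[OF T_carrier])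
qed

lemma rows_orthonormal:
  assumes "j < p" "j' < p"
  shows "(\<Sum>q<p. T $$ (j, q) * cnj (T $$ (j', q))) = (if j = j' then 1 else 0)"
proof -
  have "T * mat_adjoint T = 1\<^sub>m p" using dec by (simp add: block_decomposition_def unitary_mat_def)
  then have "(T * mat_adjoint T) $$ (j, j') = (if j = j' then 1 else 0)" using assms by simp
  then show ?thesis
    using assms by (subst (asm) mult_mat_index[of _ p p _ p]) (auto simp: mat_adjoint_index[OF T_carrier])
qed

text \<open>
  The equation \<open>\<Pi> T = T K\<close> for the block diagonal form \<open>K\<close> of the permutation matrix \<open>\<Pi>\<close>, read off row by
  row. The action mixes only the index \<open>k\<close> and keeps \<open>i\<close> and \<open>a\<close>.
\<close>

lemma T_row_transform:
  assumes g: "g \<in> G" and j: "j < p" and i: "i < r" "k < m i" "a < s i"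
  shows "T $$ (j, idx i k a) = (\<Sum>b<m i. T $$ (shift_perm g j, idx i b a) * \<rho> i g $$ (b, k))"
proof -
  define K where "K = diag_block_mat (map (\<lambda>i. kron_one (\<rho> i g) (s i)) [0..<r])"
  define P where "P = (perm_mat p g :: complex mat)"
  have P: "P \<in> carrier_mat p p" by (simp add: P_def)
  have TA: "mat_adjoint T \<in> carrier_mat p p" by simp
  have "mat_adjoint T * P * T = K" using dec g by (simp add: block_decomposition_def K_def P_def)
  then have "T * K = T * (mat_adjoint T * P * T)" by simp
  also have "\<dots> = (T * mat_adjoint T) * (P * T)"
    using assoc_mult_mat[OF TA P T_carrier] assoc_mult_mat[OF T_carrier TA mult_carrier_mat[OF P T_carrier]] by simp
  also have "\<dots> = P * T"
    using dec P T_carrier by (simp add: block_decomposition_def unitary_mat_def left_mult_one_mat[OF mult_carrier_mat])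
  finally have PT: "P * T = T * K" ..
  have K: "K \<in> carrier_mat p p"
    unfolding K_def by (subst (1 2) dim_eq[symmetric]) (rule diag_block_mat_map_carrier, rule kron_block_carrier[OF g])
  have Kent: "K $$ (idx i' k' a', idx i k a) = (if i' = i \<and> a' = a then \<rho> i g $$ (k', k) else 0)"
    if "i' < r" "k' < m i'" "a' < s i'" for i' k' a'
  proof -
    have "K $$ (idx i' k' a', idx i k a)
        = (if i' = i then kron_one (\<rho> i' g) (s i') $$ (k' * s i' + a', k * s i + a) else 0)"
      unfolding K_def idx_def using that i
      by (intro diag_block_mat_map_index[where d = "\<lambda>l. m l * s l"])
        (auto intro: mult_add_less kron_block_carrier[OF g])
    then show ?thesis using that i kron_one_index[OF \<rho>_carrier[OF i(1) g]] by auto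
  qed
  have "T $$ (j, idx i k a) = (P * T) $$ (shift_perm g j, idx i k a)"
    unfolding P_def by (rule perm_mat_mult_index[OF G_permutes[OF g] T_carrier j idx_less[OF i], symmetric])
  also have "\<dots> = (\<Sum>q<p. T $$ (shift_perm g j, q) * K $$ (q, idx i k a))"
    unfolding PT using K j idx_less[OF i] shift_less[OF G_permutes[OF g]]
    by (intro mult_mat_index[of _ p p _ p]) auto
  also have "\<dots> = (\<Sum>i'<r. \<Sum>k'<m i'. \<Sum>a'<s i'.
      if i' = i then if a' = a then T $$ (shift_perm g j, idx i' k' a') * \<rho> i g $$ (k', k) else 0 else 0)"
    unfolding sum_idx by (intro sum.cong refl) (auto simp: Kent)
  also have "\<dots> = (\<Sum>i'<r. if i' = i then \<Sum>k'<m i'. \<Sum>a'<s i'.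
      if a' = a then T $$ (shift_perm g j, idx i' k' a') * \<rho> i g $$ (k', k) else 0 else 0)"
    by (intro sum.cong refl) auto
  also have "\<dots> = (\<Sum>b<m i. T $$ (shift_perm g j, idx i b a) * \<rho> i g $$ (b, k))"
    using i by simp
  finally show ?thesis .
qed

text \<open>
  Permuting the rows of \<open>T\<close> preserves the orthonormality of its columns, so \<open>\<rho> i g\<close> has orthonormal
  columns, hence also orthonormal rows, which is the form needed below. The occurrence \<open>a = 0\<close>
  serves as a representative.
\<close>

lemma \<rho>_unitary:
  assumes g: "g \<in> G" and i: "i < r" and "k < m i" "k' < m i"
  shows "(\<Sum>b<m i. \<rho> i g $$ (k, b) * cnj (\<rho> i g $$ (k', b))) = (if k = k' then 1 else 0)"
proof -
  define R where "R = mat (m i) (m i) (\<lambda>(k, b). \<rho> i g $$ (k, b))"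
  define A where "A = mat (m i) (m i) (\<lambda>(k, b). cnj (\<rho> i g $$ (b, k)))"
  have RA: "R \<in> carrier_mat (m i) (m i)" "A \<in> carrier_mat (m i) (m i)" by (auto simp: R_def A_def)
  have "A * R = 1\<^sub>m (m i)"
  proof (rule eq_matI)
    fix k k' assume "k < dim_row (1\<^sub>m (m i) :: complex mat)" "k' < dim_col (1\<^sub>m (m i) :: complex mat)"
    then have k: "k < m i" "k' < m i" by auto
    let ?\<sigma> = "shift_perm g" and ?c = "\<lambda>b. idx i b 0"
    have s0: "0 < s i" by (rule s_pos[OF i])
    have "(if k = k' then 1 else 0) = (\<Sum>j<p. cnj (T $$ (j, ?c k)) * T $$ (j, ?c k'))"
      using k s0 idx_less[OF i] idx_inject[of k i 0 k' i 0] by (simp add: columns_orthonormal)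
    also have "\<dots> = (\<Sum>j<p. (\<Sum>b<m i. cnj (T $$ (?\<sigma> j, ?c b)) * cnj (\<rho> i g $$ (b, k)))
        * (\<Sum>b<m i. T $$ (?\<sigma> j, ?c b) * \<rho> i g $$ (b, k')))"
    proof (rule sum.cong[OF refl])
      fix j assume "j \<in> {..<p}"
      then have j: "j < p" by simp
      show "cnj (T $$ (j, ?c k)) * T $$ (j, ?c k') = (\<Sum>b<m i. cnj (T $$ (?\<sigma> j, ?c b)) * cnj (\<rho> i g $$ (b, k)))
        * (\<Sum>b<m i. T $$ (?\<sigma> j, ?c b) * \<rho> i g $$ (b, k'))"
        unfolding T_row_transform[OF g j i k(1) s0] T_row_transform[OF g j i k(2) s0] by simp
    qed
    also have "\<dots> = (\<Sum>j<p. (\<Sum>b<m i. cnj (T $$ (j, ?c b)) * cnj (\<rho> i g $$ (b, k)))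
        * (\<Sum>b<m i. T $$ (j, ?c b) * \<rho> i g $$ (b, k')))"
      by (rule sum_shift[OF G_permutes[OF g]])
    also have "\<dots> = (\<Sum>b<m i. \<Sum>b'<m i. (cnj (\<rho> i g $$ (b, k)) * \<rho> i g $$ (b', k'))
        * (\<Sum>j<p. cnj (T $$ (j, ?c b)) * T $$ (j, ?c b')))"
      unfolding sum_product_sums by (simp add: sum_distrib_left mult_ac)
    also have "\<dots> = (\<Sum>b<m i. \<Sum>b'<m i. if b' = b then cnj (\<rho> i g $$ (b, k)) * \<rho> i g $$ (b', k') else 0)"
      using s0 idx_less[OF i] by (intro sum.cong refl) (auto simp: columns_orthonormal idx_inject)
    also have "\<dots> = (A * R) $$ (k, k')"
      using k RA by (subst mult_mat_index[of _ "m i" "m i" _ "m i"]) (auto simp: A_def R_def)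
    finally show "(A * R) $$ (k, k') = 1\<^sub>m (m i) $$ (k, k')" using k by simp
  qed (use RA in auto)
  then have "R * A = 1\<^sub>m (m i)" by (rule mat_mult_left_right_inverse[OF RA(2,1)])
  then have "(R * A) $$ (k, k') = (if k = k' then 1 else 0)" using assms by simp
  then show ?thesis
    using assms RA by (subst (asm) mult_mat_index[of _ "m i" "m i" _ "m i"]) (auto simp: A_def R_def)
qed

text \<open>
  The vector with coordinates \<open>u\<close> in the \<open>k\<close>-th copy of the \<open>i\<close>-th diagonal block of the invariant
  matrices.
\<close>

definition copy_vec :: "nat \<Rightarrow> nat \<Rightarrow> (nat \<Rightarrow> complex) \<Rightarrow> nat \<Rightarrow> complex" where
  "copy_vec i k u j = (\<Sum>a<s i. u a * T $$ (j, idx i k a))"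

lemma copy_vec_transform:
  assumes "g \<in> G" "j < p" "i < r" "k < m i"
  shows "copy_vec i k u j = (\<Sum>b<m i. copy_vec i b u (shift_perm g j) * \<rho> i g $$ (b, k))"
proof -
  have "copy_vec i k u j = (\<Sum>a<s i. \<Sum>b<m i. u a * (T $$ (shift_perm g j, idx i b a) * \<rho> i g $$ (b, k)))"
    unfolding copy_vec_def using assms by (simp add: T_row_transform[of g j] sum_distrib_left)
  then show ?thesis
    unfolding copy_vec_def by (subst (asm) sum.swap) (simp add: sum_distrib_right mult.assoc)
qed

text \<open>
  A group element mixes the vectors \<open>copy_vec i k u\<close>, \<open>k < m i\<close>, by the unitary matrix \<open>\<rho> i g\<close>, and
  \<open>\<Sum>k. x k (x k)\<^sup>*\<close> does not change under unitary mixing.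
\<close>

lemma copy_gram_invariant:
  assumes "g \<in> G" "j < p" "l < p" "i < r"
  shows "(\<Sum>k<m i. copy_vec i k u j * cnj (copy_vec i k u l))
    = (\<Sum>k<m i. copy_vec i k u (shift_perm g j) * cnj (copy_vec i k u (shift_perm g l)))"
proof -
  let ?x = "\<lambda>b. copy_vec i b u (shift_perm g j)" and ?y = "\<lambda>b. cnj (copy_vec i b u (shift_perm g l))"
  have "(\<Sum>k<m i. copy_vec i k u j * cnj (copy_vec i k u l))
      = (\<Sum>k<m i. (\<Sum>b<m i. ?x b * \<rho> i g $$ (b, k)) * (\<Sum>b<m i. ?y b * cnj (\<rho> i g $$ (b, k))))"
    using assms by (intro sum.cong refl) (simp add: copy_vec_transform[of g j] copy_vec_transform[of g l])
  also have "\<dots> = (\<Sum>b<m i. \<Sum>b'<m i. (?x b * ?y b') * (\<Sum>k<m i. \<rho> i g $$ (b, k) * cnj (\<rho> i g $$ (b', k))))"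
    unfolding sum_product_sums by (simp add: sum_distrib_left mult_ac)
  also have "\<dots> = (\<Sum>b<m i. \<Sum>b'<m i. if b' = b then ?x b * ?y b' else 0)"
    using assms by (intro sum.cong refl) (auto simp: \<rho>_unitary)
  finally show ?thesis by simp
qed

end

lemma Re_hermitian_form:
  "Re (\<Sum>j\<in>I. \<Sum>l\<in>I. cnj (x j) * complex_of_real (S j l) * x l)
    = bilin I S (\<lambda>j. Re (x j)) (\<lambda>j. Re (x j)) + bilin I S (\<lambda>j. Im (x j)) (\<lambda>j. Im (x j))"
  unfolding bilin_def sum.distrib[symmetric] Re_sum
  by (intro sum.cong refl) (simp add: algebra_simps)

context block_frame begin

abbreviation copies :: "nat \<Rightarrow> (nat \<times> bool) set" where
  "copies i \<equiv> {..<m i} \<times> UNIV"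

abbreviation coords :: "nat \<Rightarrow> (nat \<times> bool) set" where
  "coords i \<equiv> {..<s i} \<times> UNIV"

text \<open>
  Real and imaginary parts of the columns of \<open>T\<close>, arranged such that \<open>test_vec i (k, b) z\<close> is the real
  (\<open>b = False\<close>) or imaginary (\<open>b = True\<close>) part of the \<open>k\<close>-th copy vector of the complex vector that \<open>z\<close>
  encodes, and is linear in \<open>z\<close> over the reals.
\<close>

definition frame :: "nat \<Rightarrow> nat \<times> bool \<Rightarrow> nat \<times> bool \<Rightarrow> nat \<Rightarrow> real" where
  "frame i \<kappa> \<gamma> j = Re (cnj (bool_unit (snd \<kappa>)) * bool_unit (snd \<gamma>) * T $$ (j, idx i (fst \<kappa>) (fst \<gamma>)))"

definition test_vec :: "nat \<Rightarrow> nat \<times> bool \<Rightarrow> (nat \<times> bool \<Rightarrow> real) \<Rightarrow> nat \<Rightarrow> real" where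
  "test_vec i \<kappa> z j = (\<Sum>\<gamma>\<in>coords i. z \<gamma> * frame i \<kappa> \<gamma> j)"

lemma test_vec_eq: "test_vec i (k, b) z j = Re (cnj (bool_unit b) * copy_vec i k (complexify z) j)"
proof -
  have "cnj (bool_unit b) * copy_vec i k (complexify z) j
      = (\<Sum>a<s i. \<Sum>c\<in>UNIV. z (a, c) * (cnj (bool_unit b) * bool_unit c * T $$ (j, idx i k a)))"
    by (simp add: copy_vec_def complexify_def sum_distrib_left sum_distrib_right mult_ac)
  also have "Re \<dots> = (\<Sum>a<s i. \<Sum>c\<in>UNIV. z (a, c) * frame i (k, b) (a, c) j)"
    by (simp add: frame_def del: complex_cnj_mult)
  also have "\<dots> = test_vec i (k, b) z j"
    unfolding test_vec_def by (simp add: sum.cartesian_product' UNIV_bool)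
  finally show ?thesis ..
qed

lemma test_vec_False: "test_vec i (k, False) z j = Re (copy_vec i k (complexify z) j)"
  and test_vec_True: "test_vec i (k, True) z j = Im (copy_vec i k (complexify z) j)"
  by (simp_all add: test_vec_eq)

lemma test_vec_gram:
  "(\<Sum>\<kappa>\<in>copies i. test_vec i \<kappa> z j * test_vec i \<kappa> z l)
    = Re (\<Sum>k<m i. copy_vec i k (complexify z) j * cnj (copy_vec i k (complexify z) l))"
  by (simp add: sum_times_bool test_vec_False test_vec_True)

text \<open>
  The sum over real and imaginary parts is the real part of the complex Gram matrix, which is
  invariant by \<open>copy_gram_invariant\<close>.
\<close>

lemma test_gram_invariant:
  assumes "i < r"
  shows "mat p p (\<lambda>(j, l). \<Sum>\<kappa>\<in>copies i. test_vec i \<kappa> z j * test_vec i \<kappa> z l) \<in> invariant_mats p G"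
proof -
  let ?M = "mat p p (\<lambda>(j, l). \<Sum>\<kappa>\<in>copies i. test_vec i \<kappa> z j * test_vec i \<kappa> z l)"
  have "?M $$ (shift_perm g j, shift_perm g l) = ?M $$ (j, l)" if "g \<in> G" "j < p" "l < p" for g j l
  proof -
    have "shift_perm g j < p" "shift_perm g l < p" using that shift_less[OF G_permutes] by auto
    then show ?thesis
      using that by (simp add: test_vec_gram copy_gram_invariant[OF that assms] del: Re_sum)
  qed
  moreover have "?M \<in> carrier_mat p p" by simp
  ultimately show ?thesis using invariant_mats_iff[of G p ?M] G_permutes by blast
qed

text \<open>
  A real combination of the test vectors is the real part of a complex combination of columns of \<open>T\<close>
  with product coefficients, to which Pythagoras applies.
\<close>

lemma test_combination_contraction:
  assumes i: "i < r"
  shows "sq_norm {..<p} (\<lambda>j. \<Sum>\<kappa>\<in>copies i. c \<kappa> * test_vec i \<kappa> z j) \<le> sq_norm (copies i) c * sq_norm (coords i) z"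
proof -
  let ?u = "complexify z" and ?\<zeta> = "\<lambda>k. cnj (complexify c k)"
  define w where "w = (\<lambda>(k, a). ?\<zeta> k * ?u a)"
  let ?A = "{..<m i} \<times> {..<s i}"
  define x where "x j = (\<Sum>\<alpha>\<in>?A. w \<alpha> * T $$ (j, idx i (fst \<alpha>) (snd \<alpha>)))" for j
  have comb: "(\<Sum>\<kappa>\<in>copies i. c \<kappa> * test_vec i \<kappa> z j) = Re (x j)" for j
  proof -
    have "x j = (\<Sum>k<m i. ?\<zeta> k * copy_vec i k ?u j)"
      unfolding x_def w_def copy_vec_def by (simp add: sum.cartesian_product' sum_distrib_left mult.assoc)
    then show ?thesis
      by (simp add: sum_times_bool test_vec_False test_vec_True complexify_eq algebra_simps)
  qed
  have "complex_of_real (\<Sum>j<p. (cmod (x j))\<^sup>2) = (\<Sum>j<p. (\<Sum>\<alpha>\<in>?A. cnj (w \<alpha>) * cnj (T $$ (j, idx i (fst \<alpha>) (snd \<alpha>))))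
      * (\<Sum>\<alpha>\<in>?A. w \<alpha> * T $$ (j, idx i (fst \<alpha>) (snd \<alpha>))))"
    by (simp only: of_real_sum complex_norm_square x_def cnj_sum complex_cnj_mult mult.commute)
  also have "\<dots> = (\<Sum>\<alpha>\<in>?A. \<Sum>\<beta>\<in>?A. (cnj (w \<alpha>) * w \<beta>)
      * (\<Sum>j<p. cnj (T $$ (j, idx i (fst \<alpha>) (snd \<alpha>))) * T $$ (j, idx i (fst \<beta>) (snd \<beta>))))"
    unfolding sum_product_sums by (simp add: sum_distrib_left mult_ac)
  also have "\<dots> = (\<Sum>\<alpha>\<in>?A. \<Sum>\<beta>\<in>?A. if \<beta> = \<alpha> then cnj (w \<alpha>) * w \<beta> else 0)"
    using i idx_less by (intro sum.cong refl) (auto simp: columns_orthonormal idx_inject split: if_splits)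
  also have "\<dots> = (\<Sum>\<alpha>\<in>?A. w \<alpha> * cnj (w \<alpha>))" by (simp add: mult.commute)
  also have "\<dots> = complex_of_real (\<Sum>\<alpha>\<in>?A. (cmod (w \<alpha>))\<^sup>2)"
    by (simp only: of_real_sum complex_norm_square)
  finally have nx: "(\<Sum>j<p. (cmod (x j))\<^sup>2) = (\<Sum>\<alpha>\<in>?A. (cmod (w \<alpha>))\<^sup>2)" by (simp only: of_real_eq_iff)
  have "sq_norm {..<p} (\<lambda>j. Re (x j)) \<le> (\<Sum>j<p. (cmod (x j))\<^sup>2)"
    unfolding sq_norm_def by (intro sum_mono) (simp add: cmod_def)
  also have "\<dots> = sq_norm (copies i) c * sq_norm (coords i) z"
    unfolding nx sq_norm_complexify w_def
    by (simp add: sum.cartesian_product' sum_product norm_mult power_mult_distrib)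
  finally show ?thesis unfolding comb .
qed

text \<open>
  For an invariant matrix \<open>D\<close> with blocks \<open>B i\<close> the sum over the copies equals \<open>m i\<close> times the real part
  of \<open>u\<^sup>* (B i) u\<close>, since all copies carry the same block. In turn the form \<open>D\<close> at \<open>v\<close> is the sum of these
  real parts at the coordinate vectors \<open>u\<close> of \<open>v\<close> in the copies, and the squared norms of the coordinate
  vectors add up to the squared norm of \<open>v\<close>.
\<close>

lemma test_forms_bound_invariant_form:
  fixes b :: real and v :: "nat \<Rightarrow> real"
  assumes D: "D \<in> invariant_mats p G"
    and bd: "\<And>i z. i < r \<Longrightarrow> \<bar>\<Sum>\<kappa>\<in>copies i. bilin {..<p} (\<lambda>j l. D $$ (j, l)) (test_vec i \<kappa> z) (test_vec i \<kappa> z)\<bar>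
      \<le> b * m i * sq_norm (coords i) z"
  shows "\<bar>bilin {..<p} (\<lambda>j l. D $$ (j, l)) v v\<bar> \<le> b * sq_norm {..<p} v"
proof -
  let ?D = "\<lambda>j l. D $$ (j, l)"
  have Dc: "D \<in> carrier_mat p p" using D by (simp add: invariant_mats_def)
  define M where "M = map_mat complex_of_real D"
  have M: "M \<in> carrier_mat p p" using Dc by (simp add: M_def)
  have "\<exists>B. (\<forall>i<r. B i \<in> carrier_mat (s i) (s i)) \<and>
      mat_adjoint T * M * T = diag_block_mat (map (\<lambda>i. diag_block_mat (replicate (m i) (B i))) [0..<r])"
    unfolding M_def using dec unfolding block_decomposition_def by (elim conjE) (rule bspec[OF _ D])
  then obtain B where B0: "(\<forall>i<r. B i \<in> carrier_mat (s i) (s i)) \<and>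
      mat_adjoint T * M * T = diag_block_mat (map (\<lambda>i. diag_block_mat (replicate (m i) (B i))) [0..<r])"
    by (rule exE)
  then have Bc: "\<And>i. i < r \<Longrightarrow> B i \<in> carrier_mat (s i) (s i)" by simp
  from B0 have B: "mat_adjoint T * M * T = diag_block_mat (map (\<lambda>i. diag_block_mat (replicate (m i) (B i))) [0..<r])"
    by (rule conjunct2)
  \<comment> \<open>the entries of \<open>T\<^sup>* D T\<close>\<close>
  define C where "C q q' = (\<Sum>j<p. \<Sum>l<p. cnj (T $$ (j, q)) * D $$ (j, l) * T $$ (l, q'))" for q q'
  have C: "C (idx i k a) (idx i' k' a') = (if i = i' \<and> k = k' then B i $$ (a, a') else 0)"
    if "i < r" "k < m i" "a < s i" "i' < r" "k' < m i'" "a' < s i'" for i k a i' k' a'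
  proof -
    let ?q = "idx i k a" and ?q' = "idx i' k' a'"
    have q: "?q < p" "?q' < p" using that by (auto intro: idx_less)
    have AM: "mat_adjoint T * M \<in> carrier_mat p p" by (rule mult_carrier_mat[OF mat_adjoint_carrier[OF T_carrier] M])
    have "(mat_adjoint T * M * T) $$ (?q, ?q') = (\<Sum>l<p. (mat_adjoint T * M) $$ (?q, l) * T $$ (l, ?q'))"
      by (rule mult_mat_index[OF AM T_carrier q])
    also have "\<dots> = (\<Sum>l<p. (\<Sum>j<p. cnj (T $$ (j, ?q)) * D $$ (j, l)) * T $$ (l, ?q'))"
    proof (intro sum.cong refl arg_cong2[where f = "(*)"])
      fix l assume "l \<in> {..<p}"
      then show "(mat_adjoint T * M) $$ (?q, l) = (\<Sum>j<p. cnj (T $$ (j, ?q)) * D $$ (j, l))"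
        using q Dc by (subst mult_mat_index[OF mat_adjoint_carrier[OF T_carrier] M])
          (auto simp: M_def mat_adjoint_index[OF T_carrier])
    qed
    also have "\<dots> = C ?q ?q'" unfolding C_def sum_distrib_right by (rule sum.swap)
    finally have "C ?q ?q' = diag_block_mat (map (\<lambda>i. diag_block_mat (replicate (m i) (B i))) [0..<r]) $$ (?q, ?q')"
      unfolding B ..
    also have "\<dots> = (if i = i' then diag_block_mat (replicate (m i) (B i)) $$ (k * s i + a, k' * s i' + a') else 0)"
      unfolding idx_def using that
      by (intro diag_block_mat_map_index[where d = "\<lambda>l. m l * s l"])
        (auto intro: mult_add_less replicate_block_carrier Bc)
    finally show ?thesis using that replicate_block_index[OF Bc] by auto
  qed
  \<comment> \<open>the sesquilinear form of the repeated block \<open>B i\<close>\<close>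
  define h where "h i u = (\<Sum>a<s i. \<Sum>a'<s i. cnj (u a) * B i $$ (a, a') * u a')" for i and u :: "nat \<Rightarrow> complex"
  have herm: "(\<Sum>j<p. \<Sum>l<p. cnj (\<Sum>x\<in>X. w x * T $$ (j, \<iota> x)) * D $$ (j, l) * (\<Sum>x\<in>X. w x * T $$ (l, \<iota> x)))
      = (\<Sum>x\<in>X. \<Sum>x'\<in>X. cnj (w x) * C (\<iota> x) (\<iota> x') * w x')" for X :: "nat set" and w \<iota>
  proof -
    have "(\<Sum>j<p. \<Sum>l<p. cnj (\<Sum>x\<in>X. w x * T $$ (j, \<iota> x)) * D $$ (j, l) * (\<Sum>x\<in>X. w x * T $$ (l, \<iota> x)))
        = (\<Sum>y\<in>{..<p} \<times> {..<p}. (\<Sum>x\<in>X. cnj (w x) * cnj (T $$ (fst y, \<iota> x)) * D $$ y)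
            * (\<Sum>x\<in>X. w x * T $$ (snd y, \<iota> x)))"
      by (simp add: sum.cartesian_product' sum_distrib_right)
    also have "\<dots> = (\<Sum>x\<in>X. \<Sum>x'\<in>X. cnj (w x) * C (\<iota> x) (\<iota> x') * w x')"
      unfolding sum_product_sums C_def
      by (simp add: sum.cartesian_product' sum_distrib_left sum_distrib_right mult_ac)
    finally show ?thesis .
  qed
  have test: "(\<Sum>\<kappa>\<in>copies i. bilin {..<p} ?D (test_vec i \<kappa> z) (test_vec i \<kappa> z)) = m i * Re (h i (complexify z))"
    if i: "i < r" for i z
  proof -
    let ?x = "\<lambda>k. copy_vec i k (complexify z)"
    have "(\<Sum>\<kappa>\<in>copies i. bilin {..<p} ?D (test_vec i \<kappa> z) (test_vec i \<kappa> z))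
        = (\<Sum>k<m i. Re (\<Sum>j<p. \<Sum>l<p. cnj (?x k j) * D $$ (j, l) * ?x k l))"
      unfolding sum_times_bool Re_hermitian_form test_vec_False[abs_def] test_vec_True[abs_def] ..
    also have "\<dots> = (\<Sum>k<m i. Re (h i (complexify z)))"
    proof (rule sum.cong[OF refl])
      fix k assume "k \<in> {..<m i}"
      then have "(\<Sum>j<p. \<Sum>l<p. cnj (?x k j) * D $$ (j, l) * ?x k l) = h i (complexify z)"
        unfolding copy_vec_def herm h_def using i by (intro sum.cong refl) (simp add: C)
      then show "Re (\<Sum>j<p. \<Sum>l<p. cnj (?x k j) * D $$ (j, l) * ?x k l) = Re (h i (complexify z))" by simp
    qed
    finally show ?thesis by simp
  qed
  have hb: "\<bar>Re (h i u)\<bar> \<le> b * (\<Sum>a<s i. (cmod (u a))\<^sup>2)" if i: "i < r" for i u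
  proof -
    define z where "z = (\<lambda>(a, c). if c then Im (u a) else Re (u a))"
    have z: "complexify z = u" by (simp add: fun_eq_iff complexify_eq z_def)
    have "m i * \<bar>Re (h i u)\<bar> \<le> m i * (b * (\<Sum>a<s i. (cmod (u a))\<^sup>2))"
      using bd[OF i, of z] unfolding test[OF i] sq_norm_complexify z by (simp add: abs_mult mult_ac)
    then show ?thesis using m_pos[OF i] by simp
  qed
  \<comment> \<open>the coordinates of \<open>v\<close> with respect to the columns of \<open>T\<close>\<close>
  define w where "w q = (\<Sum>j<p. cnj (T $$ (j, q)) * v j)" for q
  have v: "complex_of_real (v j) = (\<Sum>q<p. w q * T $$ (j, q))" if "j < p" for j
  proof -
    have "(\<Sum>q<p. w q * T $$ (j, q)) = (\<Sum>q<p. \<Sum>l<p. v l * (T $$ (j, q) * cnj (T $$ (l, q))))"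
      by (simp add: w_def sum_distrib_left sum_distrib_right mult_ac)
    also have "\<dots> = (\<Sum>l<p. v l * (\<Sum>q<p. T $$ (j, q) * cnj (T $$ (l, q))))"
      by (subst sum.swap) (simp add: sum_distrib_left)
    also have "\<dots> = (\<Sum>l<p. if l = j then complex_of_real (v l) else 0)"
      using that by (intro sum.cong refl) (auto simp: rows_orthonormal)
    finally show ?thesis using that by simp
  qed
  have nv: "sq_norm {..<p} v = (\<Sum>q<p. (cmod (w q))\<^sup>2)"
  proof -
    have "complex_of_real (\<Sum>q<p. (cmod (w q))\<^sup>2) = (\<Sum>q<p. w q * cnj (w q))"
      by (simp only: of_real_sum complex_norm_square)
    also have "\<dots> = (\<Sum>q<p. \<Sum>j<p. w q * (T $$ (j, q) * v j))"
      by (simp add: w_def sum_distrib_left)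
    also have "\<dots> = (\<Sum>j<p. (\<Sum>q<p. w q * T $$ (j, q)) * v j)"
      by (subst sum.swap) (simp add: sum_distrib_left mult_ac)
    also have "\<dots> = (\<Sum>j<p. complex_of_real (v j) * v j)"
      by (intro sum.cong refl) (simp add: v)
    also have "\<dots> = complex_of_real (sq_norm {..<p} v)"
      by (simp add: sq_norm_def power2_eq_square)
    finally show ?thesis by (simp only: of_real_eq_iff)
  qed
  have "complex_of_real (bilin {..<p} ?D v v)
      = (\<Sum>j<p. \<Sum>l<p. cnj (complex_of_real (v j)) * D $$ (j, l) * complex_of_real (v l))"
    by (simp add: bilin_def mult_ac)
  also have "\<dots> = (\<Sum>j<p. \<Sum>l<p. cnj (\<Sum>q<p. w q * T $$ (j, q)) * D $$ (j, l) * (\<Sum>q<p. w q * T $$ (l, q)))"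
    by (intro sum.cong refl) (simp add: v)
  also have "\<dots> = (\<Sum>q<p. \<Sum>q'<p. cnj (w q) * C q q' * w q')"
    by (rule herm)
  also have "\<dots> = (\<Sum>i<r. \<Sum>k<m i. h i (\<lambda>a. w (idx i k a)))"
  proof -
    have "(\<Sum>q'<p. cnj (w (idx i k a)) * C (idx i k a) q' * w q')
        = (\<Sum>a'<s i. cnj (w (idx i k a)) * B i $$ (a, a') * w (idx i k a'))"
      if "i < r" "k < m i" "a < s i" for i k a
    proof -
      have "(\<Sum>q'<p. cnj (w (idx i k a)) * C (idx i k a) q' * w q')
          = (\<Sum>i'<r. \<Sum>k'<m i'. \<Sum>a'<s i'. if i' = i then if k' = k then
              cnj (w (idx i k a)) * B i $$ (a, a') * w (idx i k a') else 0 else 0)"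
        unfolding sum_idx[of "\<lambda>q'. cnj (w (idx i k a)) * C (idx i k a) q' * w q'"]
        using that by (intro sum.cong refl) (auto simp: C)
      also have "\<dots> = (\<Sum>i'<r. if i' = i then \<Sum>a'<s i. cnj (w (idx i k a)) * B i $$ (a, a') * w (idx i k a') else 0)"
      proof (rule sum.cong[OF refl])
        fix i'
        have inner: "(\<Sum>a'<s i. if k' = k then f a' else 0) = (if k' = k then \<Sum>a'<s i. f a' else 0)"
          for k' and f :: "nat \<Rightarrow> complex" by simp
        show "(\<Sum>k'<m i'. \<Sum>a'<s i'. if i' = i then if k' = k then
              cnj (w (idx i k a)) * B i $$ (a, a') * w (idx i k a') else 0 else 0)
            = (if i' = i then \<Sum>a'<s i. cnj (w (idx i k a)) * B i $$ (a, a') * w (idx i k a') else 0)"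
          using that by (cases "i' = i") (simp_all add: inner)
      qed
      finally show ?thesis using that by simp
    qed
    then show ?thesis
      unfolding sum_idx[of "\<lambda>q. \<Sum>q'<p. cnj (w q) * C q q' * w q'"] h_def
      by - (rule sum.cong[OF refl], rule sum.cong[OF refl], rule sum.cong[OF refl], simp)
  qed
  finally have "bilin {..<p} ?D v v = (\<Sum>i<r. \<Sum>k<m i. Re (h i (\<lambda>a. w (idx i k a))))"
    by (metis (no_types, lifting) Re_complex_of_real Re_sum sum.cong)
  then have "\<bar>bilin {..<p} ?D v v\<bar> \<le> (\<Sum>i<r. \<Sum>k<m i. \<bar>Re (h i (\<lambda>a. w (idx i k a)))\<bar>)"
    by (auto intro!: order_trans[OF sum_abs] sum_mono)
  also have "\<dots> \<le> (\<Sum>i<r. \<Sum>k<m i. b * (\<Sum>a<s i. (cmod (w (idx i k a)))\<^sup>2))"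
    by (intro sum_mono hb) auto
  also have "\<dots> = b * sq_norm {..<p} v"
    unfolding nv sum_idx[of "\<lambda>q. (cmod (w q))\<^sup>2"] by (simp add: sum_distrib_left)
  finally show ?thesis .
qed

end

section \<open>The orthogonal projection onto the invariant matrices\<close>

lemma frob_inner_eq:
  assumes "A \<in> carrier_mat p p"
  shows "frob_inner A B = (\<Sum>i<p. \<Sum>j<p. A $$ (i, j) * B $$ (i, j))"
  using assms by (simp add: frob_inner_def)

text \<open>
  Averaging over the group is the orthogonal projection; the explicit formula also shows that the
  projection preserves symmetry and depends measurably on the matrix.
\<close>

definition group_average :: "nat \<Rightarrow> (nat \<Rightarrow> nat) set \<Rightarrow> real mat \<Rightarrow> real mat" where
  "group_average p G M = mat p p (\<lambda>(i, j). (\<Sum>g\<in>G. M $$ (shift_perm g i, shift_perm g j)) / real (card G))"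

lemma group_average_carrier [simp]: "group_average p G M \<in> carrier_mat p p"
  by (simp add: group_average_def)

lemma group_average_index:
  "i < p \<Longrightarrow> j < p \<Longrightarrow>
    group_average p G M $$ (i, j) = (\<Sum>g\<in>G. M $$ (shift_perm g i, shift_perm g j)) / real (card G)"
  by (simp add: group_average_def)

lemma group_average_invariant:
  assumes G: "subgroup G (sym_group p)"
  shows "group_average p G M \<in> invariant_mats p G"
proof -
  note perm = perm_group_permutes[OF G]
  have "group_average p G M $$ (shift_perm h i, shift_perm h j) = group_average p G M $$ (i, j)"
    if h: "h \<in> G" and ij: "i < p" "j < p" for h i j
  proof -
    have comp: "shift_perm (g \<circ> h) k = shift_perm g (shift_perm h k)" if "k < p" for g k
      using Suc_shift[OF perm[OF h] that] by (simp add: shift_perm_def)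
    have bij: "bij_betw (\<lambda>g. g \<circ> h) G G"
    proof -
      have "inj_on (\<lambda>g. g \<circ> h) G"
        using permutes_surj[OF perm[OF h]] by (intro inj_onI) (metis fun.map_cong o_inv_o_cancel surj_iff comp_assoc comp_id)
      moreover have "(\<lambda>g. g \<circ> h) ` G \<subseteq> G"
        using subgroup.m_closed[OF G _ h] by (auto simp: sym_group_mult)
      moreover note perm_group_finite[OF G]
      ultimately show ?thesis by (simp add: bij_betw_def endo_inj_surj)
    qed
    have "(\<Sum>g\<in>G. M $$ (shift_perm g (shift_perm h i), shift_perm g (shift_perm h j)))
        = (\<Sum>g\<in>G. M $$ (shift_perm g i, shift_perm g j))"
      using sum.reindex_bij_betw[OF bij, of "\<lambda>g. M $$ (shift_perm g i, shift_perm g j)"] ij by (simp add: comp)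
    then show ?thesis using ij shift_less[OF perm[OF h]] by (simp add: group_average_index)
  qed
  then show ?thesis using invariant_mats_iff[of G p "group_average p G M"] perm by simp
qed

text \<open>
  Conjugation by a permutation matrix is an isometry and fixes \<open>W\<close>, so every conjugate of \<open>M\<close> has the
  same inner product with \<open>W\<close> as \<open>M\<close> itself.
\<close>

lemma group_average_orthogonal:
  assumes G: "subgroup G (sym_group p)" and M: "M \<in> carrier_mat p p" and W: "W \<in> invariant_mats p G"
  shows "frob_inner (group_average p G M) W = frob_inner M W"
proof -
  note perm = perm_group_permutes[OF G]
  have inv: "W $$ (shift_perm g i, shift_perm g j) = W $$ (i, j)" if "g \<in> G" "i < p" "j < p" for g i j
    using W perm that invariant_mats_iff[of G p W] by blast
  have "finite G" "G \<noteq> {}"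
    using perm_group_finite[OF G] subgroup.one_closed[OF G] by auto
  then have c: "real (card G) > 0" by (simp add: card_gt_0_iff)
  have one: "(\<Sum>i<p. \<Sum>j<p. M $$ (shift_perm g i, shift_perm g j) * W $$ (i, j)) = frob_inner M W"
    if g: "g \<in> G" for g
  proof -
    have "(\<Sum>i<p. \<Sum>j<p. M $$ (shift_perm g i, shift_perm g j) * W $$ (i, j))
        = (\<Sum>i<p. \<Sum>j<p. M $$ (shift_perm g i, shift_perm g j) * W $$ (shift_perm g i, shift_perm g j))"
      by (intro sum.cong refl) (simp add: inv[OF g])
    also have "\<dots> = (\<Sum>i<p. \<Sum>j<p. M $$ (shift_perm g i, j) * W $$ (shift_perm g i, j))"
      by (intro sum.cong refl sum_shift[OF perm[OF g], where f = "\<lambda>j. M $$ (_, j) * W $$ (_, j)"])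
    also have "\<dots> = frob_inner M W"
      unfolding frob_inner_eq[OF M]
      by (rule sum_shift[OF perm[OF g], where f = "\<lambda>i. \<Sum>j<p. M $$ (i, j) * W $$ (i, j)"])
    finally show ?thesis .
  qed
  have "frob_inner (group_average p G M) W
      = (\<Sum>i<p. \<Sum>j<p. \<Sum>g\<in>G. M $$ (shift_perm g i, shift_perm g j) * W $$ (i, j) / card G)"
    unfolding frob_inner_eq[OF group_average_carrier]
    by (intro sum.cong refl) (simp add: group_average_index sum_divide_distrib sum_distrib_right)
  also have "\<dots> = (\<Sum>i<p. \<Sum>g\<in>G. \<Sum>j<p. M $$ (shift_perm g i, shift_perm g j) * W $$ (i, j) / card G)"
    by (intro sum.cong refl sum.swap)
  also have "\<dots> = (\<Sum>g\<in>G. \<Sum>i<p. \<Sum>j<p. M $$ (shift_perm g i, shift_perm g j) * W $$ (i, j) / card G)"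
    by (rule sum.swap)
  also have "\<dots> = (\<Sum>g\<in>G. frob_inner M W / card G)"
    by (intro sum.cong refl) (simp add: one[symmetric] sum_divide_distrib)
  also have "\<dots> = frob_inner M W" using c by simp
  finally show ?thesis .
qed

lemma frob_inner_diff_left:
  assumes "A \<in> carrier_mat p p" "B \<in> carrier_mat p p"
  shows "frob_inner (A - B) W = frob_inner A W - frob_inner B W"
  using assms by (simp add: frob_inner_def left_diff_distrib sum_subtractf)

lemma invariant_mats_diff:
  assumes G: "subgroup G (sym_group p)" and "A \<in> invariant_mats p G" "B \<in> invariant_mats p G"
  shows "A - B \<in> invariant_mats p G"
proof -
  note perm = perm_group_permutes[OF G]
  have iff: "M \<in> invariant_mats p G \<longleftrightarrow> M \<in> carrier_mat p p \<and>
    (\<forall>g\<in>G. \<forall>i<p. \<forall>j<p. M $$ (shift_perm g i, shift_perm g j) = M $$ (i, j))" for M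
    by (rule invariant_mats_iff) (rule perm)
  show ?thesis
    using assms(2,3) shift_less[OF perm] unfolding iff by auto
qed

text \<open>
  Uniqueness: the difference of two candidates is invariant and orthogonal to all invariant matrices,
  in particular to itself.
\<close>

lemma invariant_proj_eq_group_average:
  assumes G: "subgroup G (sym_group p)" and M: "M \<in> carrier_mat p p"
  shows "invariant_proj p G M = group_average p G M"
  unfolding invariant_proj_def
proof (rule the_equality)
  have car: "W \<in> carrier_mat p p" if "W \<in> invariant_mats p G" for W
    using that by (simp add: invariant_mats_def)
  show "group_average p G M \<in> invariant_mats p G \<and>
      (\<forall>W\<in>invariant_mats p G. frob_inner (M - group_average p G M) W = 0)"
    using group_average_invariant[OF G] group_average_orthogonal[OF G M]
    by (simp add: frob_inner_diff_left[OF M group_average_carrier])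
  fix Q assume Q: "Q \<in> invariant_mats p G \<and> (\<forall>W\<in>invariant_mats p G. frob_inner (M - Q) W = 0)"
  define D where "D = Q - group_average p G M"
  have D: "D \<in> invariant_mats p G"
    unfolding D_def using Q group_average_invariant[OF G] by (intro invariant_mats_diff[OF G]) auto
  have "frob_inner D D = 0"
  proof -
    have "frob_inner (M - Q) D = 0" using Q D by blast
    then show ?thesis
      using group_average_orthogonal[OF G M D] frob_inner_diff_left[OF M, of Q D] car[of Q] Q
        frob_inner_diff_left[of Q p "group_average p G M" D] by (simp add: D_def)
  qed
  then have "(\<Sum>i<p. \<Sum>j<p. (D $$ (i, j))\<^sup>2) = 0"
    using frob_inner_eq[OF car[OF D]] by (simp add: power2_eq_square)
  then have z: "D $$ (i, j) = 0" if "i < p" "j < p" for i j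
    using that by (simp add: sum_nonneg_eq_0_iff sum_nonneg)
  show "Q = group_average p G M"
  proof (rule eq_matI)
    fix i j assume "i < dim_row (group_average p G M)" "j < dim_col (group_average p G M)"
    then have ij: "i < p" "j < p" by (simp_all add: group_average_def)
    have "dim_row (group_average p G M) = p" "dim_col (group_average p G M) = p" by (simp_all add: group_average_def)
    then show "Q $$ (i, j) = group_average p G M $$ (i, j)" using z[OF ij] ij unfolding D_def by simp
  qed (use Q car in \<open>auto simp: group_average_def\<close>)
qed

section \<open>Spectral norm and Frobenius norm\<close>

definition mat_image :: "nat \<Rightarrow> real mat \<Rightarrow> (nat \<Rightarrow> real) \<Rightarrow> nat \<Rightarrow> real" where
  "mat_image p A x = (\<lambda>i. \<Sum>j<p. A $$ (i, j) * x j)"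

lemma euclid_norm_eq: "v \<in> carrier_vec p \<Longrightarrow> euclid_norm v = sqrt (sq_norm {..<p} (vec_index v))"
  by (auto simp: euclid_norm_def scalar_prod_def sq_norm_def power2_eq_square atLeast0LessThan)

lemma euclid_norm_mult_mat_vec:
  assumes "A \<in> carrier_mat p p" "v \<in> carrier_vec p"
  shows "euclid_norm (A *\<^sub>v v) = sqrt (sq_norm {..<p} (mat_image p A (vec_index v)))"
proof -
  have "A *\<^sub>v v \<in> carrier_vec p" using assms by simp
  moreover have "vec_index (A *\<^sub>v v) i = mat_image p A (vec_index v) i" if "i < p" for i
    using assms that by (auto simp: mat_image_def scalar_prod_def atLeast0LessThan)
  ultimately show ?thesis by (simp add: euclid_norm_eq sq_norm_def)
qed

lemma spectral_norm_bdd: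
  assumes A: "A \<in> carrier_mat p p"
  shows "bdd_above ((\<lambda>v. euclid_norm (A *\<^sub>v v)) ` {v \<in> carrier_vec (dim_col A). euclid_norm v \<le> 1})"
proof (rule bdd_aboveI2)
  fix v assume "v \<in> {v \<in> carrier_vec (dim_col A). euclid_norm v \<le> 1}"
  then have v: "v \<in> carrier_vec p" "euclid_norm v \<le> 1" using A by auto
  then have n: "(\<Sum>j<p. (vec_index v j)\<^sup>2) \<le> 1" by (simp add: euclid_norm_eq sq_norm_def)
  have e: "\<bar>vec_index v j\<bar> \<le> 1" if "j < p" for j
  proof -
    have "(vec_index v j)\<^sup>2 \<le> (\<Sum>j<p. (vec_index v j)\<^sup>2)"
      using that by (intro member_le_sum) auto
    then show ?thesis using n by (simp add: abs_square_le_1[symmetric])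
  qed
  have "\<bar>mat_image p A (vec_index v) i\<bar> \<le> (\<Sum>j<p. \<bar>A $$ (i, j)\<bar>)" for i
    unfolding mat_image_def
    by (rule order_trans[OF sum_abs sum_mono]) (use e in \<open>auto simp: abs_mult intro: mult_left_le\<close>)
  then have "(mat_image p A (vec_index v) i)\<^sup>2 \<le> (\<Sum>j<p. \<bar>A $$ (i, j)\<bar>)\<^sup>2" for i
    by (metis abs_ge_zero power2_abs power_mono)
  then show "euclid_norm (A *\<^sub>v v) \<le> sqrt (\<Sum>i<p. (\<Sum>j<p. \<bar>A $$ (i, j)\<bar>)\<^sup>2)"
    unfolding euclid_norm_mult_mat_vec[OF A v(1)] sq_norm_def by (intro real_sqrt_le_mono sum_mono)
qed

lemma spectral_norm_le_iff:
  assumes A: "A \<in> carrier_mat p p" and \<delta>: "\<delta> \<ge> 0"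
  shows "spectral_norm A \<le> \<delta> \<longleftrightarrow> (\<forall>x. sq_norm {..<p} (mat_image p A x) \<le> \<delta>\<^sup>2 * sq_norm {..<p} x)"
proof
  assume sn: "spectral_norm A \<le> \<delta>"
  have unit: "sq_norm {..<p} (mat_image p A x) \<le> \<delta>\<^sup>2" if x: "sq_norm {..<p} x \<le> 1" for x
  proof -
    define v where "v = Matrix.vec p x"
    have v: "v \<in> carrier_vec p" by (simp add: v_def)
    have "sq_norm {..<p} (vec_index v) = sq_norm {..<p} x" by (simp add: sq_norm_def v_def)
    then have n: "euclid_norm v \<le> 1" using x by (simp add: euclid_norm_eq[OF v])
    have "mat_image p A (vec_index v) = mat_image p A x" by (simp add: mat_image_def v_def)
    moreover have "euclid_norm (A *\<^sub>v v) \<le> \<delta>"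
      using n v A by (intro order_trans[OF _ sn]) (auto simp: spectral_norm_def intro!: cSUP_upper spectral_norm_bdd[OF A])
    ultimately have "sqrt (sq_norm {..<p} (mat_image p A x)) \<le> \<delta>"
      by (simp add: euclid_norm_mult_mat_vec[OF A v])
    then show ?thesis by (rule sqrt_le_D)
  qed
  show "\<forall>x. sq_norm {..<p} (mat_image p A x) \<le> \<delta>\<^sup>2 * sq_norm {..<p} x"
  proof
    fix x :: "nat \<Rightarrow> real"
    show "sq_norm {..<p} (mat_image p A x) \<le> \<delta>\<^sup>2 * sq_norm {..<p} x"
    proof (cases "sq_norm {..<p} x = 0")
      case True
      then have "x j = 0" if "j < p" for j using that by (auto simp: sq_norm_def sum_nonneg_eq_0_iff)
      then show ?thesis using True by (simp add: mat_image_def sq_norm_def)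
    next
      case False
      define N where "N = sqrt (sq_norm {..<p} x)"
      have N: "N > 0" "N\<^sup>2 = sq_norm {..<p} x" using False by (auto simp: N_def less_le)
      have "mat_image p A (\<lambda>i. (1 / N) * x i) = (\<lambda>i. (1 / N) * mat_image p A x i)"
        by (simp add: mat_image_def sum_divide_distrib)
      moreover have "sq_norm {..<p} (\<lambda>i. (1 / N) * x i) \<le> 1"
        unfolding sq_norm_scale using N False by (simp add: power_divide)
      ultimately have "(1 / N)\<^sup>2 * sq_norm {..<p} (mat_image p A x) \<le> \<delta>\<^sup>2"
        using unit[of "\<lambda>i. (1 / N) * x i"] by (simp only: sq_norm_scale)
      then show ?thesis using N False by (simp add: power_divide pos_divide_le_eq less_le)
    qed
  qed
next
  assume b: "\<forall>x. sq_norm {..<p} (mat_image p A x) \<le> \<delta>\<^sup>2 * sq_norm {..<p} x"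
  show "spectral_norm A \<le> \<delta>"
    unfolding spectral_norm_def
  proof (rule cSUP_least)
    have "euclid_norm (0\<^sub>v (dim_col A)) \<le> 1" by (simp add: euclid_norm_def)
    then show "{v \<in> carrier_vec (dim_col A). euclid_norm v \<le> 1} \<noteq> {}" by (auto intro!: exI[of _ "0\<^sub>v (dim_col A)"])
    fix v assume "v \<in> {v \<in> carrier_vec (dim_col A). euclid_norm v \<le> 1}"
    then have v: "v \<in> carrier_vec p" "euclid_norm v \<le> 1" using A by auto
    then have "sq_norm {..<p} (vec_index v) \<le> 1" by (simp add: euclid_norm_eq)
    then have "\<delta>\<^sup>2 * sq_norm {..<p} (vec_index v) \<le> \<delta>\<^sup>2 * 1" by (intro mult_left_mono) auto
    then have "sq_norm {..<p} (mat_image p A (vec_index v)) \<le> \<delta>\<^sup>2"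
      using b[rule_format, of "vec_index v"] by linarith
    then show "euclid_norm (A *\<^sub>v v) \<le> \<delta>"
      unfolding euclid_norm_mult_mat_vec[OF A v(1)] using \<delta> by (intro real_le_lsqrt) auto
  qed
qed

text \<open>
  By homogeneity integer vectors do the work of rational ones, and \<open>\<lfloor>N x\<rfloor> / N\<close> tends to \<open>x\<close>. The
  countable condition is the reason why spectral norm events are measurable.
\<close>

lemma spectral_norm_le_iff_int:
  assumes A: "A \<in> carrier_mat p p" and \<delta>: "\<delta> \<ge> 0"
  shows "spectral_norm A \<le> \<delta> \<longleftrightarrow> (\<forall>z\<in>{..<p} \<rightarrow>\<^sub>E (UNIV :: int set).
    sq_norm {..<p} (mat_image p A (\<lambda>j. real_of_int (z j))) \<le> \<delta>\<^sup>2 * sq_norm {..<p} (\<lambda>j. real_of_int (z j)))"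
    (is "_ \<longleftrightarrow> ?Z")
proof
  assume "spectral_norm A \<le> \<delta>"
  then show ?Z using spectral_norm_le_iff[OF A \<delta>] by simp
next
  assume Z: ?Z
  show "spectral_norm A \<le> \<delta>"
    unfolding spectral_norm_le_iff[OF A \<delta>]
  proof
    fix x :: "nat \<Rightarrow> real"
    define u where "u n j = (1 / real (Suc n)) * real_of_int \<lfloor>real (Suc n) * x j\<rfloor>" for n :: nat and j :: nat
    have lim: "(\<lambda>n. u n j) \<longlonglongrightarrow> x j" for j
    proof (rule LIMSEQ_I)
      fix e :: real assume e: "0 < e"
      obtain N where N: "inverse (real (Suc N)) < e" using reals_Archimedean[OF e] by blast
      show "\<exists>no. \<forall>n\<ge>no. norm (u n j - x j) < e"
      proof (intro exI allI impI)
        fix n assume "n \<ge> N"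
        have "\<bar>real_of_int \<lfloor>real (Suc n) * x j\<rfloor> - real (Suc n) * x j\<bar> \<le> 1" by linarith
        moreover have "u n j - x j = (real_of_int \<lfloor>real (Suc n) * x j\<rfloor> - real (Suc n) * x j) / real (Suc n)"
          by (simp add: u_def field_simps del: of_nat_Suc)
        ultimately have "norm (u n j - x j) \<le> 1 / real (Suc n)"
          by (simp add: abs_divide divide_right_mono del: of_nat_Suc)
        also have "\<dots> \<le> 1 / real (Suc N)" using \<open>n \<ge> N\<close> by (simp add: frac_le)
        finally show "norm (u n j - x j) < e" using N by (simp add: inverse_eq_divide)
      qed
    qed
    have le: "sq_norm {..<p} (mat_image p A (u n)) \<le> \<delta>\<^sup>2 * sq_norm {..<p} (u n)" for n
    proof -
      let ?z = "\<lambda>j\<in>{..<p}. \<lfloor>real (Suc n) * x j\<rfloor>" and ?c = "1 / real (Suc n)"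
      have z: "?z \<in> {..<p} \<rightarrow>\<^sub>E UNIV" by (simp only: restrict_PiE_iff) simp
      have u: "u n j = ?c * real_of_int (?z j)" if "j < p" for j using that by (simp add: u_def)
      have "sq_norm {..<p} (mat_image p A (u n)) = sq_norm {..<p} (\<lambda>i. ?c * mat_image p A (\<lambda>j. real_of_int (?z j)) i)"
        unfolding mat_image_def sum_distrib_left sq_norm_def by (intro sum.cong refl arg_cong[where f = "\<lambda>t. t\<^sup>2"]) (simp add: u)
      also have "\<dots> \<le> ?c\<^sup>2 * (\<delta>\<^sup>2 * sq_norm {..<p} (\<lambda>j. real_of_int (?z j)))"
        unfolding sq_norm_scale by (intro mult_left_mono bspec[OF Z] z zero_le_power2)
      also have "\<dots> = \<delta>\<^sup>2 * sq_norm {..<p} (\<lambda>j. ?c * real_of_int (?z j))"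
        unfolding sq_norm_scale by simp
      also have "sq_norm {..<p} (\<lambda>j. ?c * real_of_int (?z j)) = sq_norm {..<p} (u n)"
        unfolding sq_norm_def by (intro sum.cong refl) (simp add: u)
      finally show ?thesis .
    qed
    have "(\<lambda>n. sq_norm {..<p} (mat_image p A (u n))) \<longlonglongrightarrow> sq_norm {..<p} (mat_image p A x)"
      unfolding sq_norm_def mat_image_def by (intro tendsto_intros lim)
    moreover have "(\<lambda>n. \<delta>\<^sup>2 * sq_norm {..<p} (u n)) \<longlonglongrightarrow> \<delta>\<^sup>2 * sq_norm {..<p} x"
      unfolding sq_norm_def by (intro tendsto_intros lim)
    ultimately show "sq_norm {..<p} (mat_image p A x) \<le> \<delta>\<^sup>2 * sq_norm {..<p} x"
      using le by (intro LIMSEQ_le) auto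
  qed
qed

lemma sets_spectral_norm_le:
  assumes A: "\<And>X. X \<in> space P \<Longrightarrow> A X \<in> carrier_mat p p" and \<delta>: "\<delta> \<ge> 0"
    and [measurable]: "\<And>i j. i < p \<Longrightarrow> j < p \<Longrightarrow> (\<lambda>X. A X $$ (i, j)) \<in> borel_measurable P"
  shows "{X \<in> space P. spectral_norm (A X) \<le> \<delta>} \<in> sets P"
proof -
  let ?Z = "{..<p} \<rightarrow>\<^sub>E (UNIV :: int set)"
  have [simp]: "countable ?Z" by (intro countable_PiE) auto
  have "{X \<in> space P. spectral_norm (A X) \<le> \<delta>} = {X \<in> space P. \<forall>z\<in>?Z.
      (\<Sum>i<p. (\<Sum>j<p. A X $$ (i, j) * real_of_int (z j))\<^sup>2) \<le> \<delta>\<^sup>2 * (\<Sum>i<p. (real_of_int (z i))\<^sup>2)}"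
    using spectral_norm_le_iff_int[OF A \<delta>] by (auto simp: sq_norm_def mat_image_def)
  also have "\<dots> \<in> sets P"
    by (intro predE pred_intros_countable_bounded) (simp, measurable)
  finally show ?thesis .
qed

text \<open>
  The squared Frobenius norm is the sum of the squared norms of the images of the \<open>p\<close> unit vectors.
\<close>

lemma frob_norm_le_of_image_bound:
  assumes A: "A \<in> carrier_mat p p" and \<delta>: "\<delta> \<ge> 0"
    and b: "\<And>x. sq_norm {..<p} (mat_image p A x) \<le> \<delta>\<^sup>2 * sq_norm {..<p} x"
  shows "frob_norm A \<le> sqrt p * \<delta>"
proof -
  have "frob_inner A A = (\<Sum>j<p. \<Sum>i<p. (A $$ (i, j))\<^sup>2)"
    unfolding frob_inner_eq[OF A] by (subst sum.swap) (simp add: power2_eq_square)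
  also have "\<dots> \<le> (\<Sum>j<p. \<delta>\<^sup>2)"
  proof (rule sum_mono)
    fix j assume "j \<in> {..<p}"
    then have j: "j < p" by simp
    let ?e = "\<lambda>k. if k = j then 1 else 0 :: real"
    have "mat_image p A ?e i = A $$ (i, j)" for i
      using j by (simp add: mat_image_def if_distrib cong: if_cong)
    moreover have "sq_norm {..<p} ?e = 1"
      using j by (simp add: sq_norm_def if_distrib[of "\<lambda>t. t\<^sup>2"] cong: if_cong)
    ultimately show "(\<Sum>i<p. (A $$ (i, j))\<^sup>2) \<le> \<delta>\<^sup>2" using b[of ?e] by (simp add: sq_norm_def)
  qed
  also have "\<dots> = (sqrt p * \<delta>)\<^sup>2" by (simp add: power_mult_distrib)
  finally show ?thesis unfolding frob_norm_def using \<delta> by (intro real_le_lsqrt) auto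
qed

lemma sets_frob_norm_le:
  assumes A: "\<And>X. X \<in> space P \<Longrightarrow> A X \<in> carrier_mat p p"
    and [measurable]: "\<And>i j. i < p \<Longrightarrow> j < p \<Longrightarrow> (\<lambda>X. A X $$ (i, j)) \<in> borel_measurable P"
  shows "{X \<in> space P. frob_norm (A X) \<le> \<delta>} \<in> sets P"
proof -
  have "{X \<in> space P. frob_norm (A X) \<le> \<delta>}
      = {X \<in> space P. sqrt (\<Sum>i<p. \<Sum>j<p. A X $$ (i, j) * A X $$ (i, j)) \<le> \<delta>}"
    unfolding frob_norm_def using frob_inner_eq[OF A] by auto
  also have "\<dots> \<in> sets P" by measurable
  finally show ?thesis .
qed

section \<open>Quadratic statistics of a normal sample\<close>

abbreviation entry :: "real mat \<Rightarrow> nat \<Rightarrow> nat \<Rightarrow> real" where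
  "entry M \<equiv> (\<lambda>i j. M $$ (i, j))"

lemma bilin_eq_scalar_prod:
  assumes "M \<in> carrier_mat p p"
  shows "bilin {..<p} (entry M) y y = scalar_prod (Matrix.vec p y) (M *\<^sub>v Matrix.vec p y)"
  using assms by (simp add: bilin_def scalar_prod_def atLeast0LessThan sum_distrib_left mult_ac)

lemma bilin_mat_image: "bilin {..<p} (entry M) y y = (\<Sum>i<p. y i * mat_image p M y i)"
  by (simp add: bilin_def mat_image_def sum_distrib_left mult_ac)

text \<open>
  Cauchy-Schwarz in the form \<open>2 a b \<le> \<psi> a\<^sup>2 + b\<^sup>2 / \<psi>\<close>.
\<close>

lemma spectral_norm_form_bound:
  assumes "M \<in> carrier_mat p p" "spectral_norm M = \<psi>" "\<psi> > 0"
  shows "bilin {..<p} (entry M) y y \<le> \<psi> * sq_norm {..<p} y"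
proof -
  let ?w = "mat_image p M y"
  have "2 * (y i * ?w i) \<le> \<psi> * (y i)\<^sup>2 + (?w i)\<^sup>2 / \<psi>" for i
  proof -
    have "0 \<le> (\<psi> * y i - ?w i)\<^sup>2 / \<psi>" using assms(3) by simp
    also have "\<dots> = \<psi> * (y i)\<^sup>2 - 2 * (y i * ?w i) + (?w i)\<^sup>2 / \<psi>"
      using assms(3) by (simp add: field_simps power2_eq_square)
    finally show ?thesis by simp
  qed
  then have "(\<Sum>i<p. 2 * (y i * ?w i)) \<le> (\<Sum>i<p. \<psi> * (y i)\<^sup>2 + (?w i)\<^sup>2 / \<psi>)" by (intro sum_mono)
  then have "2 * bilin {..<p} (entry M) y y \<le> \<psi> * sq_norm {..<p} y + sq_norm {..<p} ?w / \<psi>"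
    unfolding bilin_mat_image sq_norm_def
    by (simp add: sum.distrib sum_distrib_left[symmetric] sum_divide_distrib[symmetric])
  also have "sq_norm {..<p} ?w / \<psi> \<le> \<psi> * sq_norm {..<p} y"
  proof -
    have "sq_norm {..<p} ?w \<le> \<psi>\<^sup>2 * sq_norm {..<p} y"
      using spectral_norm_le_iff[OF assms(1), of \<psi>] assms by simp
    then show ?thesis using assms(3) by (simp add: pos_divide_le_eq power2_eq_square mult_ac)
  qed
  finally show ?thesis by simp
qed

lemma bilin_combination:
  fixes c :: "'k \<Rightarrow> real"
  shows "bilin K (\<lambda>\<kappa> \<kappa>'. bilin I S (y \<kappa>) (y \<kappa>')) c c = bilin I S (\<lambda>j. \<Sum>\<kappa>\<in>K. c \<kappa> * y \<kappa> j) (\<lambda>j. \<Sum>\<kappa>\<in>K. c \<kappa> * y \<kappa> j)"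
proof -
  have "bilin I S (\<lambda>j. \<Sum>\<kappa>\<in>K. c \<kappa> * y \<kappa> j) (\<lambda>j. \<Sum>\<kappa>\<in>K. c \<kappa> * y \<kappa> j)
      = (\<Sum>e\<in>I \<times> I. (\<Sum>\<kappa>\<in>K. S (fst e) (snd e) * (c \<kappa> * y \<kappa> (fst e))) * (\<Sum>\<kappa>\<in>K. c \<kappa> * y \<kappa> (snd e)))"
    unfolding bilin_def by (simp add: sum.cartesian_product' sum_distrib_left)
  also have "\<dots> = (\<Sum>\<kappa>\<in>K. \<Sum>\<kappa>'\<in>K. \<Sum>e\<in>I \<times> I. S (fst e) (snd e) * (c \<kappa> * y \<kappa> (fst e)) * (c \<kappa>' * y \<kappa>' (snd e)))"
    by (rule sum_product_sums)
  also have "\<dots> = bilin K (\<lambda>\<kappa> \<kappa>'. bilin I S (y \<kappa>) (y \<kappa>')) c c"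
    unfolding bilin_def by (simp add: sum.cartesian_product' sum_distrib_left sum_distrib_right mult_ac)
  finally show ?thesis ..
qed

lemma centered_normal_linear_law:
  assumes "centered_normal p \<Sigma> \<mu>" "\<Sigma> \<in> carrier_mat p p"
  shows "distr \<mu> borel (\<lambda>x. \<Sum>j<p. y j * x j) = normal_law 0 (bilin {..<p} (entry \<Sigma>) y y)"
proof -
  have "scalar_prod (Matrix.vec p y) (Matrix.vec p x) = (\<Sum>j<p. y j * x j)" for x
    by (simp add: scalar_prod_def atLeast0LessThan)
  moreover have "Matrix.vec p y \<in> carrier_vec p" by simp
  ultimately show ?thesis
    using assms(1) unfolding centered_normal_def bilin_eq_scalar_prod[OF assms(2)]
    by (metis (no_types, lifting) ext)
qed

lemma centered_normal_measurable:
  assumes "centered_normal p \<Sigma> \<mu>" "j < p"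
  shows "(\<lambda>x. x j) \<in> borel_measurable \<mu>"
proof -
  have "sets \<mu> = sets (PiM {..<p} (\<lambda>_. borel :: real measure))" using assms(1) by (simp add: centered_normal_def)
  then have "borel_measurable \<mu> = (borel_measurable (PiM {..<p} (\<lambda>_. borel)) :: ((nat \<Rightarrow> real) \<Rightarrow> real) set)"
    by (rule measurable_cong_sets) simp
  then show ?thesis using assms(2) by simp
qed

lemma symmetric_entry:
  assumes "covariance_mat p \<Sigma>" "i < p" "j < p"
  shows "\<Sigma> $$ (i, j) = \<Sigma> $$ (j, i)"
proof -
  have "transpose_mat \<Sigma> $$ (j, i) = \<Sigma> $$ (i, j)"
    using assms by (intro index_transpose_mat) (auto simp: covariance_mat_def)
  then show ?thesis using assms by (simp add: covariance_mat_def)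
qed

text \<open>
  The linear statistics \<open>\<Sum>j. y \<kappa> j * x j\<close> form a Gaussian family with covariance
  \<open>bilin {..<p} \<Sigma> (y \<kappa>) (y \<kappa>')\<close>. By the contraction property this covariance matrix, which is the
  compression of \<open>\<Sigma>\<close> to the test vectors, is bounded by \<open>\<psi>\<close>.
\<close>

lemma quadratic_statistic_mgf:
  fixes y :: "'k \<Rightarrow> nat \<Rightarrow> real" and \<tau> \<psi> :: real
  assumes cov: "covariance_mat p \<Sigma>" and norm: "spectral_norm \<Sigma> = \<psi>" "\<psi> > 0"
    and \<mu>: "centered_normal p \<Sigma> \<mu>" and K: "finite K"
    and contr: "\<And>c. sq_norm {..<p} (\<lambda>j. \<Sum>\<kappa>\<in>K. c \<kappa> * y \<kappa> j) \<le> sq_norm K c"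
    and \<tau>: "\<bar>\<tau>\<bar> \<le> 1 / (8 * \<psi>)"
  shows "(\<integral>\<^sup>+x. ennreal (exp (\<tau> * (\<Sum>\<kappa>\<in>K. (\<Sum>j<p. y \<kappa> j * x j)\<^sup>2))) \<partial>\<mu>)
    \<le> ennreal (exp (\<tau> * (\<Sum>\<kappa>\<in>K. bilin {..<p} (entry \<Sigma>) (y \<kappa>) (y \<kappa>)) + 7 * card K * \<psi>\<^sup>2 * \<tau>\<^sup>2))"
proof -
  let ?\<Sigma> = "entry \<Sigma>"
  let ?S = "\<lambda>\<kappa> \<kappa>'. bilin {..<p} ?\<Sigma> (y \<kappa>) (y \<kappa>')"
  let ?y = "\<lambda>c j. \<Sum>\<kappa>\<in>K. c \<kappa> * y \<kappa> j"
  have \<Sigma>: "\<Sigma> \<in> carrier_mat p p" using cov by (simp add: covariance_mat_def)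
  have sym\<Sigma>: "?\<Sigma> i j = ?\<Sigma> j i" if "i \<in> {..<p}" "j \<in> {..<p}" for i j
    using symmetric_entry[OF cov] that by simp
  have psd: "bilin {..<p} ?\<Sigma> v v \<ge> 0" for v
    unfolding bilin_eq_scalar_prod[OF \<Sigma>] using cov by (simp add: covariance_mat_def)
  have meas: "(\<lambda>x. \<Sum>j<p. y \<kappa> j * x j) \<in> borel_measurable \<mu>" for \<kappa>
    using centered_normal_measurable[OF \<mu>] by (intro borel_measurable_sum borel_measurable_times) auto
  have law: "distr \<mu> borel (\<lambda>x. \<Sum>\<kappa>\<in>K. c \<kappa> * (\<Sum>j<p. y \<kappa> j * x j)) = normal_law 0 (bilin K ?S c c)" for c
  proof -
    have "(\<lambda>x. \<Sum>\<kappa>\<in>K. c \<kappa> * (\<Sum>j<p. y \<kappa> j * x j)) = (\<lambda>x. \<Sum>j<p. ?y c j * x j)"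
    proof
      fix x :: "nat \<Rightarrow> real"
      have "(\<Sum>\<kappa>\<in>K. c \<kappa> * (\<Sum>j<p. y \<kappa> j * x j)) = (\<Sum>\<kappa>\<in>K. \<Sum>j<p. c \<kappa> * y \<kappa> j * x j)"
        by (simp add: sum_distrib_left mult.assoc)
      also have "\<dots> = (\<Sum>j<p. ?y c j * x j)"
        by (subst sum.swap) (simp add: sum_distrib_right)
      finally show "(\<Sum>\<kappa>\<in>K. c \<kappa> * (\<Sum>j<p. y \<kappa> j * x j)) = (\<Sum>j<p. ?y c j * x j)" .
    qed
    then show ?thesis
      unfolding bilin_combination using centered_normal_linear_law[OF \<mu> \<Sigma>, of "?y c"] by simp
  qed
  have sym: "\<tau> * ?S \<kappa> \<kappa>' = \<tau> * ?S \<kappa>' \<kappa>" for \<kappa> \<kappa>'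
    using bilin_commute[of "{..<p}" ?\<Sigma>, OF sym\<Sigma>] by simp
  have scale: "bilin K (\<lambda>\<kappa> \<kappa>'. \<tau> * ?S \<kappa> \<kappa>') c c = \<tau> * bilin K ?S c c" for c
    by (simp add: bilin_def[of K] sum_distrib_left mult.assoc)
  have form: "\<bar>bilin K (\<lambda>\<kappa> \<kappa>'. \<tau> * ?S \<kappa> \<kappa>') c c\<bar> \<le> \<bar>\<tau>\<bar> * \<psi> * sq_norm K c" for c
  proof -
    have "bilin K ?S c c \<le> \<psi> * sq_norm K c"
      unfolding bilin_combination
      using spectral_norm_form_bound[OF \<Sigma> norm, of "?y c"] mult_left_mono[OF contr[of c], of \<psi>] norm(2) by linarith
    then have "\<bar>\<tau>\<bar> * bilin K ?S c c \<le> \<bar>\<tau>\<bar> * (\<psi> * sq_norm K c)" by (rule mult_left_mono) simp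
    moreover have "bilin K ?S c c \<ge> 0" unfolding bilin_combination by (rule psd)
    ultimately show ?thesis unfolding scale by (simp add: abs_mult mult.assoc)
  qed
  have "(\<integral>\<^sup>+x. ennreal (exp (\<tau> * (\<Sum>\<kappa>\<in>K. (\<Sum>j<p. y \<kappa> j * x j)\<^sup>2))) \<partial>\<mu>)
      = (\<integral>\<^sup>+c. ennreal (exp (\<tau> * bilin K ?S c c)) \<partial>std_gauss K)"
    using \<mu> by (intro gaussian_family_exp_square_sum K meas law) (auto simp: centered_normal_def bilin_combination psd)
  also have "\<dots> \<le> ennreal (exp ((\<Sum>\<kappa>\<in>K. \<tau> * ?S \<kappa> \<kappa>) + 7 * card K * (\<bar>\<tau>\<bar> * \<psi>)\<^sup>2))"
    unfolding scale[symmetric]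
    by (rule gaussian_chaos_exp_bound[OF K _ _ sym form]) (use \<tau> norm in \<open>auto simp: field_simps\<close>)
  also have "(\<Sum>\<kappa>\<in>K. \<tau> * ?S \<kappa> \<kappa>) + 7 * card K * (\<bar>\<tau>\<bar> * \<psi>)\<^sup>2
      = \<tau> * (\<Sum>\<kappa>\<in>K. bilin {..<p} ?\<Sigma> (y \<kappa>) (y \<kappa>)) + 7 * card K * \<psi>\<^sup>2 * \<tau>\<^sup>2"
    by (simp add: sum_distrib_left power_mult_distrib)
  finally show ?thesis .
qed

lemma empirical_statistic_tail:
  fixes y :: "'k \<Rightarrow> nat \<Rightarrow> real" and \<psi> t :: real and n :: nat
  assumes cov: "covariance_mat p \<Sigma>" and norm: "spectral_norm \<Sigma> = \<psi>" "\<psi> > 0"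
    and \<mu>: "centered_normal p \<Sigma> \<mu>" and K: "finite K" "K \<noteq> {}"
    and contr: "\<And>c. sq_norm {..<p} (\<lambda>j. \<Sum>\<kappa>\<in>K. c \<kappa> * y \<kappa> j) \<le> sq_norm K c"
    and t: "0 \<le> t" "t \<le> card K * \<psi>"
  shows "measure (PiM {..<n} (\<lambda>_. \<mu>)) {X \<in> space (PiM {..<n} (\<lambda>_. \<mu>)). n * t \<le>
      \<bar>(\<Sum>k<n. \<Sum>\<kappa>\<in>K. (\<Sum>j<p. y \<kappa> j * X k j)\<^sup>2) - n * (\<Sum>\<kappa>\<in>K. bilin {..<p} (entry \<Sigma>) (y \<kappa>) (y \<kappa>))\<bar>}
    \<le> 2 * exp (- (n * t\<^sup>2 / (28 * card K * \<psi>\<^sup>2)))"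
proof -
  have c: "real (card K) > 0" using K by (simp add: card_gt_0_iff)
  define V where "V = 7 * card K * \<psi>\<^sup>2"
  have V: "V > 0" "4 * V = 28 * card K * \<psi>\<^sup>2" using c norm by (auto simp: V_def)
  have le: "t / (2 * V) \<le> 1 / (8 * \<psi>)"
  proof -
    have "t * (8 * \<psi>) \<le> card K * \<psi> * (8 * \<psi>)" using t norm by (intro mult_right_mono) auto
    also have "\<dots> \<le> 2 * V" using c by (simp add: V_def power2_eq_square)
    finally show ?thesis using V(1) norm(2) by (simp add: field_simps)
  qed
  have meas: "(\<lambda>x. \<Sum>\<kappa>\<in>K. (\<Sum>j<p. y \<kappa> j * x j)\<^sup>2) \<in> borel_measurable \<mu>"
    using centered_normal_measurable[OF \<mu>] by (intro borel_measurable_sum borel_measurable_power borel_measurable_times) auto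
  show ?thesis
    unfolding V(2)[symmetric]
    by (rule chernoff_two_sided[OF _ meas _ V(1) t(1) le])
      (use \<mu> quadratic_statistic_mgf[OF cov norm \<mu> K(1) contr] in \<open>auto simp: V_def centered_normal_def\<close>)
qed

section \<open>The estimation error\<close>

lemma empirical_cov_carrier [simp]: "empirical_cov p n X \<in> carrier_mat p p"
  by (simp add: empirical_cov_def)

lemma bilin_empirical_cov:
  "bilin {..<p} (entry (empirical_cov p n X)) y y = (\<Sum>k<n. (\<Sum>j<p. y j * X k j)\<^sup>2) / n"
proof -
  have "bilin {..<p} (entry (empirical_cov p n X)) y y
      = (\<Sum>i<p. \<Sum>j<p. \<Sum>k<n. (y i * X k i) * (y j * X k j) / n)"
    unfolding bilin_def
    by (intro sum.cong refl) (simp add: empirical_cov_def sum_distrib_left sum_distrib_right sum_divide_distrib mult_ac)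
  also have "\<dots> = (\<Sum>i<p. \<Sum>k<n. \<Sum>j<p. (y i * X k i) * (y j * X k j) / n)"
    by (intro sum.cong refl sum.swap)
  also have "\<dots> = (\<Sum>k<n. \<Sum>i<p. \<Sum>j<p. (y i * X k i) * (y j * X k j) / n)"
    by (rule sum.swap)
  also have "\<dots> = (\<Sum>k<n. (\<Sum>j<p. y j * X k j)\<^sup>2) / n"
    by (simp add: power2_eq_square sum_product sum_divide_distrib)
  finally show ?thesis .
qed

lemma sum_bilin_eq_frob_inner:
  assumes "A \<in> carrier_mat p p"
  shows "(\<Sum>\<kappa>\<in>K. bilin {..<p} (entry A) (y \<kappa>) (y \<kappa>))
    = frob_inner A (mat p p (\<lambda>(j, l). \<Sum>\<kappa>\<in>K. y \<kappa> j * y \<kappa> l))"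
proof -
  have "frob_inner A (mat p p (\<lambda>(j, l). \<Sum>\<kappa>\<in>K. y \<kappa> j * y \<kappa> l))
      = (\<Sum>j<p. \<Sum>l<p. \<Sum>\<kappa>\<in>K. A $$ (j, l) * y \<kappa> j * y \<kappa> l)"
    unfolding frob_inner_eq[OF assms] by (intro sum.cong refl) (simp add: sum_distrib_left mult_ac)
  also have "\<dots> = (\<Sum>j<p. \<Sum>\<kappa>\<in>K. \<Sum>l<p. A $$ (j, l) * y \<kappa> j * y \<kappa> l)"
    by (intro sum.cong refl sum.swap)
  also have "\<dots> = (\<Sum>\<kappa>\<in>K. bilin {..<p} (entry A) (y \<kappa>) (y \<kappa>))"
    unfolding bilin_def by (rule sum.swap)
  finally show ?thesis ..
qed

lemma bilin_sum_forms: "bilin I (\<lambda>a b. \<Sum>\<kappa>\<in>K. F \<kappa> a b) x y = (\<Sum>\<kappa>\<in>K. bilin I (F \<kappa>) x y)"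
  for F :: "'k \<Rightarrow> 'i \<Rightarrow> 'i \<Rightarrow> real"
proof -
  have "bilin I (\<lambda>a b. \<Sum>\<kappa>\<in>K. F \<kappa> a b) x y = (\<Sum>i\<in>I. \<Sum>j\<in>I. \<Sum>\<kappa>\<in>K. F \<kappa> i j * x i * y j)"
    by (simp add: bilin_def sum_distrib_right)
  also have "\<dots> = (\<Sum>i\<in>I. \<Sum>\<kappa>\<in>K. \<Sum>j\<in>I. F \<kappa> i j * x i * y j)"
    by (intro sum.cong refl sum.swap)
  also have "\<dots> = (\<Sum>\<kappa>\<in>K. bilin I (F \<kappa>) x y)" unfolding bilin_def by (rule sum.swap)
  finally show ?thesis .
qed

context block_frame begin

lemma r_le_p: "r \<le> p"
proof -
  have "(\<Sum>i<r. 1) \<le> (\<Sum>i<r. m i * s i)"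
    using s_pos m_pos by (intro sum_mono) (simp add: Suc_le_eq)
  then show ?thesis by (simp add: dim_eq)
qed

definition estimation_error :: "nat \<Rightarrow> real mat \<Rightarrow> (nat \<Rightarrow> nat \<Rightarrow> real) \<Rightarrow> real mat" where
  "estimation_error n \<Sigma> X = \<Sigma> - invariant_proj p G (empirical_cov p n X)"

lemma estimation_error_eq: "estimation_error n \<Sigma> X = \<Sigma> - group_average p G (empirical_cov p n X)"
  by (simp add: estimation_error_def invariant_proj_eq_group_average[OF G])

lemma estimation_error_carrier: "estimation_error n \<Sigma> X \<in> carrier_mat p p"
  unfolding estimation_error_eq by (simp add: minus_carrier_mat)

lemma estimation_error_index:
  "i < p \<Longrightarrow> j < p \<Longrightarrow> estimation_error n \<Sigma> X $$ (i, j) = \<Sigma> $$ (i, j) - group_average p G (empirical_cov p n X) $$ (i, j)"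
  unfolding estimation_error_eq using carrier_matD[OF group_average_carrier[of p G "empirical_cov p n X"]] by simp

lemma estimation_error_symmetric:
  assumes "covariance_mat p \<Sigma>" "i < p" "j < p"
  shows "estimation_error n \<Sigma> X $$ (i, j) = estimation_error n \<Sigma> X $$ (j, i)"
proof -
  have "empirical_cov p n X $$ (shift_perm g i, shift_perm g j) = empirical_cov p n X $$ (shift_perm g j, shift_perm g i)"
    if "g \<in> G" for g
    using assms shift_less[OF G_permutes[OF that]] by (simp add: empirical_cov_def mult.commute)
  then show ?thesis
    using assms symmetric_entry[OF assms] by (simp add: estimation_error_index group_average_index)
qed

text \<open>
  The projection preserves the inner products with the invariant Gram matrices of the test vectors,
  so the hypothesis on \<open>\<Sigma> - \<Sigma>\<^sup>n\<close> is one on the error itself. For fixed \<open>i\<close> the sum over the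
  copies is a quadratic form in \<open>z\<close>, so that the bound extends from the net to all \<open>z\<close> at the price of
  the factor \<open>16/7\<close>; the threshold \<open>\<delta>/4\<close> leaves room for it.
\<close>

lemma error_form_bound_from_net:
  fixes \<delta> :: real and v :: "nat \<Rightarrow> real"
  assumes cov: "covariance_mat p \<Sigma>" and inv: "\<Sigma> \<in> invariant_mats p G" and \<delta>: "\<delta> \<ge> 0"
    and net: "\<And>i z. i < r \<Longrightarrow> z \<in> grid_net (coords i) \<Longrightarrow>
      \<bar>\<Sum>\<kappa>\<in>copies i. bilin {..<p} (entry \<Sigma>) (test_vec i \<kappa> z) (test_vec i \<kappa> z)
        - bilin {..<p} (entry (empirical_cov p n X)) (test_vec i \<kappa> z) (test_vec i \<kappa> z)\<bar> \<le> m i * \<delta> / 4"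
  shows "\<bar>bilin {..<p} (entry (estimation_error n \<Sigma> X)) v v\<bar> \<le> \<delta> * sq_norm {..<p} v"
proof -
  let ?M = "empirical_cov p n X" and ?D = "estimation_error n \<Sigma> X"
  have \<Sigma>: "\<Sigma> \<in> carrier_mat p p" using cov by (simp add: covariance_mat_def)
  have D: "?D \<in> invariant_mats p G"
    unfolding estimation_error_eq by (intro invariant_mats_diff[OF G] inv group_average_invariant[OF G])
  have proj: "(\<Sum>\<kappa>\<in>copies i. bilin {..<p} (entry ?D) (test_vec i \<kappa> z) (test_vec i \<kappa> z))
      = (\<Sum>\<kappa>\<in>copies i. bilin {..<p} (entry \<Sigma>) (test_vec i \<kappa> z) (test_vec i \<kappa> z)
        - bilin {..<p} (entry ?M) (test_vec i \<kappa> z) (test_vec i \<kappa> z))" if i: "i < r" for i z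
  proof -
    let ?W = "mat p p (\<lambda>(j, l). \<Sum>\<kappa>\<in>copies i. test_vec i \<kappa> z j * test_vec i \<kappa> z l)"
    have "frob_inner ?D ?W = frob_inner \<Sigma> ?W - frob_inner ?M ?W"
      unfolding estimation_error_eq frob_inner_diff_left[OF \<Sigma> group_average_carrier]
        group_average_orthogonal[OF G empirical_cov_carrier test_gram_invariant[OF i]] ..
    then show ?thesis
      unfolding sum_subtractf sum_bilin_eq_frob_inner[OF \<Sigma>] sum_bilin_eq_frob_inner[OF empirical_cov_carrier]
        sum_bilin_eq_frob_inner[OF estimation_error_carrier] .
  qed
  have "\<bar>\<Sum>\<kappa>\<in>copies i. bilin {..<p} (entry ?D) (test_vec i \<kappa> z) (test_vec i \<kappa> z)\<bar>
      \<le> \<delta> * m i * sq_norm (coords i) z" if i: "i < r" for i z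
  proof -
    define S where "S \<gamma> \<gamma>' = (\<Sum>\<kappa>\<in>copies i. bilin {..<p} (entry ?D) (frame i \<kappa> \<gamma>) (frame i \<kappa> \<gamma>'))" for \<gamma> \<gamma>'
    have S: "bilin (coords i) S z z = (\<Sum>\<kappa>\<in>copies i. bilin {..<p} (entry ?D) (test_vec i \<kappa> z) (test_vec i \<kappa> z))" for z
      unfolding S_def[abs_def] bilin_sum_forms bilin_combination test_vec_def[abs_def] ..
    have "\<bar>bilin (coords i) S z z\<bar> \<le> 16 / 7 * (m i * \<delta> / 4) * sq_norm (coords i) z"
    proof (rule form_bound_from_grid_net)
      show "coords i \<noteq> {}" using s_pos[OF i] by auto
      show "S \<gamma> \<gamma>' = S \<gamma>' \<gamma>" for \<gamma> \<gamma>'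
        unfolding S_def using estimation_error_symmetric[OF cov]
        by (intro sum.cong refl bilin_commute) auto
      show "\<bar>bilin (coords i) S z z\<bar> \<le> m i * \<delta> / 4" if "z \<in> grid_net (coords i)" for z
        unfolding S proj[OF i] by (rule net[OF i that])
    qed simp
    also have "\<dots> \<le> \<delta> * m i * sq_norm (coords i) z"
      using \<delta> by (intro mult_right_mono) (auto simp: mult_ac)
    finally show ?thesis unfolding S .
  qed
  then show ?thesis by (rule test_forms_bound_invariant_form[OF D])
qed

text \<open>
  Union bound over \<open>i\<close> and the net of the \<open>i\<close>-th coordinate space. The constant is \<open>26880 = 30 * 896\<close>: by
  the two sample size conditions the exponent \<open>n m i \<delta>\<^sup>2 / (896 \<psi>\<^sup>2)\<close> is at least \<open>15 s i + 15 ln p\<close>. Of this,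
  \<open>12 s i\<close> pays for the size of the net, \<open>2 s i\<close> for the factor in front of the tail bound, and \<open>2 ln p\<close>
  for the at most \<open>p\<close> values of \<open>i\<close> together with the failure probability \<open>1 / p\<close>.
\<close>

lemma deviation_probability:
  fixes \<psi> \<delta> :: real and n :: nat
  assumes p: "p \<ge> 1" and cov: "covariance_mat p \<Sigma>" and inv: "\<Sigma> \<in> invariant_mats p G"
    and norm: "spectral_norm \<Sigma> = \<psi>" and \<mu>: "centered_normal p \<Sigma> \<mu>"
    and \<delta>: "0 < \<delta>" "\<delta> \<le> 8 * \<psi>"
    and n1: "\<And>i. i < r \<Longrightarrow> 26880 * \<psi>\<^sup>2 * s i \<le> n * (m i * \<delta>\<^sup>2)"
    and n2: "\<And>i. i < r \<Longrightarrow> 26880 * \<psi>\<^sup>2 * ln p \<le> n * (m i * \<delta>\<^sup>2)"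
  obtains E where "E \<in> sets (PiM {..<n} (\<lambda>_. \<mu>))" "measure (PiM {..<n} (\<lambda>_. \<mu>)) E > 1 - 1 / p"
    "\<And>X v. X \<in> E \<Longrightarrow> \<bar>bilin {..<p} (entry (estimation_error n \<Sigma> X)) v v\<bar> \<le> \<delta> * sq_norm {..<p} v"
proof -
  let ?P = "PiM {..<n} (\<lambda>_. \<mu>)"
  have \<psi>: "\<psi> > 0" using \<delta> by linarith
  have prob: "prob_space \<mu>" using \<mu> by (simp add: centered_normal_def)
  interpret P: prob_space ?P by (rule prob_space_PiM) (rule prob)
  have r0: "r > 0"
    using dim_eq p by (cases r) auto
  \<comment> \<open>the first sample size condition excludes \<open>n = 0\<close>, where division by \<open>n\<close> would be meaningless\<close>
  have n0: "n > 0"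
  proof (rule ccontr)
    assume "\<not> n > 0"
    then have "26880 * \<psi>\<^sup>2 * real (s 0) \<le> 0" using n1[OF r0] by simp
    then show False using \<psi> s_pos[OF r0] by (simp add: mult_le_0_iff)
  qed
  define e where "e i z = (\<Sum>\<kappa>\<in>copies i. bilin {..<p} (entry \<Sigma>) (test_vec i \<kappa> z) (test_vec i \<kappa> z))" for i z
  define q where "q i z X = (\<Sum>k<n. \<Sum>\<kappa>\<in>copies i. (\<Sum>j<p. test_vec i \<kappa> z j * X k j)\<^sup>2)" for i z and X :: "nat \<Rightarrow> nat \<Rightarrow> real"
  define A where "A x = {X \<in> space ?P. n * (m (fst x) * \<delta> / 4) \<le> \<bar>q (fst x) (snd x) X - n * e (fst x) (snd x)\<bar>}" for x
  let ?N = "Sigma {..<r} (\<lambda>i. grid_net (coords i))"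
  define E where "E = space ?P - (\<Union>x\<in>?N. A x)"
  have finN: "finite ?N" by (intro finite_SigmaI card_grid_net) auto
  have meas: "(\<lambda>X. X k j) \<in> borel_measurable ?P" if "k < n" "j < p" for k j
    using centered_normal_measurable[OF \<mu> that(2)] that(1)
    by (intro measurable_compose[OF measurable_component_singleton[of k "{..<n}"]]) auto
  have [measurable]: "(\<lambda>X. q i z X) \<in> borel_measurable ?P" for i z
    unfolding q_def using meas
    by (intro borel_measurable_sum borel_measurable_power borel_measurable_times) auto
  have setsA: "A x \<in> sets ?P" for x unfolding A_def by measurable
  have tail: "measure ?P (A (i, z)) \<le> 2 * exp (- (14 * s i + 2 * ln p))"
    if i: "i < r" and z: "z \<in> grid_net (coords i)" for i z
  proof -
    have cK: "card (copies i) = 2 * m i" by (simp add: card_cartesian_product)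
    have z1: "sq_norm (coords i) z \<le> 1"
      using s_pos[OF i] by (intro grid_net_sq_norm z) auto
    have mi: "real (m i) > 0" using m_pos[OF i] by simp
    have contr: "sq_norm {..<p} (\<lambda>j. \<Sum>\<kappa>\<in>copies i. c \<kappa> * test_vec i \<kappa> z j) \<le> sq_norm (copies i) c" for c
      using test_combination_contraction[OF i, of c z] mult_left_mono[OF z1, of "sq_norm (copies i) c"] by simp
    have "measure ?P (A (i, z)) \<le> 2 * exp (- (n * (m i * \<delta> / 4)\<^sup>2 / (28 * card (copies i) * \<psi>\<^sup>2)))"
      unfolding A_def q_def e_def fst_conv snd_conv
    proof (rule empirical_statistic_tail[OF cov norm \<psi> \<mu> _ _ contr])
      show "copies i \<noteq> {}" using m_pos[OF i] by auto
      show "m i * \<delta> / 4 \<le> card (copies i) * \<psi>" unfolding cK using \<delta> mi by (simp add: field_simps)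
    qed (use \<delta> in auto)
    also have "n * (m i * \<delta> / 4)\<^sup>2 / (28 * card (copies i) * \<psi>\<^sup>2) = n * (m i * \<delta>\<^sup>2) / (896 * \<psi>\<^sup>2)"
      unfolding cK using mi \<psi> by (simp add: power2_eq_square field_simps)
    also have "2 * exp (- (n * (m i * \<delta>\<^sup>2) / (896 * \<psi>\<^sup>2))) \<le> 2 * exp (- (14 * s i + 2 * ln p))"
    proof -
      have d: "0 < 896 * \<psi>\<^sup>2" using \<psi> by simp
      have "30 * real (s i) \<le> n * (m i * \<delta>\<^sup>2) / (896 * \<psi>\<^sup>2)" "30 * ln p \<le> n * (m i * \<delta>\<^sup>2) / (896 * \<psi>\<^sup>2)"
        using n1[OF i] n2[OF i] unfolding pos_le_divide_eq[OF d] by (simp_all add: mult_ac)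
      moreover have "ln (real p) \<ge> 0" using p by simp
      ultimately show ?thesis by simp
    qed
    finally show ?thesis .
  qed
  have "measure ?P (\<Union>x\<in>?N. A x) \<le> (\<Sum>x\<in>?N. measure ?P (A x))"
    using finN setsA by (intro P.finite_measure_subadditive_finite) auto
  also have "\<dots> = (\<Sum>i<r. \<Sum>z\<in>grid_net (coords i). measure ?P (A (i, z)))"
    by (subst sum.Sigma) (auto intro!: card_grid_net)
  also have "\<dots> \<le> (\<Sum>i<r. real (card (grid_net (coords i))) * (2 * exp (- (14 * s i + 2 * ln p))))"
    by (intro sum_mono sum_bounded_above tail) auto
  also have "\<dots> \<le> (\<Sum>i<r. exp (12 * s i) * (2 * exp (- (14 * s i + 2 * ln p))))"
  proof (intro sum_mono mult_right_mono)
    fix i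
    have "real (card (grid_net (coords i))) \<le> 48 ^ card (coords i)" by (rule card_grid_net) simp
    also have "card (coords i) = 2 * s i" by (simp add: card_cartesian_product)
    also have "(48::real) ^ (2 * s i) \<le> exp (12 * s i)" using grid_net_size_le_exp[of "s i"] by simp
    finally show "real (card (grid_net (coords i))) \<le> exp (12 * s i)" .
  qed simp
  also have "\<dots> \<le> (\<Sum>i<r. 1 / (2 * (real p)\<^sup>2))"
  proof (rule sum_mono)
    fix i assume "i \<in> {..<r}"
    then have si: "real (s i) \<ge> 1" using s_pos[of i] by (simp add: Suc_le_eq)
    have "exp (12 * s i) * (2 * exp (- (14 * s i + 2 * ln p))) = 2 * exp (- (2 * s i)) * exp (- (2 * ln p))"
      by (simp add: exp_add[symmetric] mult.assoc[symmetric])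
    also have "exp (- (2 * ln (real p))) = 1 / (real p)\<^sup>2"
      using p by (simp add: exp_minus exp_double inverse_eq_divide)
    finally have eq: "exp (12 * s i) * (2 * exp (- (14 * s i + 2 * ln p))) = 2 * exp (- (2 * real (s i))) * (1 / (real p)\<^sup>2)"
      by simp
    have "2 * exp (- (2 * real (s i))) \<le> 1 / 2"
    proof -
      have "(2::real) \<le> exp (s i)" using exp_ge_add_one_self[of "real (s i)"] si by linarith
      then have "(2::real)\<^sup>2 \<le> exp (s i) ^ 2" by (rule power_mono) simp
      then have "4 \<le> exp (2 * real (s i))" by (simp add: exp_double)
      then show ?thesis by (simp add: exp_minus field_simps)
    qed
    then have "2 * exp (- (2 * real (s i))) * (1 / (real p)\<^sup>2) \<le> 1 / 2 * (1 / (real p)\<^sup>2)"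
      by (rule mult_right_mono) simp
    then show "exp (12 * s i) * (2 * exp (- (14 * s i + 2 * ln p))) \<le> 1 / (2 * (real p)\<^sup>2)"
      unfolding eq by simp
  qed
  also have "\<dots> = r / (2 * (real p)\<^sup>2)" by simp
  also have "\<dots> \<le> p / (2 * (real p)\<^sup>2)" using r_le_p by (intro divide_right_mono) auto
  also have "\<dots> < 1 / p" using p by (simp add: power2_eq_square field_simps)
  finally have small: "measure ?P (\<Union>x\<in>?N. A x) < 1 / p" .
  show ?thesis
  proof (rule that)
    have U: "(\<Union>x\<in>?N. A x) \<in> sets ?P" using finN setsA by auto
    then show "E \<in> sets ?P" by (simp add: E_def)
    show "measure ?P E > 1 - 1 / p" unfolding E_def P.prob_compl[OF U] using small by simp
    fix X v assume X: "X \<in> E"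
    show "\<bar>bilin {..<p} (entry (estimation_error n \<Sigma> X)) v v\<bar> \<le> \<delta> * sq_norm {..<p} v"
    proof (rule error_form_bound_from_net[OF cov inv])
      fix i z assume iz: "i < r" "z \<in> grid_net (coords i)"
      then have "X \<notin> A (i, z)" "X \<in> space ?P" using X by (auto simp: E_def)
      then have "\<bar>q i z X - n * e i z\<bar> / n \<le> n * (m i * \<delta> / 4) / n"
        by (intro divide_right_mono) (simp_all add: A_def)
      also have "\<dots> = m i * \<delta> / 4" using n0 by simp
      also have "\<bar>q i z X - n * e i z\<bar> / n = \<bar>e i z - q i z X / n\<bar>"
      proof -
        have "e i z - q i z X / n = - ((q i z X - n * e i z) / n)" using n0 by (simp add: field_simps)
        then show ?thesis using n0 by (simp add: abs_divide)
      qed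
      also have "e i z - q i z X / n = (\<Sum>\<kappa>\<in>copies i. bilin {..<p} (entry \<Sigma>) (test_vec i \<kappa> z) (test_vec i \<kappa> z)
          - bilin {..<p} (entry (empirical_cov p n X)) (test_vec i \<kappa> z) (test_vec i \<kappa> z))"
        unfolding e_def q_def sum_subtractf bilin_empirical_cov sum_divide_distrib[symmetric]
        by (subst sum.swap) simp
      finally show "\<bar>\<Sum>\<kappa>\<in>copies i. bilin {..<p} (entry \<Sigma>) (test_vec i \<kappa> z) (test_vec i \<kappa> z)
          - bilin {..<p} (entry (empirical_cov p n X)) (test_vec i \<kappa> z) (test_vec i \<kappa> z)\<bar> \<le> m i * \<delta> / 4" .
    qed (use \<delta> in simp)
  qed
qed

lemma norm_events_measurable:
  assumes \<mu>: "centered_normal p \<Sigma> \<mu>" and \<delta>: "\<delta> \<ge> 0"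
  shows "{X \<in> space (PiM {..<n} (\<lambda>_. \<mu>)). spectral_norm (estimation_error n \<Sigma> X) \<le> \<delta>} \<in> sets (PiM {..<n} (\<lambda>_. \<mu>))"
    and "{X \<in> space (PiM {..<n} (\<lambda>_. \<mu>)). frob_norm (estimation_error n \<Sigma> X) \<le> \<delta>} \<in> sets (PiM {..<n} (\<lambda>_. \<mu>))"
proof -
  let ?P = "PiM {..<n} (\<lambda>_. \<mu>)"
  have coord: "(\<lambda>X. X k j) \<in> borel_measurable ?P" if "k < n" "j < p" for k j
    using centered_normal_measurable[OF \<mu> that(2)] that(1)
    by (intro measurable_compose[OF measurable_component_singleton[of k "{..<n}"]]) auto
  have emp: "(\<lambda>X. empirical_cov p n X $$ (i, j)) \<in> borel_measurable ?P" if "i < p" "j < p" for i j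
    using that coord by (auto simp: empirical_cov_def intro!: borel_measurable_sum borel_measurable_times)
  have meas: "(\<lambda>X. estimation_error n \<Sigma> X $$ (i, j)) \<in> borel_measurable ?P" if "i < p" "j < p" for i j
    using that emp shift_less[OF G_permutes]
    by (auto simp: estimation_error_index group_average_index
        intro!: borel_measurable_diff borel_measurable_divide borel_measurable_sum)
  show "{X \<in> space ?P. spectral_norm (estimation_error n \<Sigma> X) \<le> \<delta>} \<in> sets ?P"
    by (rule sets_spectral_norm_le[OF estimation_error_carrier \<delta> meas])
  show "{X \<in> space ?P. frob_norm (estimation_error n \<Sigma> X) \<le> \<delta>} \<in> sets ?P"
    by (rule sets_frob_norm_le[OF estimation_error_carrier meas])
qed

text \<open>
  One event serves for both norms. The error is symmetric, so the bound on its quadratic form bounds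
  its spectral norm.
\<close>

lemma spectral_and_frobenius_deviation:
  fixes \<psi> \<delta> :: real and n :: nat
  assumes p: "p \<ge> 1" and cov: "covariance_mat p \<Sigma>" and inv: "\<Sigma> \<in> invariant_mats p G"
    and norm: "spectral_norm \<Sigma> = \<psi>" and \<mu>: "centered_normal p \<Sigma> \<mu>"
    and \<delta>: "0 < \<delta>" "\<delta> \<le> 8 * \<psi>"
    and n1: "\<And>i. i < r \<Longrightarrow> 26880 * \<psi>\<^sup>2 * s i \<le> n * (m i * \<delta>\<^sup>2)"
    and n2: "\<And>i. i < r \<Longrightarrow> 26880 * \<psi>\<^sup>2 * ln p \<le> n * (m i * \<delta>\<^sup>2)"
  shows "measure (PiM {..<n} (\<lambda>_. \<mu>))
      {X \<in> space (PiM {..<n} (\<lambda>_. \<mu>)). spectral_norm (estimation_error n \<Sigma> X) \<le> \<delta>} > 1 - 1 / p"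
    and "measure (PiM {..<n} (\<lambda>_. \<mu>))
      {X \<in> space (PiM {..<n} (\<lambda>_. \<mu>)). frob_norm (estimation_error n \<Sigma> X) \<le> sqrt p * \<delta>} > 1 - 1 / p"
proof -
  let ?P = "PiM {..<n} (\<lambda>_. \<mu>)" and ?D = "estimation_error n \<Sigma>"
  interpret P: prob_space ?P by (rule prob_space_PiM) (use \<mu> in \<open>simp add: centered_normal_def\<close>)
  obtain E where E: "E \<in> sets ?P" "measure ?P E > 1 - 1 / p"
    and bd: "\<And>X v. X \<in> E \<Longrightarrow> \<bar>bilin {..<p} (entry (?D X)) v v\<bar> \<le> \<delta> * sq_norm {..<p} v"
    using deviation_probability[OF p cov inv norm \<mu> \<delta> n1 n2] by blast
  have img: "sq_norm {..<p} (mat_image p (?D X) x) \<le> \<delta>\<^sup>2 * sq_norm {..<p} x" if "X \<in> E" for X x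
    unfolding mat_image_def
    by (rule form_bound_imp_image_bound[OF _ bd[OF that]]) (use estimation_error_symmetric[OF cov] \<delta> in auto)
  have "E \<subseteq> {X \<in> space ?P. spectral_norm (?D X) \<le> \<delta>}"
    using img sets.sets_into_space[OF E(1)] spectral_norm_le_iff[OF estimation_error_carrier] \<delta> by auto
  then have "measure ?P E \<le> measure ?P {X \<in> space ?P. spectral_norm (?D X) \<le> \<delta>}"
    using \<delta> by (intro P.finite_measure_mono norm_events_measurable[OF \<mu>]) auto
  then show "measure ?P {X \<in> space ?P. spectral_norm (?D X) \<le> \<delta>} > 1 - 1 / p" using E(2) by linarith
  have "E \<subseteq> {X \<in> space ?P. frob_norm (?D X) \<le> sqrt p * \<delta>}"
    using img sets.sets_into_space[OF E(1)] frob_norm_le_of_image_bound[OF estimation_error_carrier] \<delta> by auto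
  then have "measure ?P E \<le> measure ?P {X \<in> space ?P. frob_norm (?D X) \<le> sqrt p * \<delta>}"
    using \<delta> by (intro P.finite_measure_mono norm_events_measurable[OF \<mu>]) auto
  then show "measure ?P {X \<in> space ?P. frob_norm (?D X) \<le> sqrt p * \<delta>} > 1 - 1 / p" using E(2) by linarith
qed

end

text \<open>
  The summand \<open>1\<close> keeps the constant of the theorem positive when \<open>\<psi> = 0\<close>.
\<close>

lemma sample_size_bound:
  fixes C x :: real and f h :: "nat \<Rightarrow> real"
  assumes n: "x \<ge> (C + 1) * max (MAX i\<in>{..<r}. f i) (MAX i\<in>{..<r}. h i)"
    and C: "C \<ge> 0" and i: "i < r" and nonneg: "f i \<ge> 0" "h i \<ge> 0"
  shows "C * f i \<le> x" "C * h i \<le> x"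
proof -
  let ?M = "max (MAX i\<in>{..<r}. f i) (MAX i\<in>{..<r}. h i)"
  have "f i \<le> (MAX i\<in>{..<r}. f i)" "h i \<le> (MAX i\<in>{..<r}. h i)" using i by (auto intro: Max_ge)
  then have le: "f i \<le> ?M" "h i \<le> ?M" by auto
  then have M: "?M \<ge> 0" using nonneg by linarith
  have "C * f i \<le> C * ?M" "C * h i \<le> C * ?M" using le C by (auto intro: mult_left_mono)
  moreover have "C * ?M \<le> (C + 1) * ?M" using M by (simp add: distrib_right)
  ultimately show "C * f i \<le> x" "C * h i \<le> x" using n by linarith+
qed

theorem corollary3p1:
  fixes \<psi> :: real
  shows "\<exists>c C1 C2 :: real. c > 0 \<and> C1 > 0 \<and> C2 > 0 \<and>
    (\<forall>(p::nat) (n::nat) (G :: (nat \<Rightarrow> nat) set) (\<Sigma> :: real mat) (\<mu> :: (nat \<Rightarrow> real) measure)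
      (r::nat) (s :: nat \<Rightarrow> nat) (m :: nat \<Rightarrow> nat) (\<delta>::real).
      p \<ge> 1 \<longrightarrow> subgroup G (sym_group p) \<longrightarrow> block_params p G r s m \<longrightarrow>
      covariance_mat p \<Sigma> \<longrightarrow> \<Sigma> \<in> invariant_mats p G \<longrightarrow> spectral_norm \<Sigma> = \<psi> \<longrightarrow>
      centered_normal p \<Sigma> \<mu> \<longrightarrow> 0 < \<delta> \<longrightarrow> \<delta> \<le> 8 * \<psi> \<longrightarrow>
      (let P = PiM {..<n} (\<lambda>_. \<mu>);
           Sigma_hat = (\<lambda>X. invariant_proj p G (empirical_cov p n X))
       in
        (real n \<ge> C1 * max (MAX i\<in>{..<r}. real (s i) / (real (m i) * \<delta>\<^sup>2))
                            (MAX i\<in>{..<r}. ln (real p) / (real (m i) * \<delta>\<^sup>2)) \<longrightarrow>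
          measure P {X \<in> space P. spectral_norm (\<Sigma> - Sigma_hat X) \<le> \<delta>} > 1 - 1 / real p powr c) \<and>
        (real n \<ge> C2 * max (MAX i\<in>{..<r}. real (s i) * real p / (real (m i) * \<delta>\<^sup>2))
                            (MAX i\<in>{..<r}. real p * ln (real p) / (real (m i) * \<delta>\<^sup>2)) \<longrightarrow>
          measure P {X \<in> space P. frob_norm (\<Sigma> - Sigma_hat X) \<le> \<delta>} > 1 - 1 / real p powr c)))"
proof (intro exI conjI allI impI)
  define C where "C = 26880 * \<psi>\<^sup>2"
  have C: "C \<ge> 0" by (simp add: C_def)
  show "(0::real) < 1" "0 < 26880 * \<psi>\<^sup>2 + 1" "0 < 26880 * \<psi>\<^sup>2 + 1"
    by (simp_all add: add_nonneg_pos)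
  fix p n :: nat and G :: "(nat \<Rightarrow> nat) set" and \<Sigma> :: "real mat" and \<mu> :: "(nat \<Rightarrow> real) measure"
    and r :: nat and s m :: "nat \<Rightarrow> nat" and \<delta> :: real
  assume p: "1 \<le> p" and G: "subgroup G (sym_group p)" and par: "block_params p G r s m"
    and cov: "covariance_mat p \<Sigma>" and inv: "\<Sigma> \<in> invariant_mats p G" and norm: "spectral_norm \<Sigma> = \<psi>"
    and \<mu>: "centered_normal p \<Sigma> \<mu>" and \<delta>: "0 < \<delta>" "\<delta> \<le> 8 * \<psi>"
  obtain \<rho> T where "block_decomposition p G r s m \<rho> T" using par by (auto simp: block_params_def)
  then interpret block_frame p G r s m \<rho> T by (rule block_frame.intro[OF G])
  have lnp: "ln (real p) \<ge> 0" and p0: "real p > 0" using p by auto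
  have pos: "real (m i) * \<delta>\<^sup>2 > 0" if "i < r" for i using m_pos[OF that] \<delta> by simp
  let ?P = "PiM {..<n} (\<lambda>_. \<mu>)"
  have a: "measure ?P {X \<in> space ?P. spectral_norm (\<Sigma> - invariant_proj p G (empirical_cov p n X)) \<le> \<delta>}
      > 1 - 1 / real p powr 1"
    if n: "real n \<ge> (26880 * \<psi>\<^sup>2 + 1) * max (MAX i\<in>{..<r}. real (s i) / (real (m i) * \<delta>\<^sup>2))
                            (MAX i\<in>{..<r}. ln (real p) / (real (m i) * \<delta>\<^sup>2))"
  proof -
    have *: "C * (real (s i) / (real (m i) * \<delta>\<^sup>2)) \<le> n" "C * (ln (real p) / (real (m i) * \<delta>\<^sup>2)) \<le> n"
      if "i < r" for i
      using sample_size_bound[OF n[folded C_def] C that] pos[OF that] lnp by auto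
    have "26880 * \<psi>\<^sup>2 * s i \<le> n * (m i * \<delta>\<^sup>2)" "26880 * \<psi>\<^sup>2 * ln p \<le> n * (m i * \<delta>\<^sup>2)" if "i < r" for i
      using *[OF that] pos[OF that] unfolding C_def by (simp_all add: pos_divide_le_eq)
    from spectral_and_frobenius_deviation(1)[OF p cov inv norm \<mu> \<delta> this] show ?thesis
      using p0 by (simp add: estimation_error_def)
  qed
  have b: "measure ?P {X \<in> space ?P. frob_norm (\<Sigma> - invariant_proj p G (empirical_cov p n X)) \<le> \<delta>}
      > 1 - 1 / real p powr 1"
    if n: "real n \<ge> (26880 * \<psi>\<^sup>2 + 1) * max (MAX i\<in>{..<r}. real (s i) * real p / (real (m i) * \<delta>\<^sup>2))
                            (MAX i\<in>{..<r}. real p * ln (real p) / (real (m i) * \<delta>\<^sup>2))"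
  proof -
    \<comment> \<open>the spectral tolerance that corresponds to the Frobenius tolerance \<open>\<delta>\<close>\<close>
    define \<eta> where "\<eta> = \<delta> / sqrt p"
    have \<eta>: "0 < \<eta>" "\<eta> \<le> 8 * \<psi>" "sqrt p * \<eta> = \<delta>" "real p * \<eta>\<^sup>2 = \<delta>\<^sup>2"
    proof -
      show "0 < \<eta>" "sqrt p * \<eta> = \<delta>" "real p * \<eta>\<^sup>2 = \<delta>\<^sup>2" using \<delta> p0 by (auto simp: \<eta>_def power_divide)
      have "\<delta> \<le> \<delta> * sqrt p" using \<delta> p by simp
      then have "\<eta> \<le> \<delta>" unfolding \<eta>_def using p0 by (simp add: pos_divide_le_eq)
      then show "\<eta> \<le> 8 * \<psi>" using \<delta> by linarith
    qed
    have *: "C * (real (s i) * real p / (real (m i) * \<delta>\<^sup>2)) \<le> n" "C * (real p * ln (real p) / (real (m i) * \<delta>\<^sup>2)) \<le> n"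
      if "i < r" for i
      using sample_size_bound[OF n[folded C_def] C that] pos[OF that] lnp by auto
    have "26880 * \<psi>\<^sup>2 * s i \<le> n * (m i * \<eta>\<^sup>2)" "26880 * \<psi>\<^sup>2 * ln p \<le> n * (m i * \<eta>\<^sup>2)" if "i < r" for i
    proof -
      have "C * (s i * real p) \<le> n * (m i * \<delta>\<^sup>2)" "C * (p * ln p) \<le> n * (m i * \<delta>\<^sup>2)"
        using *[OF that] pos[OF that] by (simp_all add: pos_divide_le_eq)
      moreover have "n * (m i * \<delta>\<^sup>2) = p * (n * (m i * \<eta>\<^sup>2))"
        unfolding \<eta>(4)[symmetric] by (simp only: mult_ac)
      ultimately have "p * (C * s i) \<le> p * (n * (m i * \<eta>\<^sup>2))" "p * (C * ln p) \<le> p * (n * (m i * \<eta>\<^sup>2))"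
        by (simp_all only: mult_ac)
      then show "26880 * \<psi>\<^sup>2 * s i \<le> n * (m i * \<eta>\<^sup>2)" "26880 * \<psi>\<^sup>2 * ln p \<le> n * (m i * \<eta>\<^sup>2)"
        using p0 unfolding C_def by simp_all
    qed
    from spectral_and_frobenius_deviation(2)[OF p cov inv norm \<mu> \<eta>(1,2) this] show ?thesis
      using p0 by (simp add: estimation_error_def \<eta>(3))
  qed
  show "let P = ?P; Sigma_hat = (\<lambda>X. invariant_proj p G (empirical_cov p n X)) in
        (real n \<ge> (26880 * \<psi>\<^sup>2 + 1) * max (MAX i\<in>{..<r}. real (s i) / (real (m i) * \<delta>\<^sup>2))
                            (MAX i\<in>{..<r}. ln (real p) / (real (m i) * \<delta>\<^sup>2)) \<longrightarrow>
          measure P {X \<in> space P. spectral_norm (\<Sigma> - Sigma_hat X) \<le> \<delta>} > 1 - 1 / real p powr 1) \<and>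
        (real n \<ge> (26880 * \<psi>\<^sup>2 + 1) * max (MAX i\<in>{..<r}. real (s i) * real p / (real (m i) * \<delta>\<^sup>2))
                            (MAX i\<in>{..<r}. real p * ln (real p) / (real (m i) * \<delta>\<^sup>2)) \<longrightarrow>
          measure P {X \<in> space P. frob_norm (\<Sigma> - Sigma_hat X) \<le> \<delta>} > 1 - 1 / real p powr 1)"
    unfolding Let_def using a b by blast
qed

end
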